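(* Let $p$ be an odd prime, $A$ a local pro-$p$ domain with maximal ideal $\mathfrak m$, residue field $\mathbb F$ and field of fractions $K$, and $\Pi$ a $p$-finite profinite group. Let $\rho:\Pi\to\mathrm{GL}_2(A)$ be a continuous representation such that $\bar\rho=\rho\bmod\mathfrak m$ is semisimple and multiplicity free. Let $A_0$ be the adjoint trace ring of $\rho$ and $\mathbb E$ its residue field, and assume $\#\mathbb E\ge7$. If the image of $\bar\rho$ contains $\mathrm{SL}_2(\mathbb E)$, then the image of $\rho$ contains $\mathrm{SL}_2(A_0)$ up to conjugation, i.e. $x^{-1}\rho(\Pi)x\supseteq\mathrm{SL}_2(A_0)$ for some $x\in\mathrm{GL}_2(K)$.
   Context: A local pro-$p$ ring is a commutative local topological ring that is an inverse limit of finite rings of $p$-power order, with finite residue field. A profinite group $\Pi$ is $p$-finite if for every open subgroup $\Pi_0\subseteq\Pi$ the set of continuous homomorphisms $\Pi_0\to\mathbb F_p$ is finite. $\bar\rho$ is multiplicity free if it is absolutely irreducible or a sum of two distinct characters $\Pi\to\mathbb F^\times$. The adjoint trace ring $A_0$ of $\rho$ is the closed subring of $A$ topologically generated by $(\operatorname{tr}\rho(g))^2/\det\rho(g)$, $g\in\Pi$; it is local and its residue field $\mathbb E$ is the subfield of $\mathbb F$ generated by $(\operatorname{tr}\bar\rho(g))^2/\det\bar\rho(g)$, $g\in\Pi$. *)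

theory Defs
  imports
    "HOL-Analysis.Analysis"
    "HOL-Algebra.Algebra"
    "HOL-Algebra.Algebraic_Closure_Type"
begin

no_notation fps_nth (infixl \<open>$\<close> 75)

section \<open>Local rings and their residue fields\<close>

class local_ring = comm_ring_1 +
  assumes nonunit_add: "\<not> x dvd 1 \<Longrightarrow> \<not> y dvd 1 \<Longrightarrow> \<not> (x + y) dvd 1"
begin

text \<open>
  Congruence modulo the set of non-units, which is the unique maximal ideal by
  \<open>maximalideal_local_ring\<close> below.
\<close>

definition residue_cong :: "'a \<Rightarrow> 'a \<Rightarrow> bool"
  where "residue_cong x y \<longleftrightarrow> \<not> (x - y) dvd 1"

lemma nonunit_mult: "\<not> x dvd 1 \<Longrightarrow> \<not> (x * y) dvd 1"
  by (meson dvd_mult_left)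

lemma nonunit_minus: "\<not> x dvd 1 \<Longrightarrow> \<not> (- x) dvd 1"
  by simp

lemma equivp_residue_cong: "equivp residue_cong"
proof (rule equivpI)
  show "reflp residue_cong"
    by (simp add: reflp_def residue_cong_def)
  show "symp residue_cong"
    unfolding symp_def residue_cong_def by (metis minus_diff_eq nonunit_minus)
  show "transp residue_cong"
    unfolding transp_def residue_cong_def
  proof (intro allI impI)
    fix x y z assume "\<not> (x - y) dvd 1" "\<not> (y - z) dvd 1"
    from nonunit_add[OF this] show "\<not> (x - z) dvd 1"
      by (simp add: algebra_simps)
  qed
qed

end

lemma ring_of_type_algebra_simps [simp]:
  "carrier (ring_of_type_algebra :: 'a :: comm_ring_1 ring) = UNIV"
  "x \<otimes>\<^bsub>ring_of_type_algebra\<^esub> y = x * (y :: 'a)"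
  "x \<oplus>\<^bsub>ring_of_type_algebra\<^esub> y = x + y"
  "\<one>\<^bsub>ring_of_type_algebra\<^esub> = (1 :: 'a)"
  "\<zero>\<^bsub>ring_of_type_algebra\<^esub> = (0 :: 'a)"
  "\<ominus>\<^bsub>ring_of_type_algebra\<^esub> x = - x"
proof -
  let ?R = "ring_of_type_algebra :: 'a ring"
  interpret ring ?R by (rule ring_from_type_algebra)
  show "carrier ?R = UNIV" "x \<otimes>\<^bsub>?R\<^esub> y = x * y" "x \<oplus>\<^bsub>?R\<^esub> y = x + y" "\<one>\<^bsub>?R\<^esub> = 1" "\<zero>\<^bsub>?R\<^esub> = 0"
    by (simp_all add: ring_of_type_algebra_def)
  then show "\<ominus>\<^bsub>?R\<^esub> x = - x"
    using minus_equality[of "- x" x] by (simp add: ring_of_type_algebra_def)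
qed

lemma maximalideal_local_ring:
  "maximalideal M (ring_of_type_algebra :: 'a :: local_ring ring) \<longleftrightarrow> M = {x. \<not> x dvd 1}"
proof -
  let ?R = "ring_of_type_algebra :: 'a ring"
  let ?N = "{x :: 'a. \<not> x dvd 1}"
  interpret cring ?R by (rule cring_from_type_algebra)
  have N: "ideal ?N ?R"
  proof (rule idealI)
    show "subgroup ?N (add_monoid ?R)"
    proof (rule add.subgroupI)
      show "\<ominus>\<^bsub>?R\<^esub> a \<in> ?N" if "a \<in> ?N" for a
        using that by simp
    qed (use nonunit_add in \<open>auto intro: exI[of _ 0]\<close>)
    show "x \<otimes>\<^bsub>?R\<^esub> a \<in> ?N" "a \<otimes>\<^bsub>?R\<^esub> x \<in> ?N" if "a \<in> ?N" for a x
      using that nonunit_mult[of a x] by (simp_all add: mult.commute)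
  qed (rule ring_axioms)
  have max: "J \<subseteq> ?N" if J: "ideal J ?R" "J \<noteq> UNIV" for J
  proof
    fix x assume x: "x \<in> J"
    interpret J: ideal J ?R by fact
    show "x \<in> ?N"
    proof (rule ccontr)
      assume "x \<notin> ?N"
      then obtain y where "1 = x * y" by (auto elim: dvdE)
      hence "1 \<in> J" using J.I_r_closed[OF x, of y] by simp
      hence "z \<in> J" for z using J.I_l_closed[of 1 z] by simp
      with J(2) show False by auto
    qed
  qed
  have "1 \<notin> ?N" by simp
  show ?thesis
  proof
    assume "maximalideal M ?R"
    then interpret M: maximalideal M ?R .
    have "M \<noteq> UNIV" using M.I_notcarr by simp
    hence "M \<subseteq> ?N" by (rule max[OF M.is_ideal])
    hence "?N = M \<or> ?N = UNIV" using M.I_maximal[OF N] by simp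
    with \<open>1 \<notin> ?N\<close> show "M = ?N" by blast
  next
    assume "M = ?N"
    moreover have "maximalideal ?N ?R"
    proof (rule maximalidealI[OF N])
      show "carrier ?R \<noteq> ?N" unfolding ring_of_type_algebra_simps(1) using \<open>1 \<notin> ?N\<close> by blast
      show "J = ?N \<or> J = carrier ?R" if "ideal J ?R" "?N \<subseteq> J" for J
        using max[OF that(1)] that(2) by auto
    qed
    ultimately show "maximalideal M ?R" by simp
  qed
qed

quotient_type (overloaded) 'a residue_field = "'a :: local_ring" / residue_cong
  by (rule equivp_residue_cong)

lift_definition residue :: "'a :: local_ring \<Rightarrow> 'a residue_field" is "\<lambda>x. x" .

instantiation residue_field :: (local_ring) comm_ring_1
begin

lift_definition zero_residue_field :: "'a residue_field" is 0 .
lift_definition one_residue_field :: "'a residue_field" is 1 .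

lift_definition plus_residue_field :: "'a residue_field \<Rightarrow> 'a residue_field \<Rightarrow> 'a residue_field"
  is "(+)"
  unfolding residue_cong_def by (metis add_diff_add nonunit_add)

lift_definition uminus_residue_field :: "'a residue_field \<Rightarrow> 'a residue_field"
  is uminus
  unfolding residue_cong_def by (metis minus_diff_minus nonunit_minus)

lift_definition minus_residue_field :: "'a residue_field \<Rightarrow> 'a residue_field \<Rightarrow> 'a residue_field"
  is "(-)"
proof -
  fix a b c d :: 'a assume "residue_cong a b" "residue_cong c d"
  hence "\<not> ((a - b) + - (c - d)) dvd 1"
    unfolding residue_cong_def using nonunit_add nonunit_minus by blast
  thus "residue_cong (a - c) (b - d)"
    unfolding residue_cong_def by (simp add: algebra_simps)
qed

lift_definition times_residue_field :: "'a residue_field \<Rightarrow> 'a residue_field \<Rightarrow> 'a residue_field"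
  is "(*)"
proof -
  fix a b c d :: 'a assume "residue_cong a b" "residue_cong c d"
  hence "\<not> ((a - b) * c + (c - d) * b) dvd 1"
    unfolding residue_cong_def using nonunit_add nonunit_mult by blast
  thus "residue_cong (a * c) (b * d)"
    unfolding residue_cong_def by (simp add: algebra_simps)
qed

instance
  by standard (transfer; simp add: algebra_simps residue_cong_def)+

end

lemma residue_0 [simp]: "residue 0 = 0" by transfer (simp add: residue_cong_def)
lemma residue_1 [simp]: "residue 1 = 1" by transfer (simp add: residue_cong_def)
lemma residue_add [simp]: "residue (x + y) = residue x + residue y"
  by transfer (simp add: residue_cong_def)
lemma residue_minus [simp]: "residue (- x) = - residue x"
  by transfer (simp add: residue_cong_def)
lemma residue_diff [simp]: "residue (x - y) = residue x - residue y"
  by transfer (simp add: residue_cong_def)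
lemma residue_mult [simp]: "residue (x * y) = residue x * residue y"
  by transfer (simp add: residue_cong_def)

lemma residue_eq_0_iff: "residue x = 0 \<longleftrightarrow> \<not> x dvd 1"
  by transfer (simp add: residue_cong_def)

lemma residue_surj: "\<exists>x. residue x = r"
  by transfer (rule exI, rule equivp_reflp[OF equivp_residue_cong])

lemma residue_field_right_inverse: "\<exists>s. r * s = 1" if "r \<noteq> 0" for r :: "'a :: local_ring residue_field"
proof -
  obtain x where x: "residue x = r" using residue_surj by blast
  with that have "x dvd 1" using residue_eq_0_iff by blast
  then obtain y where "1 = x * y" by (auto elim: dvdE)
  hence "r * residue y = 1" using x by (metis residue_1 residue_mult)
  thus ?thesis ..
qed

instantiation residue_field :: (local_ring) field
begin

definition inverse_residue_field :: "'a residue_field \<Rightarrow> 'a residue_field"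
  where "inverse_residue_field r = (if r = 0 then 0 else SOME s. r * s = 1)"

definition divide_residue_field :: "'a residue_field \<Rightarrow> 'a residue_field \<Rightarrow> 'a residue_field"
  where "divide_residue_field r s = r * inverse s"

instance
proof
  fix r s :: "'a residue_field"
  show "inverse r * r = 1" if "r \<noteq> 0"
    using someI_ex[OF residue_field_right_inverse[OF that]] that
    by (simp add: inverse_residue_field_def mult.commute)
qed (simp_all add: inverse_residue_field_def divide_residue_field_def)

end


section \<open>Pro-\<open>p\<close> rings\<close>

locale finite_ring_system =
  fixes p :: nat
    and I :: "'i set"
    and le :: "'i \<Rightarrow> 'i \<Rightarrow> bool"
    and R :: "'i \<Rightarrow> 'r ring"
    and \<phi> :: "'i \<Rightarrow> 'i \<Rightarrow> 'r \<Rightarrow> 'r"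
  assumes index_nonempty: "I \<noteq> {}"
    and le_refl: "i \<in> I \<Longrightarrow> le i i"
    and le_trans: "\<lbrakk>i \<in> I; j \<in> I; k \<in> I; le i j; le j k\<rbrakk> \<Longrightarrow> le i k"
    and directed: "\<lbrakk>i \<in> I; j \<in> I\<rbrakk> \<Longrightarrow> \<exists>k\<in>I. le i k \<and> le j k"
    and ring: "i \<in> I \<Longrightarrow> ring (R i)"
    and finite_carrier: "i \<in> I \<Longrightarrow> finite (carrier (R i))"
    and p_power_order: "i \<in> I \<Longrightarrow> \<exists>n. card (carrier (R i)) = p ^ n"
    and transition_hom: "\<lbrakk>i \<in> I; j \<in> I; le i j\<rbrakk> \<Longrightarrow> \<phi> i j \<in> ring_hom (R j) (R i)"
    and transition_refl: "\<lbrakk>i \<in> I; x \<in> carrier (R i)\<rbrakk> \<Longrightarrow> \<phi> i i x = x"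
    and transition_comp:
      "\<lbrakk>i \<in> I; j \<in> I; k \<in> I; le i j; le j k; x \<in> carrier (R k)\<rbrakk> \<Longrightarrow> \<phi> i j (\<phi> j k x) = \<phi> i k x"
begin

definition limit_topology :: "('i \<Rightarrow> 'r) topology"
  where "limit_topology =
    subtopology (product_topology (\<lambda>i. discrete_topology (carrier (R i))) I)
      {x. \<forall>i\<in>I. \<forall>j\<in>I. le i j \<longrightarrow> \<phi> i j (x j) = x i}"

end

text \<open>
  The homeomorphism onto the limit has ring homomorphisms as components, so it is an isomorphism of
  topological rings. Every finite ring has a copy with carrier in \<^typ>\<open>nat\<close>, and a presentation as
  an inverse limit can always be re-indexed by the kernels of its projections, so that taking the
  index set in \<^typ>\<open>'a set\<close> loses no generality.
\<close>

definition pro_p_ring :: "nat \<Rightarrow> 'a :: {comm_ring_1, topological_space} itself \<Rightarrow> bool"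
  where "pro_p_ring p _ \<longleftrightarrow>
    (\<exists>(I :: 'a set set) le (R :: 'a set \<Rightarrow> nat ring) \<phi> (\<pi> :: 'a set \<Rightarrow> 'a \<Rightarrow> nat).
      finite_ring_system p I le R \<phi> \<and>
      (\<forall>i\<in>I. \<pi> i \<in> ring_hom ring_of_type_algebra (R i)) \<and>
      homeomorphic_map euclidean (finite_ring_system.limit_topology I le R \<phi>)
        (\<lambda>a. \<lambda>i\<in>I. \<pi> i a))"

definition local_pro_p_ring ::
    "nat \<Rightarrow> 'a :: {local_ring, topological_ab_group_add, topological_semigroup_mult} itself \<Rightarrow> bool"
  where "local_pro_p_ring p A \<longleftrightarrow> pro_p_ring p A \<and> finite (UNIV :: 'a residue_field set)"


section \<open>Profinite groups\<close>

definition topological_group :: "('g, 'm) monoid_scheme \<Rightarrow> 'g topology \<Rightarrow> bool"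
  where "topological_group G T \<longleftrightarrow>
    group G \<and> topspace T = carrier G \<and>
    continuous_map (prod_topology T T) T (\<lambda>(x, y). x \<otimes>\<^bsub>G\<^esub> y) \<and>
    continuous_map T T (\<lambda>x. inv\<^bsub>G\<^esub> x)"

definition profinite_group :: "('g, 'm) monoid_scheme \<Rightarrow> 'g topology \<Rightarrow> bool"
  where "profinite_group G T \<longleftrightarrow>
    topological_group G T \<and> compact_space T \<and> Hausdorff_space T \<and>
    (\<forall>x\<in>topspace T. connected_component_of_set T x = {x})"

text \<open>Homomorphisms are taken extensional, so that each is counted as a single function.\<close>

definition p_finite :: "nat \<Rightarrow> ('g, 'm) monoid_scheme \<Rightarrow> 'g topology \<Rightarrow> bool"
  where "p_finite p G T \<longleftrightarrow>
    (\<forall>H. subgroup H G \<and> openin T H \<longrightarrow>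
      finite {f \<in> extensional H. f \<in> hom (G\<lparr>carrier := H\<rparr>) (integer_mod_group p) \<and>
        continuous_map (subtopology T H) (discrete_topology (carrier (integer_mod_group p))) f})"


section \<open>Matrix representations\<close>

definition GL :: "('a :: comm_ring_1 ^ 'n ^ 'n) monoid"
  where "GL = \<lparr>carrier = {M. invertible M}, monoid.mult = (**), one = mat 1\<rparr>"

definition SL :: "'a :: comm_ring_1 set \<Rightarrow> ('a ^ 'n ^ 'n) set"
  where "SL S = {M. (\<forall>i j. M $ i $ j \<in> S) \<and> det M = 1}"

definition invariant_subspace ::
    "('g, 'm) monoid_scheme \<Rightarrow> ('g \<Rightarrow> 'f :: field ^ 'n ^ 'n) \<Rightarrow> ('f ^ 'n) set \<Rightarrow> bool"
  where "invariant_subspace G \<sigma> W \<longleftrightarrow>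
    vec.subspace W \<and> (\<forall>g\<in>carrier G. \<forall>w\<in>W. \<sigma> g *v w \<in> W)"

definition irreducible_rep :: "('g, 'm) monoid_scheme \<Rightarrow> ('g \<Rightarrow> 'f :: field ^ 'n ^ 'n) \<Rightarrow> bool"
  where "irreducible_rep G \<sigma> \<longleftrightarrow> (\<forall>W. invariant_subspace G \<sigma> W \<longrightarrow> W = {0} \<or> W = UNIV)"

definition absolutely_irreducible_rep ::
    "('g, 'm) monoid_scheme \<Rightarrow> ('g \<Rightarrow> 'f :: field ^ 'n ^ 'n) \<Rightarrow> bool"
  where "absolutely_irreducible_rep G \<sigma> \<longleftrightarrow> irreducible_rep G (\<lambda>g. map_matrix to_ac (\<sigma> g))"

definition semisimple_rep :: "('g, 'm) monoid_scheme \<Rightarrow> ('g \<Rightarrow> 'f :: field ^ 'n ^ 'n) \<Rightarrow> bool"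
  where "semisimple_rep G \<sigma> \<longleftrightarrow>
    (\<forall>W. invariant_subspace G \<sigma> W \<longrightarrow>
      (\<exists>W'. invariant_subspace G \<sigma> W' \<and> W \<inter> W' = {0} \<and> (\<forall>v. \<exists>w\<in>W. \<exists>w'\<in>W'. v = w + w')))"

definition sum_of_characters ::
    "('g, 'm) monoid_scheme \<Rightarrow> ('g \<Rightarrow> 'f :: field ^ 2 ^ 2) \<Rightarrow> ('g \<Rightarrow> 'f) \<Rightarrow> ('g \<Rightarrow> 'f) \<Rightarrow> bool"
  where "sum_of_characters G \<sigma> \<chi>\<^sub>1 \<chi>\<^sub>2 \<longleftrightarrow>
    \<chi>\<^sub>1 \<in> hom G (units_of ring_of_type_algebra) \<and> \<chi>\<^sub>2 \<in> hom G (units_of ring_of_type_algebra) \<and>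
    (\<exists>P :: 'f ^ 2 ^ 2. invertible P \<and>
      (\<forall>g\<in>carrier G.
        \<sigma> g = P ** vector [vector [\<chi>\<^sub>1 g, 0], vector [0, \<chi>\<^sub>2 g]] ** matrix_inv P))"

definition multiplicity_free_rep :: "('g, 'm) monoid_scheme \<Rightarrow> ('g \<Rightarrow> 'f :: field ^ 2 ^ 2) \<Rightarrow> bool"
  where "multiplicity_free_rep G \<sigma> \<longleftrightarrow>
    absolutely_irreducible_rep G \<sigma> \<or>
    (\<exists>\<chi>\<^sub>1 \<chi>\<^sub>2. sum_of_characters G \<sigma> \<chi>\<^sub>1 \<chi>\<^sub>2 \<and> (\<exists>g\<in>carrier G. \<chi>\<^sub>1 g \<noteq> \<chi>\<^sub>2 g))"

definition residual_rep :: "('g \<Rightarrow> 'a :: local_ring ^ 'n ^ 'n) \<Rightarrow> 'g \<Rightarrow> 'a residue_field ^ 'n ^ 'n"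
  where "residual_rep \<rho> g = map_matrix residue (\<rho> g)"


section \<open>The adjoint trace ring\<close>

text \<open>
  Since \<^term>\<open>det (\<rho> g)\<close> is a unit, the equation determines \<^term>\<open>t\<close> as the quotient of
  \<^term>\<open>(trace (\<rho> g))\<^sup>2\<close> by \<^term>\<open>det (\<rho> g)\<close>.
\<close>

definition adjoint_trace_ring ::
    "('g, 'm) monoid_scheme \<Rightarrow> ('g \<Rightarrow> 'a :: {comm_ring_1, topological_space} ^ 2 ^ 2) \<Rightarrow> 'a set"
  where "adjoint_trace_ring G \<rho> =
    closure (generate_ring ring_of_type_algebra
      {t. \<exists>g\<in>carrier G. t * det (\<rho> g) = (trace (\<rho> g))\<^sup>2})"

text \<open>
  This subfield of the residue field of the coefficient ring is the image of the adjoint trace ring,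
  as \<open>adjoint_trace_ring_residue\<close> below shows.
\<close>

definition adjoint_trace_residue_field ::
    "('g, 'm) monoid_scheme \<Rightarrow> ('g \<Rightarrow> 'a :: local_ring ^ 2 ^ 2) \<Rightarrow> 'a residue_field set"
  where "adjoint_trace_residue_field G \<rho> =
    generate_field ring_of_type_algebra
      {(trace (residual_rep \<rho> g))\<^sup>2 / det (residual_rep \<rho> g) | g. g \<in> carrier G}"

lemma open_nonunits:
  assumes "pro_p_ring p TYPE('a :: {local_ring, topological_ab_group_add, topological_semigroup_mult})"
  shows "open {x :: 'a. \<not> x dvd 1}"
proof -
  let ?R = "ring_of_type_algebra :: 'a ring"
  obtain I :: "'a set set" and le and R :: "'a set \<Rightarrow> nat ring" and \<phi> and \<pi> :: "'a set \<Rightarrow> 'a \<Rightarrow> nat"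
    where sys: "finite_ring_system p I le R \<phi>"
      and hom: "\<forall>i\<in>I. \<pi> i \<in> ring_hom ring_of_type_algebra (R i)"
      and homeo: "homeomorphic_map euclidean (finite_ring_system.limit_topology I le R \<phi>) (\<lambda>a. \<lambda>i\<in>I. \<pi> i a)"
    using assms unfolding pro_p_ring_def by blast
  interpret finite_ring_system p I le R \<phi> by fact
  have "inj (\<lambda>a. \<lambda>i\<in>I. \<pi> i a)"
    using homeomorphic_imp_injective_map[OF homeo] by simp
  hence "(\<lambda>i\<in>I. \<pi> i (1::'a)) \<noteq> (\<lambda>i\<in>I. \<pi> i 0)"
    using inj_eq[of "\<lambda>a. \<lambda>i\<in>I. \<pi> i a" 1 "0 :: 'a"] by simp
  then obtain i where i: "i \<in> I" "\<pi> i 1 \<noteq> \<pi> i (0::'a)"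
    by (meson restrict_ext)
  interpret Ri: ring "R i" using ring[OF i(1)] .
  interpret R: ring ?R by (rule ring_from_type_algebra)
  have h: "\<pi> i \<in> ring_hom ?R (R i)" using hom i by blast
  have z: "\<pi> i 0 = \<zero>\<^bsub>R i\<^esub>"
    using ring_hom_zero[OF h R.ring_axioms Ri.ring_axioms] by simp
  have cont: "continuous_map euclidean (discrete_topology (carrier (R i))) (\<pi> i)"
  proof -
    have "continuous_map euclidean (product_topology (\<lambda>i. discrete_topology (carrier (R i))) I) (\<lambda>a. \<lambda>i\<in>I. \<pi> i a)"
      using homeomorphic_imp_continuous_map[OF homeo] unfolding limit_topology_def
      by (simp add: continuous_map_in_subtopology)
    from continuous_map_componentwise[THEN iffD1, OF this] i(1)
    have "continuous_map euclidean (discrete_topology (carrier (R i))) (\<lambda>a. (\<lambda>i\<in>I. \<pi> i a) i)"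
      by blast
    with i(1) show ?thesis by (simp add: eta_contract_eq)
  qed
  define K where "K = {a. \<pi> i a = \<pi> i 0}"
  have "openin (discrete_topology (carrier (R i))) {\<zero>\<^bsub>R i\<^esub>}" by simp
  from openin_continuous_map_preimage[OF cont this] have oK: "open K"
    by (simp add: K_def z)
  have KN: "\<not> a dvd 1" if "a \<in> K" for a
  proof
    assume "a dvd 1"
    then obtain b where "1 = a * b" by (auto elim: dvdE)
    hence "\<pi> i 1 = \<pi> i a \<otimes>\<^bsub>R i\<^esub> \<pi> i b"
      using ring_hom_mult[OF h, of a b] by simp
    also have "\<dots> = \<pi> i 0"
      using that ring_hom_closed[OF h, of b] by (simp add: K_def z)
    finally show False using i by simp
  qed
  show ?thesis
  proof (subst open_subopen, intro ballI)
    fix x :: 'a assume x: "x \<in> {x. \<not> x dvd 1}"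
    have "open ((\<lambda>y. y - x) -` K)"
      by (intro open_vimage oK continuous_intros)
    moreover have "x \<in> (\<lambda>y. y - x) -` K" by (simp add: K_def)
    moreover have "(\<lambda>y. y - x) -` K \<subseteq> {x. \<not> x dvd 1}"
    proof
      fix y assume "y \<in> (\<lambda>y. y - x) -` K"
      with KN have "\<not> (y - x) dvd 1" by simp
      with x nonunit_add[of "y - x" x] show "y \<in> {x. \<not> x dvd 1}" by simp
    qed
    ultimately show "\<exists>T. open T \<and> x \<in> T \<and> T \<subseteq> {x. \<not> x dvd 1}" by blast
  qed
qed

lemma residue_image_closure:
  fixes S :: "'a :: {local_ring, topological_ab_group_add, topological_semigroup_mult} set"
  assumes "pro_p_ring p TYPE('a)"
  shows "residue ` closure S = residue ` S"
proof
  show "residue ` closure S \<subseteq> residue ` S"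
  proof clarify
    fix x assume x: "x \<in> closure S"
    let ?U = "(\<lambda>y. y - x) -` {x. \<not> x dvd 1}"
    have "open ?U" by (intro open_vimage open_nonunits[OF assms] continuous_intros)
    moreover have "x \<in> ?U" by simp
    ultimately obtain y where y: "y \<in> S" "\<not> (y - x) dvd 1"
      using x unfolding closure_iff_nhds_not_empty by blast
    hence "residue y = residue x"
      using residue_eq_0_iff[of "y - x"] by simp
    thus "residue x \<in> residue ` S" using y by (metis image_eqI)
  qed
qed (use closure_subset in blast)

lemma adjoint_trace_ring_residue:
  fixes \<rho> :: "'g \<Rightarrow> 'a :: {local_ring, topological_ab_group_add, topological_semigroup_mult} ^ 2 ^ 2"
  assumes "local_pro_p_ring p TYPE('a)" "\<And>g. g \<in> carrier G \<Longrightarrow> det (\<rho> g) dvd 1"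
  shows "residue ` adjoint_trace_ring G \<rho> = adjoint_trace_residue_field G \<rho>"
proof -
  let ?R = "ring_of_type_algebra :: 'a ring"
  let ?F = "ring_of_type_algebra :: 'a residue_field ring"
  interpret R: ring ?R by (rule ring_from_type_algebra)
  interpret F: field ?F by (rule field_from_type_algebra)
  have inv: "inv\<^bsub>?F\<^esub> x = inverse x" if "x \<noteq> 0" for x
    using F.comm_inv_char[of x "inverse x"] that by simp
  define S where "S = {t. \<exists>g\<in>carrier G. t * det (\<rho> g) = (trace (\<rho> g))\<^sup>2}"
  define T where "T = {(trace (residual_rep \<rho> g))\<^sup>2 / det (residual_rep \<rho> g) | g. g \<in> carrier G}"
  have tr: "trace (residual_rep \<rho> g) = residue (trace (\<rho> g))" for g
    by (simp add: residual_rep_def trace_def sum_2)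
  have dt: "det (residual_rep \<rho> g) = residue (det (\<rho> g))" for g
    by (simp add: residual_rep_def det_2)
  have ST: "residue ` S = T"
  proof (intro equalityI subsetI)
    fix r assume "r \<in> residue ` S"
    then obtain t g where tg: "r = residue t" "g \<in> carrier G" "t * det (\<rho> g) = (trace (\<rho> g))\<^sup>2"
      by (auto simp: S_def)
    have "residue t * residue (det (\<rho> g)) = (residue (trace (\<rho> g)))\<^sup>2"
      using arg_cong[OF tg(3), of residue] by (simp add: power2_eq_square)
    moreover have "residue (det (\<rho> g)) \<noteq> 0" using assms(2)[OF tg(2)] by (simp add: residue_eq_0_iff)
    ultimately have "r = (trace (residual_rep \<rho> g))\<^sup>2 / det (residual_rep \<rho> g)"
      by (simp add: tr dt tg(1) field_simps)
    with tg(2) show "r \<in> T" unfolding T_def by blast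
  next
    fix r assume "r \<in> T"
    then obtain g where g: "g \<in> carrier G" "r = (trace (residual_rep \<rho> g))\<^sup>2 / det (residual_rep \<rho> g)"
      by (auto simp: T_def)
    obtain d where d: "1 = det (\<rho> g) * d" using assms(2)[OF g(1)] by (auto elim: dvdE)
    define t where "t = (trace (\<rho> g))\<^sup>2 * d"
    have t: "t * det (\<rho> g) = (trace (\<rho> g))\<^sup>2"
      using d by (simp add: t_def mult.assoc mult.commute[of d])
    have "residue t * residue (det (\<rho> g)) = (residue (trace (\<rho> g)))\<^sup>2"
      using arg_cong[OF t, of residue] by (simp add: power2_eq_square)
    moreover have "residue (det (\<rho> g)) \<noteq> 0" using assms(2)[OF g(1)] by (simp add: residue_eq_0_iff)
    ultimately have "r = residue t" by (simp add: tr dt g(2) field_simps)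
    moreover have "t \<in> S" using t g(1) by (auto simp: S_def)
    ultimately show "r \<in> residue ` S" by blast
  qed
  have gen: "residue ` generate_ring ?R S = generate_ring ?F T"
  proof (intro equalityI subsetI)
    fix r assume "r \<in> residue ` generate_ring ?R S"
    then obtain x where "x \<in> generate_ring ?R S" "r = residue x" by blast
    then show "r \<in> generate_ring ?F T"
    proof (induction arbitrary: r)
      case one thus ?case using generate_ring.one[of ?F T] by simp
    next
      case (incl h) thus ?case using ST by (auto intro: generate_ring.incl)
    next
      case (a_inv h) thus ?case using generate_ring.a_inv[of "residue h" ?F T] by simp
    next
      case (eng_add h1 h2) thus ?case using generate_ring.eng_add[of "residue h1" ?F T "residue h2"] by simp
    next
      case (eng_mult h1 h2) thus ?case using generate_ring.eng_mult[of "residue h1" ?F T "residue h2"] by simp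
    qed
  next
    fix r assume "r \<in> generate_ring ?F T"
    then show "r \<in> residue ` generate_ring ?R S"
    proof induction
      case one show ?case using imageI[OF generate_ring.one[of ?R S], of residue] by simp
    next
      case (incl h) thus ?case using ST by (auto intro: generate_ring.incl)
    next
      case (a_inv h)
      then obtain x where "h = residue x" "x \<in> generate_ring ?R S" by blast
      thus ?case using imageI[OF generate_ring.a_inv[of x ?R S], of residue] by simp
    next
      case (eng_add h1 h2)
      then obtain x y where "h1 = residue x" "x \<in> generate_ring ?R S" "h2 = residue y" "y \<in> generate_ring ?R S"
        by blast
      thus ?case using imageI[OF generate_ring.eng_add[of x ?R S y], of residue] by simp
    next
      case (eng_mult h1 h2)
      then obtain x y where "h1 = residue x" "x \<in> generate_ring ?R S" "h2 = residue y" "y \<in> generate_ring ?R S"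
        by blast
      thus ?case using imageI[OF generate_ring.eng_mult[of x ?R S y], of residue] by simp
    qed
  qed
  have fin: "finite (UNIV :: 'a residue_field set)"
    using assms(1) by (simp add: local_pro_p_ring_def)
  have pow: "x ^ n \<in> generate_ring ?F T" if "x \<in> generate_ring ?F T" for x and n :: nat
  proof (induction n)
    case 0 show ?case using generate_ring.one[of ?F T] by simp
  next
    case (Suc n) thus ?case using generate_ring.eng_mult[OF that Suc.IH] by simp
  qed
  have fld: "generate_ring ?F T = generate_field ?F T"
  proof (intro equalityI subsetI)
    fix r assume "r \<in> generate_ring ?F T"
    then show "r \<in> generate_field ?F T"
      by induction (blast intro: generate_field.intros)+
  next
    fix r assume "r \<in> generate_field ?F T"
    then show "r \<in> generate_ring ?F T"
    proof induction
      case (m_inv h)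
      hence h: "h \<noteq> 0" by simp
      have "\<not> inj (\<lambda>n::nat. h ^ n)"
        using finite_imageD[OF finite_subset[OF subset_UNIV fin]] infinite_UNIV_nat by blast
      then obtain a b :: nat where "a \<noteq> b" "h ^ a = h ^ b" by (auto simp: inj_def)
      then obtain a b :: nat where ab: "a < b" "h ^ a = h ^ b" by (metis nat_neq_iff)
      then obtain c where c: "b = a + Suc c" by (auto simp: less_iff_Suc_add)
      have "h ^ a * h ^ Suc c = h ^ a * 1" using ab(2) unfolding c power_add by simp
      hence "h ^ Suc c = 1" using h by (simp del: power_Suc)
      hence "h * h ^ c = 1" by simp
      hence "h ^ c = inverse h" using h by (metis inverse_unique)
      with pow[OF m_inv.IH, of c] inv[OF h] show ?case by simp
    qed (blast intro: generate_ring.intros)+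
  qed
  show ?thesis
    using residue_image_closure[of p "generate_ring ?R S"] assms(1) gen fld
    by (simp add: adjoint_trace_ring_def adjoint_trace_residue_field_def local_pro_p_ring_def S_def T_def)
qed

end

theory Submission
  imports Defs
begin

text \<open>
  Let \<open>R\<close> be the adjoint trace ring, \<open>\<bbbE>\<close> its residue field and \<open>\<Gamma>\<close> the image of the representation, up
  to a conjugation that is chosen as follows. As \<open>\<bbbE>\<close> has at least seven elements, it contains a unit
  \<open>a\<close> with \<open>a\<^sup>4 \<noteq> 1\<close>. An element of the image that reduces to \<open>diag(a, 1/a)\<close> is diagonalised by Hensel's
  lemma; the ratio \<open>r\<close> of its eigenvalues lies in \<open>R\<close> (\<open>closed_subring_root\<close>), and \<open>r\<close>, \<open>1\<close>, \<open>1/r\<close> stay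
  distinct modulo the maximal ideal. A second conjugation, by a diagonal matrix, makes one further
  element with unit entries a scalar multiple of a matrix over \<open>R\<close>.

  The adjoint traces of the products of \<open>g \<in> \<Gamma>\<close> with powers of the diagonal element and with the
  second element are combinations of the products \<open>XY / det g\<close> of two entries of \<open>g\<close>. Inverting a
  Vandermonde matrix puts all these products into \<open>R\<close>, so that every \<open>g \<in> \<Gamma>\<close> is a scalar multiple of a
  matrix over \<open>R\<close> (\<open>scaling\<close>). Hence commutators of elements of \<open>\<Gamma>\<close> lie in \<open>H = \<Gamma> \<inter> SL\<^sub>2(R)\<close>; this group
  is normalised by \<open>\<Gamma>\<close> and maps onto \<open>SL\<^sub>2(\<bbbE>)\<close>.

  It remains to see that \<open>H\<close> maps onto \<open>SL\<^sub>2(R / J)\<close> for every ideal \<open>J\<close> of \<open>R\<close> that contains an open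
  one; compactness of the group then gives \<open>SL\<^sub>2(R) \<subseteq> \<Gamma>\<close>. The proof descends through the ideals of finite
  index. In one step \<open>J \<subset> J1 = J + Rj\<close>, where the maximal ideal annihilates \<open>j\<close> modulo \<open>J\<close>, and \<open>H\<close> is known
  to map onto \<open>SL\<^sub>2(R / J1)\<close>. The elements of \<open>H\<close> congruent to \<open>1\<close> modulo \<open>J1\<close> form, modulo \<open>J\<close>, an additive
  group of trace zero matrices over the line \<open>J1 / J\<close>, stable under conjugation by \<open>H\<close>. Unless it is
  zero, it contains all trace zero matrices, and then \<open>H\<close> maps onto \<open>SL\<^sub>2(R / J)\<close>
  (\<open>full_of_not_rigid\<close>). If it is zero, then \<open>H\<close> modulo \<open>J\<close> is a group-theoretic section of
  \<open>SL\<^sub>2(R / J) \<rightarrow> SL\<^sub>2(R / J1)\<close>. The torus forces this section to preserve elementary matrices, and the entry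
  of the lifted elementary matrix is, up to a unit, a section of rings \<open>R / J1 \<rightarrow> R / J\<close>. Its image is
  \<open>S / J\<close> for a subring \<open>S\<close> of \<open>R\<close> that misses \<open>j\<close>. As \<open>\<Gamma>\<close> normalises \<open>H\<close>, which is conjugate to
  \<open>SL\<^sub>2(S / J)\<close> modulo \<open>J\<close>, all adjoint traces of \<open>\<Gamma>\<close> lie in \<open>S\<close> (\<open>normaliser_trace\<close>). But these traces
  generate \<open>R\<close> topologically and \<open>S\<close> is open in \<open>R\<close>, which is absurd.
\<close>

section \<open>Two-by-two matrices\<close>

definition mat2 :: "'a::zero \<Rightarrow> 'a \<Rightarrow> 'a \<Rightarrow> 'a \<Rightarrow> 'a ^ 2 ^ 2"
  where "mat2 a b c d = vector [vector [a, b], vector [c, d]]"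

lemma mat2_nth [simp]:
  "mat2 a b c d $ 1 $ 1 = a" "mat2 a b c d $ 1 $ 2 = b"
  "mat2 a b c d $ 2 $ 1 = c" "mat2 a b c d $ 2 $ 2 = d"
  by (simp_all add: mat2_def)

lemma mat2_eta: "M = mat2 (M$1$1) (M$1$2) (M$2$1) (M$2$2)"
  by (simp add: vec_eq_iff forall_2)

lemma mat2_cases: obtains a b c d where "M = mat2 a b c d"
  using mat2_eta by blast

lemma mat2_eq_iff [simp]:
  "mat2 a b c d = mat2 a' b' c' d' \<longleftrightarrow> a = a' \<and> b = b' \<and> c = c' \<and> d = d'"
  by (auto simp: vec_eq_iff forall_2)

lemma mat2_mult [simp]:
  fixes a :: "'a :: comm_ring_1"
  shows "mat2 a b c d ** mat2 a' b' c' d' =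
    mat2 (a * a' + b * c') (a * b' + b * d') (c * a' + d * c') (c * b' + d * d')"
  by (simp add: vec_eq_iff forall_2 matrix_matrix_mult_def sum_2)

lemma mat_1_mat2: "(mat 1 :: 'a::comm_ring_1 ^ 2 ^ 2) = mat2 1 0 0 1"
  by (simp add: vec_eq_iff forall_2 mat_def)

lemma det_mat2 [simp]: "det (mat2 a b c d) = a * d - b * (c :: 'a::comm_ring_1)"
  by (simp add: det_2)

lemma trace_mat2 [simp]: "trace (mat2 a b c d) = a + (d :: 'a::comm_ring_1)"
  by (simp add: trace_def sum_2)

lemma transpose_mat2 [simp]: "transpose (mat2 a b c d) = mat2 a c b d"
  by (simp add: vec_eq_iff forall_2 transpose_def)

definition adj2 :: "'a::comm_ring_1 ^ 2 ^ 2 \<Rightarrow> 'a ^ 2 ^ 2"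
  where "adj2 M = mat2 (M$2$2) (- M$1$2) (- M$2$1) (M$1$1)"

lemma adj2_mat2 [simp]: "adj2 (mat2 a b c d) = mat2 d (- b) (- c) a"
  by (simp add: adj2_def)

definition mats :: "'a set \<Rightarrow> ('a ^ 2 ^ 2) set"
  where "mats S = {M. \<forall>i j. M $ i $ j \<in> S}"

lemma mat2_mats [simp]: "mat2 a b c d \<in> mats S \<longleftrightarrow> a \<in> S \<and> b \<in> S \<and> c \<in> S \<and> d \<in> S"
  by (auto simp: mats_def forall_2)

definition mcong :: "'a::comm_ring_1 set \<Rightarrow> 'a ^ 2 ^ 2 \<Rightarrow> 'a ^ 2 ^ 2 \<Rightarrow> bool"
  where "mcong J M N \<longleftrightarrow> (\<forall>i j. M $ i $ j - N $ i $ j \<in> J)"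

lemma mcong_mat2 [simp]:
  "mcong J (mat2 a b c d) (mat2 a' b' c' d') \<longleftrightarrow> a - a' \<in> J \<and> b - b' \<in> J \<and> c - c' \<in> J \<and> d - d' \<in> J"
  by (auto simp: mcong_def forall_2)

lemma mcong_mono: "mcong J M N \<Longrightarrow> J \<subseteq> J' \<Longrightarrow> mcong J' M N"
  by (auto simp: mcong_def)

text \<open>
  Transposition exchanges the two kinds of elementary matrices; it halves the work below.
\<close>

lemma mcong_transpose: "mcong J (transpose M) (transpose N) \<longleftrightarrow> mcong J M N"
  by (auto simp: mcong_def transpose_def)

section \<open>Local subrings and their ideals\<close>

lemma unit_iff_residue: "x dvd 1 \<longleftrightarrow> residue x \<noteq> 0" for x :: "'a::local_ring"
  using residue_eq_0_iff by blast

lemma residue_2: "residue 2 = 2"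
  using residue_add[of 1 1] by simp

lemma residue_power: "residue (x ^ n) = residue x ^ n"
  by (induction n) simp_all

text \<open>
  The adjoint trace ring is a subset of the coefficient ring rather than a type. Closure under inverses
  that exist in the big ring makes it local, its maximal ideal being its set of non-units.
\<close>

locale local_subring =
  fixes R :: "'a::{idom,local_ring} set"
  assumes one_closed: "1 \<in> R"
    and diff_closed: "x \<in> R \<Longrightarrow> y \<in> R \<Longrightarrow> x - y \<in> R"
    and mult_closed: "x \<in> R \<Longrightarrow> y \<in> R \<Longrightarrow> x * y \<in> R"
    and inverse_closed: "x \<in> R \<Longrightarrow> x * y = 1 \<Longrightarrow> y \<in> R"
    and two_unit: "(2::'a) dvd 1"
begin

lemma zero_closed: "0 \<in> R"
  using diff_closed[OF one_closed one_closed] by simp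

lemma minus_closed: "x \<in> R \<Longrightarrow> - x \<in> R"
  using diff_closed[OF zero_closed, of x] by simp

lemma add_closed: "x \<in> R \<Longrightarrow> y \<in> R \<Longrightarrow> x + y \<in> R"
  using diff_closed[of x "- y"] minus_closed[of y] by simp

lemma power_closed: "x \<in> R \<Longrightarrow> x ^ n \<in> R"
  by (induction n) (auto intro: one_closed mult_closed)

lemma two_closed: "2 \<in> R"
  using add_closed[OF one_closed one_closed] by simp

lemmas closed = zero_closed one_closed two_closed add_closed diff_closed minus_closed mult_closed
  power_closed

lemma unit_inverse:
  assumes "u \<in> R" "u dvd 1" shows "\<exists>v\<in>R. u * v = 1"
  using assms inverse_closed by (metis dvdE)

lemma half: "\<exists>h\<in>R. 2 * h = 1"
  by (rule unit_inverse[OF two_closed two_unit])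

definition ideal_of :: "'a set \<Rightarrow> bool"
  where "ideal_of J \<longleftrightarrow> J \<subseteq> R \<and> 0 \<in> J \<and> (\<forall>x\<in>J. \<forall>y\<in>J. x + y \<in> J) \<and> (\<forall>a\<in>R. \<forall>x\<in>J. a * x \<in> J)"

lemma ideal_ofD:
  assumes "ideal_of J"
  shows "x \<in> J \<Longrightarrow> x \<in> R" "0 \<in> J" "x \<in> J \<Longrightarrow> y \<in> J \<Longrightarrow> x + y \<in> J"
    "x \<in> J \<Longrightarrow> y \<in> J \<Longrightarrow> x - y \<in> J" "x \<in> J \<Longrightarrow> - x \<in> J"
    "a \<in> R \<Longrightarrow> x \<in> J \<Longrightarrow> a * x \<in> J" "a \<in> R \<Longrightarrow> x \<in> J \<Longrightarrow> x * a \<in> J"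
proof -
  have *: "- x \<in> J" if "x \<in> J" for x
    using assms that minus_closed[OF one_closed] unfolding ideal_of_def
    by (metis mult_minus1)
  show "x \<in> J \<Longrightarrow> - x \<in> J" by (rule *)
  show "x \<in> J \<Longrightarrow> y \<in> J \<Longrightarrow> x - y \<in> J"
    using *[of y] assms unfolding ideal_of_def by (metis add_uminus_conv_diff)
qed (use assms in \<open>auto simp: ideal_of_def mult.commute[of x a]\<close>)

lemma ideal_adjoin:
  assumes J: "ideal_of J" and j: "j \<in> R"
  shows "ideal_of {x + a * j | x a. x \<in> J \<and> a \<in> R}" (is "ideal_of ?J1")
  unfolding ideal_of_def
proof (intro conjI ballI)
  show "?J1 \<subseteq> R" using j ideal_ofD(1)[OF J] by (auto intro!: closed)
  have "0 + 0 * j \<in> ?J1" using ideal_ofD(2)[OF J] zero_closed by blast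
  then show "0 \<in> ?J1" by simp
  fix x assume "x \<in> ?J1"
  then obtain y a where x: "x = y + a * j" "y \<in> J" "a \<in> R" by blast
  show "x + x' \<in> ?J1" if x': "x' \<in> ?J1" for x'
  proof -
    obtain y' a' where x': "x' = y' + a' * j" "y' \<in> J" "a' \<in> R" using x' by blast
    have "x + x' = (y + y') + (a + a') * j" by (simp add: x x' algebra_simps)
    then show ?thesis using ideal_ofD(3)[OF J x(2) x'(2)] add_closed[OF x(3) x'(3)] by blast
  qed
  show "c * x \<in> ?J1" if "c \<in> R" for c
  proof -
    have "c * x = c * y + (c * a) * j" by (simp add: x algebra_simps)
    then show ?thesis using ideal_ofD(6)[OF J that x(2)] mult_closed[OF that x(3)] by blast
  qed
qed

lemma mats_mult: "M \<in> mats R \<Longrightarrow> N \<in> mats R \<Longrightarrow> M ** N \<in> mats R"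
  by (cases M rule: mat2_cases, cases N rule: mat2_cases) (auto intro!: closed)

lemma mcong_refl: "ideal_of J \<Longrightarrow> mcong J M M"
  by (simp add: mcong_def ideal_ofD(2))

lemma mcong_sym: "ideal_of J \<Longrightarrow> mcong J M N \<Longrightarrow> mcong J N M"
  unfolding mcong_def
proof (intro allI)
  fix i k assume J: "ideal_of J" "\<forall>i j. M $ i $ j - N $ i $ j \<in> J"
  show "N $ i $ k - M $ i $ k \<in> J" using ideal_ofD(5)[OF J(1) J(2)[rule_format, of i k]] by simp
qed

lemma mcong_trans: "ideal_of J \<Longrightarrow> mcong J M N \<Longrightarrow> mcong J N P \<Longrightarrow> mcong J M P"
  unfolding mcong_def
proof (intro allI)
  fix i k assume J: "ideal_of J" "\<forall>i j. M $ i $ j - N $ i $ j \<in> J" "\<forall>i j. N $ i $ j - P $ i $ j \<in> J"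
  show "M $ i $ k - P $ i $ k \<in> J"
    using ideal_ofD(3)[OF J(1) J(2)[rule_format, of i k] J(3)[rule_format, of i k]] by simp
qed

lemma mcong_mult:
  assumes "ideal_of J" "mcong J M M'" "mcong J N N'" "M \<in> mats R" "N' \<in> mats R"
  shows "mcong J (M ** N) (M' ** N')"
proof -
  have 1: "x * y + z * w - (x' * y' + z' * w') \<in> J"
    if "x - x' \<in> J" "y - y' \<in> J" "z - z' \<in> J" "w - w' \<in> J" "x \<in> R" "z \<in> R" "y' \<in> R" "w' \<in> R"
    for x y z w x' y' z' w'
  proof -
    have "x * y + z * w - (x' * y' + z' * w') =
        x * (y - y') + y' * (x - x') + (z * (w - w') + w' * (z - z'))"
      by (simp add: algebra_simps)
    also have "\<dots> \<in> J" using that by (intro ideal_ofD(3,6)[OF assms(1)])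
    finally show ?thesis .
  qed
  show ?thesis
    using assms(2-)
    by (cases M rule: mat2_cases, cases N rule: mat2_cases,
        cases M' rule: mat2_cases, cases N' rule: mat2_cases) (auto intro!: 1)
qed

end

abbreviation nonunits :: "'a::comm_ring_1 set" where "nonunits \<equiv> {x. \<not> x dvd 1}"

context local_subring begin

lemma local_subring_UNIV: "local_subring (UNIV :: 'a set)"
  by unfold_locales (use two_unit in auto)

lemma nonunits_ideal: "local_subring.ideal_of UNIV (nonunits :: 'a set)"
proof -
  interpret U: local_subring "UNIV :: 'a set" by (rule local_subring_UNIV)
  have "\<not> (a * x) dvd 1" if "\<not> x dvd 1" for a x :: 'a
    using nonunit_mult[OF that, of a] by (simp add: mult.commute)
  then show ?thesis unfolding U.ideal_of_def by (simp add: nonunit_add)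
qed

lemma mcong_nonunits_mult:
  fixes M N :: "'a ^ 2 ^ 2"
  shows "mcong nonunits M M' \<Longrightarrow> mcong nonunits N N' \<Longrightarrow> mcong nonunits (M ** N) (M' ** N')"
proof -
  interpret U: local_subring "UNIV :: 'a set" by (rule local_subring_UNIV)
  show "mcong nonunits M M' \<Longrightarrow> mcong nonunits N N' \<Longrightarrow> mcong nonunits (M ** N) (M' ** N')"
    by (rule U.mcong_mult[OF nonunits_ideal]) (simp_all add: mats_def)
qed

end

definition elem_upper :: "'a::comm_ring_1 \<Rightarrow> 'a ^ 2 ^ 2" where "elem_upper b = mat2 1 b 0 1"
definition elem_lower :: "'a::comm_ring_1 \<Rightarrow> 'a ^ 2 ^ 2" where "elem_lower c = mat2 1 0 c 1"

lemmas elem_defs = elem_upper_def elem_lower_def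

text \<open>Over a local ring a matrix of determinant one with a unit in the lower left corner is a product of
  three elementary matrices, and one elementary factor moves a unit to that corner.\<close>

lemma (in local_subring) SL_elementary_induct:
  assumes mult: "\<And>M N. P M \<Longrightarrow> P N \<Longrightarrow> P (M ** N)"
    and elem: "\<And>b. b \<in> R \<Longrightarrow> P (elem_upper b)" "\<And>b. b \<in> R \<Longrightarrow> P (elem_lower b)"
    and M: "M \<in> mats R" "det M = 1"
  shows "P M"
proof -
  have unit: "P (mat2 a b c d)" if m: "mat2 a b c d \<in> mats R" "a * d - b * c = 1" "c dvd 1" for a b c d
  proof -
    have mR: "a \<in> R" "b \<in> R" "c \<in> R" "d \<in> R" using m(1) by simp_all
    obtain e where e: "e \<in> R" "c * e = 1" using unit_inverse[OF mR(3) m(3)] by blast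
    have "P (elem_upper ((a - 1) * e) ** elem_lower c ** elem_upper ((d - 1) * e))"
      by (intro mult elem closed mR e)
    moreover have "1 + (a - 1) * e * c = a" "d = 1 + c * ((d - 1) * e)"
      "b = a * ((d - 1) * e) + (a - 1) * e" using e(2) m(2) by Groebner_Basis.algebra+
    then have "elem_upper ((a - 1) * e) ** elem_lower c ** elem_upper ((d - 1) * e) = mat2 a b c d"
      by (simp add: elem_defs add.commute)
    ultimately show ?thesis by simp
  qed
  obtain a b c d where abcd: "M = mat2 a b c d" by (rule mat2_cases)
  have mR: "a \<in> R" "b \<in> R" "c \<in> R" "d \<in> R" and det: "a * d - b * c = 1" using M by (simp_all add: abcd)
  show ?thesis
  proof (cases "c dvd 1")
    case True then show ?thesis using unit[of a b c d] M abcd by simp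
  next
    case False
    have "\<not> (b * c) dvd 1" using nonunit_mult[OF False, of b] by (simp add: mult.commute)
    then have "(a * d) dvd 1"
      using nonunit_add[of "a * d" "- (b * c)"] nonunit_minus det by auto
    then have "a dvd 1" by (rule dvd_mult_left)
    then have "(c + a) dvd 1"
      using nonunit_add[of "c + a" "- c"] nonunit_minus[OF False] by auto
    then have "P (mat2 a b (c + a) (d + b))"
      using mR det by (intro unit) (auto intro: closed simp: algebra_simps)
    from mult[OF elem(2)[OF minus_closed[OF one_closed]] this] show ?thesis
      by (simp add: abcd elem_defs)
  qed
qed

section \<open>One step of the descent\<close>

text \<open>
  The situation of one step of the descent: \<open>j\<close> spans a line over the residue field modulo \<open>J\<close>, and \<open>H\<close>
  contains lifts of all elementary matrices modulo \<open>J + Rj\<close>. The two torus assumptions are conjugation by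
  a diagonal matrix with ratio \<open>r\<close> and by its inverse; having both makes the situation symmetric under
  transposition. That matrix itself may have a determinant different from \<open>1\<close> and so need not be in \<open>H\<close>.
\<close>

locale congruence_step = local_subring R for R :: "'a::{idom,local_ring} set" +
  fixes H :: "('a ^ 2 ^ 2) set" and J :: "'a set" and j r r' :: 'a
  assumes J: "ideal_of J" and j: "j \<in> R" "\<not> j dvd 1" "j \<notin> J"
    and J_nonunit: "x \<in> J \<Longrightarrow> \<not> x dvd 1"
    and nonunit_j: "m \<in> R \<Longrightarrow> \<not> m dvd 1 \<Longrightarrow> m * j \<in> J"
    and r: "r \<in> R" "r * r' = 1" "(r\<^sup>2 - 1) dvd 1"
    and H_mats: "H \<subseteq> mats R"
    and H_det: "h \<in> H \<Longrightarrow> det h = 1"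
    and H_one: "mat 1 \<in> H"
    and H_mult: "h \<in> H \<Longrightarrow> k \<in> H \<Longrightarrow> h ** k \<in> H"
    and H_adj: "h \<in> H \<Longrightarrow> adj2 h \<in> H"
    and H_torus: "mat2 a b c d \<in> H \<Longrightarrow> mat2 a (r * b) (r' * c) d \<in> H"
      "mat2 a b c d \<in> H \<Longrightarrow> mat2 a (r' * b) (r * c) d \<in> H"
    and full: "b \<in> R \<Longrightarrow> \<exists>h\<in>H. mcong {x + a * j | x a. x \<in> J \<and> a \<in> R} h (elem_upper b)"
      "b \<in> R \<Longrightarrow> \<exists>h\<in>H. mcong {x + a * j | x a. x \<in> J \<and> a \<in> R} h (elem_lower b)"
begin

definition "J1 = {x + a * j | x a. x \<in> J \<and> a \<in> R}"

lemma transposed: "congruence_step R (transpose ` H) J j r r'"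
proof unfold_locales
  fix h k assume "h \<in> transpose ` H" "k \<in> transpose ` H"
  then obtain h' k' where hk: "h' \<in> H" "k' \<in> H" "h = transpose h'" "k = transpose k'" by blast
  have "h ** k = transpose (k' ** h')" unfolding hk(3,4) by (rule matrix_transpose_mul[symmetric])
  then show "h ** k \<in> transpose ` H" using H_mult[OF hk(2,1)] by blast
next
  fix h assume "h \<in> transpose ` H"
  then show "adj2 h \<in> transpose ` H"
    using H_adj by (force simp: adj2_def vec_eq_iff forall_2 transpose_def image_iff)
next
  fix a b c d assume "mat2 a b c d \<in> transpose ` H"
  then have "mat2 a c b d \<in> H" by (metis image_iff transpose_mat2 transpose_transpose)
  from H_torus[OF this] show "mat2 a (r * b) (r' * c) d \<in> transpose ` H" "mat2 a (r' * b) (r * c) d \<in> transpose ` H"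
    by (metis image_iff transpose_mat2)+
next
  fix b assume b: "b \<in> R"
  show "\<exists>h\<in>transpose ` H. mcong {x + a * j | x a. x \<in> J \<and> a \<in> R} h (elem_upper b)"
    using full(2)[OF b] mcong_transpose[of _ _ "elem_lower b"] by (force simp: elem_defs)
  show "\<exists>h\<in>transpose ` H. mcong {x + a * j | x a. x \<in> J \<and> a \<in> R} h (elem_lower b)"
    using full(1)[OF b] mcong_transpose[of _ _ "elem_upper b"] by (force simp: elem_defs)
next
  show "mat 1 \<in> transpose ` H" using H_one by (metis image_iff transpose_mat)
  show "transpose ` H \<subseteq> mats R" using H_mats by (auto simp: mats_def transpose_def)
qed (use J j J_nonunit nonunit_j r H_det in \<open>auto simp: det_transpose\<close>)

lemma J1: "ideal_of J1"
  unfolding J1_def by (rule ideal_adjoin[OF J j(1)])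

lemma J_subset_J1: "J \<subseteq> J1"
proof
  fix x assume "x \<in> J"
  moreover have "x = x + 0 * j" by simp
  ultimately show "x \<in> J1" unfolding J1_def using zero_closed by blast
qed

lemma j_J1: "j \<in> J1"
proof -
  have "j = 0 + 1 * j" by simp
  then show ?thesis unfolding J1_def using ideal_ofD(2)[OF J] one_closed by blast
qed

lemma J1_nonunit:
  assumes "x \<in> J1" shows "\<not> x dvd 1"
proof -
  obtain y a where x: "x = y + j * a" "y \<in> J" "a \<in> R" using assms by (auto simp: J1_def mult.commute)
  show ?thesis unfolding x(1) by (intro nonunit_add nonunit_mult j(2) J_nonunit x(2))
qed

lemmas Jc = ideal_ofD[OF J]
lemmas J1c = ideal_ofD[OF J1]

lemma nonunit_J1: "m \<in> R \<Longrightarrow> \<not> m dvd 1 \<Longrightarrow> x \<in> J1 \<Longrightarrow> m * x \<in> J"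
proof -
  assume m: "m \<in> R" "\<not> m dvd 1" and "x \<in> J1"
  then obtain y a where x: "x = y + a * j" "y \<in> J" "a \<in> R" by (auto simp: J1_def)
  have "m * x = m * y + a * (m * j)" by (simp add: x algebra_simps)
  then show ?thesis using Jc(3)[OF Jc(6)[OF m(1) x(2)] Jc(6)[OF x(3) nonunit_j[OF m]]] by simp
qed

lemma J1_mult: "x \<in> J1 \<Longrightarrow> y \<in> J1 \<Longrightarrow> x * y \<in> J"
  by (rule nonunit_J1[OF J1c(1) J1_nonunit])

lemma unit_cancel: "u \<in> R \<Longrightarrow> u dvd 1 \<Longrightarrow> u * x \<in> J \<Longrightarrow> x \<in> J"
proof -
  assume u: "u \<in> R" "u dvd 1" "u * x \<in> J"
  obtain v where v: "v \<in> R" "u * v = 1" using unit_inverse[OF u(1,2)] by blast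
  have "x = (u * v) * x" using v(2) by simp
  also have "\<dots> = v * (u * x)" by (simp only: ac_simps)
  finally show ?thesis using Jc(6)[OF v(1) u(3)] by (simp only:)
qed

lemma unit_shift: "u dvd 1 \<Longrightarrow> v - u \<in> J1 \<Longrightarrow> v dvd 1"
proof (rule ccontr)
  assume "u dvd 1" "v - u \<in> J1" "\<not> v dvd 1"
  then have "\<not> (v + - (v - u)) dvd 1"
    using J1_nonunit[of "v - u"] nonunit_add[of v "- (v - u)"] nonunit_minus by blast
  then show False using \<open>u dvd 1\<close> by simp
qed

text \<open>\<open>J1 / J\<close> is a line over the residue field, so any element outside \<open>J\<close> spans it.\<close>

lemma J1_span:
  assumes "z \<in> J1" "z \<notin> J" "y \<in> J1" obtains a where "a \<in> R" "y - a * z \<in> J"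
proof -
  obtain x c where z: "z = x + c * j" "x \<in> J" "c \<in> R" using assms(1) by (auto simp: J1_def)
  obtain x' c' where y: "y = x' + c' * j" "x' \<in> J" "c' \<in> R" using assms(3) by (auto simp: J1_def)
  have "c dvd 1"
    using z assms(2) nonunit_j[of c] Jc(3)[of x "c * j"] by auto
  then obtain v where v: "v \<in> R" "c * v = 1" using unit_inverse[OF z(3)] by blast
  have "y - (c' * v) * z = x' - (c' * v) * x + (c' - c' * (c * v)) * j"
    by (simp add: y(1) z(1) algebra_simps)
  also have "\<dots> = x' - (c' * v) * x" by (simp add: v)
  also have "\<dots> \<in> J" using v y z by (intro Jc(4,6) closed)
  finally show ?thesis using that mult_closed[OF y(3) v(1)] by blast
qed

lemma r'_closed: "r' \<in> R"
  using inverse_closed r by blast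

lemma r_minus_1: "(r - 1) dvd 1"
proof -
  have "r\<^sup>2 - 1 = (r - 1) * (r + 1)" by (simp add: power2_eq_square algebra_simps)
  with r(3) have "(r - 1) * (r + 1) dvd 1" by (simp only:)
  then show ?thesis by (rule dvd_mult_left)
qed

end

section \<open>Lifts that are not unique\<close>

context congruence_step begin

text \<open>
  \<open>V\<close> describes the kernel of \<open>H\<close> modulo \<open>J \<rightarrow> H\<close> modulo \<open>J1\<close> inside the trace zero matrices
  \<open>(x, y; z, - x)\<close>. Multiplication in \<open>H\<close> becomes addition because products of two elements of \<open>J1\<close> lie in
  \<open>J\<close>.
\<close>

definition V where "V x y z \<longleftrightarrow> x \<in> J1 \<and> y \<in> J1 \<and> z \<in> J1 \<and> (\<exists>k\<in>H. mcong J k (mat2 (1 + x) y z (1 - x)))"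

lemma V_J1: "V x y z \<Longrightarrow> x \<in> J1" "V x y z \<Longrightarrow> y \<in> J1" "V x y z \<Longrightarrow> z \<in> J1"
  by (simp_all add: V_def)

lemma V_cong:
  assumes "V x y z" "x - x' \<in> J" "y - y' \<in> J" "z - z' \<in> J" shows "V x' y' z'"
proof -
  obtain k where k: "k \<in> H" "mcong J k (mat2 (1 + x) y z (1 - x))" using assms(1) by (auto simp: V_def)
  have "mcong J (mat2 (1 + x) y z (1 - x)) (mat2 (1 + x') y' z' (1 - x'))"
    using assms(2-4) Jc(5)[OF assms(2)] by simp
  from mcong_trans[OF J k(2) this] have 1: "mcong J k (mat2 (1 + x') y' z' (1 - x'))" .
  have 2: "w' \<in> J1" if "w \<in> J1" "w - w' \<in> J" for w w'
  proof -
    from J1c(4)[OF that(1) subsetD[OF J_subset_J1 that(2)]] show ?thesis by simp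
  qed
  show ?thesis unfolding V_def using 1 k(1) 2[OF V_J1(1)[OF assms(1)] assms(2)]
      2[OF V_J1(2)[OF assms(1)] assms(3)] 2[OF V_J1(3)[OF assms(1)] assms(4)] by blast
qed

lemma V_add:
  assumes "V x y z" "V x' y' z'" shows "V (x + x') (y + y') (z + z')"
proof -
  obtain k where k: "k \<in> H" "mcong J k (mat2 (1 + x) y z (1 - x))" using assms(1) by (auto simp: V_def)
  obtain k' where k': "k' \<in> H" "mcong J k' (mat2 (1 + x') y' z' (1 - x'))" using assms(2) by (auto simp: V_def)
  note m = V_J1[OF assms(1)] V_J1[OF assms(2)]
  note mR = m[THEN J1c(1)]
  have "mcong J (k ** k') (mat2 (1 + x) y z (1 - x) ** mat2 (1 + x') y' z' (1 - x'))"
    by (rule mcong_mult[OF J k(2) k'(2)]) (simp_all add: closed mR subsetD[OF H_mats k(1)])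
  also have "mcong J (mat2 (1 + x) y z (1 - x) ** mat2 (1 + x') y' z' (1 - x'))
     (mat2 (1 + (x + x')) (y + y') (z + z') (1 - (x + x')))"
  proof -
    have "(1 + x) * (1 + x') + y * z' - (1 + (x + x')) = x * x' + y * z'"
      "(1 + x) * y' + y * (1 - x') - (y + y') = x * y' - y * x'"
      "z * (1 + x') + (1 - x) * z' - (z + z') = z * x' - x * z'"
      "z * y' + (1 - x) * (1 - x') - (1 - (x + x')) = z * y' + x * x'"
      by Groebner_Basis.algebra+
    moreover have "x * x' + y * z' \<in> J" "x * y' - y * x' \<in> J" "z * x' - x * z' \<in> J" "z * y' + x * x' \<in> J"
      using m by (auto intro!: Jc(3,4) J1_mult)
    ultimately show ?thesis by (simp only: mat2_mult mcong_mat2 simp_thms)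
  qed
  finally (mcong_trans[OF J]) show ?thesis using H_mult[OF k(1) k'(1)] m unfolding V_def by (auto intro: J1c(3))
qed

lemma V_minus:
  assumes "V x y z" shows "V (- x) (- y) (- z)"
proof -
  obtain k where k: "k \<in> H" "mcong J k (mat2 (1 + x) y z (1 - x))" using assms(1) by (auto simp: V_def)
  obtain a b c d where abcd: "k = mat2 a b c d" by (rule mat2_cases)
  have kJ: "a - (1 + x) \<in> J" "b - y \<in> J" "c - z \<in> J" "d - (1 - x) \<in> J"
    using k(2) unfolding abcd mcong_mat2 by blast+
  have "mcong J (adj2 k) (mat2 (1 + - x) (- y) (- z) (1 - - x))"
    using kJ Jc(5)[OF kJ(2)] Jc(5)[OF kJ(3)] by (simp add: abcd)
  then show ?thesis using H_adj[OF k(1)] V_J1[OF assms] unfolding V_def by (auto intro: J1c(5))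
qed

lemma V_diff: "V x y z \<Longrightarrow> V x' y' z' \<Longrightarrow> V (x - x') (y - y') (z - z')"
  using V_add[OF _ V_minus, of x y z x' y' z'] by simp

text \<open>
  Conjugation by an elementary matrix. A lift of this matrix modulo \<open>J1\<close> suffices, since errors in \<open>J1\<close> are
  multiplied by entries in \<open>J1\<close>.
\<close>

lemma V_conj_upper:
  assumes "V x y z" "b \<in> R" shows "V (x + b * z) (y - 2 * b * x - b\<^sup>2 * z) z"
proof -
  obtain k where k: "k \<in> H" "mcong J k (mat2 (1 + x) y z (1 - x))" using assms(1) by (auto simp: V_def)
  obtain n where n: "n \<in> H" "mcong J1 n (elem_upper b)" using full(1)[OF assms(2)] unfolding J1_def by blast
  obtain n1 n2 n3 n4 where n': "n = mat2 n1 n2 n3 n4" by (rule mat2_cases)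
  note m = V_J1[OF assms(1)]
  have nR: "n1 \<in> R" "n2 \<in> R" "n3 \<in> R" "n4 \<in> R" using n(1) H_mats by (auto simp: n')
  have det: "n1 * n4 - n2 * n3 = 1" using H_det[OF n(1)] by (simp add: n')
  have nJ: "n1 - 1 \<in> J1" "n2 - b \<in> J1" "n3 \<in> J1" "n4 - 1 \<in> J1"
    using n(2) by (simp_all add: n' elem_defs)
  note mR = m[THEN J1c(1)]
  have "mcong J (n ** k ** adj2 n) (n ** mat2 (1 + x) y z (1 - x) ** adj2 n)"
    by (rule mcong_mult[OF J mcong_mult[OF J mcong_refl[OF J] k(2)] mcong_refl[OF J]])
       (simp_all add: closed mats_mult n' mR nR subsetD[OF H_mats k(1)] del: mat2_mult)
  also have "mcong J (n ** mat2 (1 + x) y z (1 - x) ** adj2 n)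
      (mat2 (1 + (x + b * z)) (y - 2 * b * x - b\<^sup>2 * z) z (1 - (x + b * z)))"
  proof -
    have p: "n1 * n4 - 1 \<in> J1" "n2 * n4 - b \<in> J1" "n1 * n2 - b \<in> J1" "n1 * n1 - 1 \<in> J1"
      "n2 * n2 - b * b \<in> J1" "n4 * n4 - 1 \<in> J1"
    proof -
      have e: "n1 * n4 - 1 = n1 * (n4 - 1) + (n1 - 1)" "n2 * n4 - b = n2 * (n4 - 1) + (n2 - b)"
        "n1 * n2 - b = n2 * (n1 - 1) + (n2 - b)" "n1 * n1 - 1 = n1 * (n1 - 1) + (n1 - 1)"
        "n2 * n2 - b * b = n2 * (n2 - b) + b * (n2 - b)" "n4 * n4 - 1 = n4 * (n4 - 1) + (n4 - 1)"
        by Groebner_Basis.algebra+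
      show "n1 * n4 - 1 \<in> J1" "n2 * n4 - b \<in> J1" "n1 * n2 - b \<in> J1" "n1 * n1 - 1 \<in> J1"
        "n2 * n2 - b * b \<in> J1" "n4 * n4 - 1 \<in> J1"
        unfolding e using nJ nR assms(2) by (auto intro!: J1c(3,6))
    qed
    have "(n1 * (1 + x) + n2 * z) * n4 + (n1 * y + n2 * (1 - x)) * - n3 - (1 + (x + b * z)) =
       x * (n1 * n4 - 1) + x * (n2 * n3) + z * (n2 * n4 - b) - n1 * (n3 * y)"
      using det by Groebner_Basis.algebra
    moreover have "\<dots> \<in> J" using m p nJ nR by (intro Jc(3,4,6) J1_mult) (auto intro: J1c(6))
    moreover have "(n1 * (1 + x) + n2 * z) * - n2 + (n1 * y + n2 * (1 - x)) * n1 - (y - 2 * b * x - b\<^sup>2 * z) =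
       y * (n1 * n1 - 1) - 2 * (x * (n1 * n2 - b)) - z * (n2 * n2 - b * b)"
      by Groebner_Basis.algebra
    moreover have "\<dots> \<in> J" using m p nJ nR by (intro Jc(3,4,6) J1_mult) (auto intro: J1c(6) closed)
    moreover have "(n3 * (1 + x) + n4 * z) * n4 + (n3 * y + n4 * (1 - x)) * - n3 - z =
       z * (n4 * n4 - 1) + 2 * (n4 * (n3 * x)) - n3 * (n3 * y)"
      by Groebner_Basis.algebra
    moreover have "\<dots> \<in> J" using m p nJ nR by (intro Jc(3,4,6) J1_mult) (auto intro: J1c(6) closed)
    moreover have "(n3 * (1 + x) + n4 * z) * - n2 + (n3 * y + n4 * (1 - x)) * n1 - (1 - (x + b * z)) =
      n1 * (n3 * y) - (x * (n1 * n4 - 1) + x * (n2 * n3) + z * (n2 * n4 - b))"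
      using det by Groebner_Basis.algebra
    moreover have "\<dots> \<in> J" using m p nJ nR by (intro Jc(3,4,6) J1_mult) (auto intro: J1c(6) closed)
    ultimately show ?thesis by (simp add: n')
  qed
  finally (mcong_trans[OF J]) have "mcong J (n ** k ** adj2 n)
      (mat2 (1 + (x + b * z)) (y - 2 * b * x - b\<^sup>2 * z) z (1 - (x + b * z)))" .
  moreover have "n ** k ** adj2 n \<in> H" using n(1) k(1) by (intro H_mult H_adj)
  moreover have "x + b * z \<in> J1" "y - 2 * b * x - b\<^sup>2 * z \<in> J1"
    using m assms(2) by (auto intro!: J1c(3,4,6) closed)
  ultimately show ?thesis unfolding V_def using m by blast
qed

lemma V_transposed: "congruence_step.V R (transpose ` H) J j x z y \<longleftrightarrow> V x y z"
proof -
  interpret T: congruence_step R "transpose ` H" J j r r' by (rule transposed)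
  have "mcong J (transpose k) (mat2 (1 + x) z y (1 - x)) \<longleftrightarrow> mcong J k (mat2 (1 + x) y z (1 - x))" for k
    by (cases k rule: mat2_cases) auto
  then show ?thesis unfolding T.V_def V_def by auto
qed

lemma V_conj_lower:
  assumes "V x y z" "c \<in> R" shows "V (x + c * y) y (z - 2 * c * x - c\<^sup>2 * y)"
proof -
  interpret T: congruence_step R "transpose ` H" J j r r' by (rule transposed)
  show ?thesis
    using T.V_conj_upper[OF V_transposed[THEN iffD2, OF assms(1)] assms(2)]
    by (rule V_transposed[THEN iffD1])
qed

lemma upper_of_multiples:
  assumes "\<And>b. b \<in> R \<Longrightarrow> V 0 (b * z) 0" "z \<in> J1" "z \<notin> J" "y \<in> J1" shows "V 0 y 0"
proof -
  obtain a where a: "a \<in> R" "y - a * z \<in> J" using J1_span[OF assms(2-4)] .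
  have "a * z - y \<in> J" using Jc(5)[OF a(2)] by simp
  then show ?thesis using V_cong[OF assms(1)[OF a(1)], of 0 y 0] Jc(2) by simp
qed

text \<open>
  A second difference in the parameter of the conjugation leaves only the upper entry
  \<open>- 2 b\<^sup>2 z\<close>, and the elements \<open>2 b\<^sup>2\<close> generate \<open>R\<close> additively because \<open>2\<close> is a unit.
\<close>

lemma V_upper_of_lower_entry:
  assumes V: "V x y z" and z: "z \<notin> J" and y': "y' \<in> J1" shows "V 0 y' 0"
proof (rule upper_of_multiples[OF _ V_J1(3)[OF V] z y'])
  have sq: "V 0 (- 2 * b\<^sup>2 * z) 0" if b: "b \<in> R" for b
  proof -
    have "V (x + b * z) (y - 2 * b * x - b\<^sup>2 * z) z" "V (x - b * z) (y + 2 * b * x - b\<^sup>2 * z) z"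
      using V_conj_upper[OF V b] V_conj_upper[OF V minus_closed[OF b]] by simp_all
    from V_diff[OF V_add[OF this] V_add[OF V V]] show ?thesis by (simp add: algebra_simps)
  qed
  fix b assume b: "b \<in> R"
  obtain h where h: "h \<in> R" "2 * h = 1" using half by blast
  have "V 0 (- 2 * (h * (h * b - 1))\<^sup>2 * z - (- 2 * (h * (h * b + 1))\<^sup>2 * z)) 0"
    using V_diff[OF sq[of "h * (h * b - 1)"] sq[of "h * (h * b + 1)"]] h b by (auto intro!: closed)
  moreover
  have "- 2 * (h * (h * b - 1))\<^sup>2 * z - (- 2 * (h * (h * b + 1))\<^sup>2 * z) = (2 * h) * (2 * h) * (2 * h) * b * z"
    by Groebner_Basis.algebra
  then have "- 2 * (h * (h * b - 1))\<^sup>2 * z - (- 2 * (h * (h * b + 1))\<^sup>2 * z) = b * z" using h(2) by simp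
  ultimately show "V 0 (b * z) 0" by simp
qed

lemma V_upper_of_nonzero:
  assumes V: "V x y z" and nz: "x \<notin> J \<or> y \<notin> J \<or> z \<notin> J" and y': "y' \<in> J1" shows "V 0 y' 0"
proof -
  consider "z \<notin> J" | "z \<in> J" "x \<notin> J" | "z \<in> J" "x \<in> J" "y \<notin> J" using nz by blast
  then show ?thesis
  proof cases
    case 1 then show ?thesis using V_upper_of_lower_entry[OF V _ y'] by blast
  next
    case 2
    show ?thesis
    proof (rule upper_of_multiples[OF _ V_J1(1)[OF V] 2(2) y'])
      fix b assume b: "b \<in> R"
      obtain h where h: "h \<in> R" "2 * h = 1" using half by blast
      have *: "- h * b \<in> R" using h b by (intro closed)
      have "V (- h * b * z) (- 2 * (- h * b) * x - (- h * b)\<^sup>2 * z) 0"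
        using V_diff[OF V_conj_upper[OF V *] V] by simp
      then show "V 0 (b * x) 0"
      proof (rule V_cong)
        have "- 2 * (- h * b) * x - (- h * b)\<^sup>2 * z - b * x = (2 * h) * b * x - b * x - ((- h * b)\<^sup>2 * z)" by Groebner_Basis.algebra
        also have "\<dots> = - ((- h * b)\<^sup>2 * z)" using h(2) by simp
        finally have "- 2 * (- h * b) * x - (- h * b)\<^sup>2 * z - b * x = - ((- h * b)\<^sup>2 * z)" .
        moreover have "\<dots> \<in> J" using 2 * by (intro Jc(5,6) power_closed) auto
        ultimately show "- 2 * (- h * b) * x - (- h * b)\<^sup>2 * z - b * x \<in> J" by (simp only:)
        show "- h * b * z - 0 \<in> J" using Jc(6)[OF * 2(1)] by simp
      qed (use Jc(2) in simp)
    qed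
  next
    case 3
    interpret T: congruence_step R "transpose ` H" J j r r' by (rule transposed)
      have "T.V 0 j 0"
      using T.V_upper_of_lower_entry[OF V_transposed[THEN iffD2, OF V] 3(3) j_J1] .
    then have "V 0 0 j" by (rule V_transposed[THEN iffD1])
    from V_upper_of_lower_entry[OF this j(3) y'] show ?thesis .
  qed
qed

text \<open>
  From upper matrices, conjugation by lower elementary matrices yields diagonal ones. So the trace zero
  matrices over \<open>J1 / J\<close> have no proper non-zero stable subgroup.
\<close>

lemma V_full:
  assumes V: "V x y z" and nz: "x \<notin> J \<or> y \<notin> J \<or> z \<notin> J" and m: "x' \<in> J1" "y' \<in> J1" "z' \<in> J1"
  shows "V x' y' z'"
proof -
  interpret T: congruence_step R "transpose ` H" J j r r' by (rule transposed)
  have up: "V 0 y 0" if "y \<in> J1" for y using V_upper_of_nonzero[OF V nz that] .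
  have V': "T.V x z y" using V by (rule V_transposed[THEN iffD2])
  have nz': "x \<notin> J \<or> z \<notin> J \<or> y \<notin> J" using nz by blast
  have low: "V 0 0 z" if "z \<in> J1" for z
    using T.V_upper_of_nonzero[OF V' nz' that] by (rule V_transposed[THEN iffD1])
  have "V x' x' (- x')" using V_conj_lower[OF up[OF m(1)] one_closed] by simp
  from V_add[OF V_diff[OF this up[OF m(1)]] low[OF m(1)]] have "V x' 0 0" by simp
  from V_add[OF V_add[OF this up[OF m(2)]] low[OF m(3)]] show ?thesis by simp
qed

text \<open>
  A lift modulo \<open>J1\<close> is corrected by the element of the kernel that cancels its error.
\<close>

lemma full_upper_of_V_full:
  assumes V: "\<And>x y z. x \<in> J1 \<Longrightarrow> y \<in> J1 \<Longrightarrow> z \<in> J1 \<Longrightarrow> V x y z" and b: "b \<in> R"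
  shows "\<exists>h\<in>H. mcong J h (elem_upper b)"
proof -
  obtain h where h: "h \<in> H" "mcong J1 h (elem_upper b)" using full(1)[OF b] unfolding J1_def by blast
  obtain h1 h2 h3 h4 where h': "h = mat2 h1 h2 h3 h4" by (rule mat2_cases)
  have hR: "h1 \<in> R" "h2 \<in> R" "h3 \<in> R" "h4 \<in> R" using h(1) H_mats by (auto simp: h')
  have det: "h1 * h4 - h2 * h3 = 1" using H_det[OF h(1)] by (simp add: h')
  have hJ: "h1 - 1 \<in> J1" "h2 - b \<in> J1" "h3 \<in> J1" "h4 - 1 \<in> J1"
    using h(2) by (simp_all add: h' elem_defs)
  define x where "x = h4 - 1"
  define y where "y = h2 - b * h4"
  have y: "y = (h2 - b) - b * (h4 - 1)" by (simp add: y_def algebra_simps)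
  have m: "x \<in> J1" "y \<in> J1" using hJ b unfolding y x_def by (auto intro!: J1c(4,6))
  obtain k where k: "k \<in> H" "mcong J k (mat2 (1 + x) (- y) (- h3) (1 - x))"
    using V[OF m(1) J1c(5)[OF m(2)] J1c(5)[OF hJ(3)]] unfolding V_def by blast
  have "mcong J (h ** k) (h ** mat2 (1 + x) (- y) (- h3) (1 - x))"
    by (rule mcong_mult[OF J mcong_refl[OF J] k(2)])
      (simp_all add: closed m[THEN J1c(1)] hR subsetD[OF H_mats h(1)])
  also have "mcong J (h ** mat2 (1 + x) (- y) (- h3) (1 - x)) (elem_upper b)"
  proof -
    have "h1 * (1 + x) + h2 * - h3 - 1 = 0" "h3 * (1 + x) + h4 * - h3 - 0 = 0"
      using det by (simp_all add: x_def algebra_simps)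
    then have e: "h1 * (1 + x) + h2 * - h3 - 1 \<in> J" "h3 * (1 + x) + h4 * - h3 - 0 \<in> J"
      using Jc(2) by (simp_all only:)
    have "h1 * - y + h2 * (1 - x) - b = - ((h1 - 1) * y) - (h2 - b) * x"
      "h3 * - y + h4 * (1 - x) - 1 = - (h3 * y) - (h4 - 1) * x"
      unfolding y_def x_def by Groebner_Basis.algebra+
    moreover have "- ((h1 - 1) * y) - (h2 - b) * x \<in> J" "- (h3 * y) - (h4 - 1) * x \<in> J"
      using hJ m by (auto intro!: Jc(4,5) J1_mult)
    ultimately have "h1 * - y + h2 * (1 - x) - b \<in> J" "h3 * - y + h4 * (1 - x) - 1 \<in> J"
      by (simp_all only:)
    with e show ?thesis unfolding h' elem_defs mat2_mult mcong_mat2 by blast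
  qed
  finally (mcong_trans[OF J]) show ?thesis using H_mult[OF h(1) k(1)] by blast
qed

lemma V_of_not_rigid:
  assumes hk: "h \<in> H" "k \<in> H" "mcong J1 h k" "\<not> mcong J h k"
  obtains x y z where "V x y z" "x \<notin> J \<or> y \<notin> J \<or> z \<notin> J"
proof -
  obtain h1 h2 h3 h4 where h': "h = mat2 h1 h2 h3 h4" by (rule mat2_cases)
  have hR: "h1 \<in> R" "h2 \<in> R" "h3 \<in> R" "h4 \<in> R" using hk(1) H_mats by (auto simp: h')
  obtain k1 k2 k3 k4 where k': "k = mat2 k1 k2 k3 k4" by (rule mat2_cases)
  have kR: "k1 \<in> R" "k2 \<in> R" "k3 \<in> R" "k4 \<in> R" using hk(2) H_mats by (auto simp: k')
  have det: "h1 * h4 - h2 * h3 = 1" "k1 * k4 - k2 * k3 = 1" using H_det[OF hk(1)] H_det[OF hk(2)] by (simp_all add: h' k')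
  define n where "n = k ** adj2 h"
  have n: "n \<in> H" unfolding n_def using hk by (intro H_mult H_adj)
  have hm: "h \<in> mats R" "k \<in> mats R" using hk H_mats by auto
  have n1: "mcong J1 n (mat 1)"
  proof -
    have "mcong J1 n (h ** adj2 h)" unfolding n_def
      using hR hm by (intro mcong_mult[OF J1 mcong_sym[OF J1 hk(3)] mcong_refl[OF J1]]) (auto simp: h' intro: closed)
    moreover have "h ** adj2 h = mat 1" using det(1) by (simp add: h' mat_1_mat2 algebra_simps)
    ultimately show ?thesis by simp
  qed
  have n2: "\<not> mcong J n (mat 1)"
  proof
    assume "mcong J n (mat 1)"
    from mcong_mult[OF J this mcong_refl[OF J, of h]] n H_mats hm have "mcong J (n ** h) h" by (auto simp: matrix_mul_lid)
    moreover have "adj2 h ** h = mat 1" using det(1) by (simp add: h' mat_1_mat2 algebra_simps)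
    then have "n ** h = k" unfolding n_def by (simp add: matrix_mul_assoc[symmetric])
    ultimately show False using hk(4) mcong_sym[OF J] by blast
  qed
  obtain a b c d where n': "n = mat2 a b c d" by (rule mat2_cases)
  have nJ: "a - 1 \<in> J1" "b \<in> J1" "c \<in> J1" "d - 1 \<in> J1" using n1 by (simp_all add: n' mat_1_mat2)
  have "a * d - b * c = 1" using H_det[OF n] by (simp add: n')
  then have "d - (1 - (a - 1)) = b * c - (a - 1) * (d - 1)" by Groebner_Basis.algebra
  then have d: "d - (1 - (a - 1)) \<in> J" using nJ by (auto intro!: Jc(4) J1_mult)
  have "mcong J n (mat2 (1 + (a - 1)) b c (1 - (a - 1)))" using d Jc(2) by (simp add: n')
  then have V: "V (a - 1) b c" unfolding V_def using nJ n by blast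
  have nz: "a - 1 \<notin> J \<or> b \<notin> J \<or> c \<notin> J"
  proof (rule ccontr)
    assume *: "\<not> ?thesis"
    have "d - 1 = (d - (1 - (a - 1))) - (a - 1)" by simp
    then have "d - 1 \<in> J" using d * Jc(4) by metis
    then show False using n2 * by (simp add: n' mat_1_mat2)
  qed
  show thesis using that V nz by blast
qed

lemma full_of_not_rigid:
  assumes hk: "h \<in> H" "k \<in> H" "mcong J1 h k" "\<not> mcong J h k" and b: "b \<in> R"
  shows "\<exists>h\<in>H. mcong J h (elem_upper b)" "\<exists>h\<in>H. mcong J h (elem_lower b)"
proof -
  obtain x y z where V: "V x y z" "x \<notin> J \<or> y \<notin> J \<or> z \<notin> J" using V_of_not_rigid[OF hk] .
  note VF = V_full[OF V]
  show "\<exists>h\<in>H. mcong J h (elem_upper b)" using full_upper_of_V_full[OF VF b] .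
  interpret T: congruence_step R "transpose ` H" J j r r' by (rule transposed)
  have "\<exists>h\<in>transpose ` H. mcong J h (elem_upper b)"
    by (intro T.full_upper_of_V_full b V_transposed[THEN iffD2] VF)
  then obtain h where h: "h \<in> H" "mcong J (transpose h) (elem_upper b)" by blast
  have "elem_upper b = transpose (elem_lower b)" by (simp add: elem_defs)
  with h(2) have "mcong J h (elem_lower b)" using mcong_transpose[of J h "elem_lower b"] by (simp only:)
  with h(1) show "\<exists>h\<in>H. mcong J h (elem_lower b)" by blast
qed

end

section \<open>Unique lifts\<close>

text \<open>
  Here \<open>H\<close> modulo \<open>J\<close> is a section of \<open>SL\<^sub>2(R / J) \<rightarrow> SL\<^sub>2(R / J1)\<close>: two words in \<open>H\<close> that agree modulo \<open>J1\<close>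
  agree modulo \<open>J\<close>. Every relation below is obtained by comparing two such words.
\<close>

locale rigid_step = congruence_step +
  assumes rigid: "h \<in> H \<Longrightarrow> k \<in> H \<Longrightarrow> mcong J1 h k \<Longrightarrow> mcong J h k"
begin

lemma rigid_transposed: "rigid_step R (transpose ` H) J j r r'"
proof -
  interpret T: congruence_step R "transpose ` H" J j r r' by (rule transposed)
  show ?thesis
  proof unfold_locales
    fix h k assume "h \<in> transpose ` H" "k \<in> transpose ` H" and *: "mcong J1 h k"
    then obtain h' k' where hk: "h' \<in> H" "k' \<in> H" "h = transpose h'" "k = transpose k'" by blast
    have "mcong J1 h' k'" using * unfolding hk(3,4) by (rule mcong_transpose[THEN iffD1])
    from rigid[OF hk(1,2) this] show "mcong J h k" unfolding hk(3,4) by (rule mcong_transpose[THEN iffD2])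
  qed
qed

lemma H_R:
  assumes "mat2 a b c d \<in> H" shows "a \<in> R" "b \<in> R" "c \<in> R" "d \<in> R" "a * d - b * c = 1"
  using subsetD[OF H_mats assms] H_det[OF assms] by simp_all

lemma elem_mats: "b \<in> R \<Longrightarrow> elem_upper b \<in> mats R" "b \<in> R \<Longrightarrow> elem_lower b \<in> mats R"
  by (simp_all add: elem_defs zero_closed one_closed)

lemma elem_upper_mult: "elem_upper a ** elem_upper b = elem_upper (a + b :: 'a)"
  by (simp add: elem_defs add.commute)

lemma upper_commute:
  assumes h: "mat2 a b c d \<in> H" "mcong J1 (mat2 a b c d) (elem_upper y)" "y \<in> R"
    and k: "mat2 a' b' c' d' \<in> H" "mcong J1 (mat2 a' b' c' d') (elem_upper z)" "z \<in> R"
  shows "y * c' - z * c \<in> J"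
proof -
  let ?h = "mat2 a b c d" and ?k = "mat2 a' b' c' d'"
  have "mcong J1 (?h ** ?k) (elem_upper (y + z))"
    using mcong_mult[OF J1 h(2) k(2) subsetD[OF H_mats h(1)] elem_mats(1)[OF k(3)]]
    unfolding elem_upper_mult .
  moreover have "mcong J1 (?k ** ?h) (elem_upper (y + z))"
    using mcong_mult[OF J1 k(2) h(2) subsetD[OF H_mats k(1)] elem_mats(1)[OF h(3)]]
    unfolding elem_upper_mult by (simp only: add.commute)
  ultimately have "mcong J1 (?h ** ?k) (?k ** ?h)"
    using mcong_trans[OF J1 _ mcong_sym[OF J1]] by blast
  from rigid[OF H_mult[OF h(1) k(1)] H_mult[OF k(1) h(1)] this]
  have 1: "a * a' + b * c' - (a' * a + b' * c) \<in> J" by simp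
  have m: "b - y \<in> J1" "b' - z \<in> J1" "c \<in> J1" "c' \<in> J1" using h(2) k(2) by (simp_all add: elem_defs)
  have "y * c' - z * c = (a * a' + b * c' - (a' * a + b' * c)) - (b - y) * c' + (b' - z) * c"
    by (simp add: algebra_simps)
  also have "\<dots> \<in> J" by (intro Jc(3,4) 1 J1_mult m)
  finally show ?thesis .
qed

text \<open>
  By commutation the lower entry of a lift is a linear function of its upper entry, while the torus
  scales the two by \<open>r\<close> and \<open>1/r\<close>; so it vanishes as \<open>r\<^sup>2 - 1\<close> is a unit. The upper left entries are
  then multiplicative in the parameter and invariant under the torus, hence trivial.
\<close>

lemma upper_shape:
  assumes h: "mat2 a b c d \<in> H" "mcong J1 (mat2 a b c d) (elem_upper y)" "y \<in> R"
  shows "a - 1 \<in> J" "c \<in> J" "d - 1 \<in> J"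
proof -
  have c0: "c \<in> J" if h: "mat2 a b c d \<in> H" "mcong J1 (mat2 a b c d) (elem_upper y)" "y \<in> R" for a b c d y
  proof -
    obtain k where k: "k \<in> H" "mcong J1 k (elem_upper 1)" using full(1)[OF one_closed] unfolding J1_def by blast
    obtain a1 b1 c1 d1 where k': "k = mat2 a1 b1 c1 d1" by (rule mat2_cases)
    note k = k[unfolded k'] note kR = H_R[OF k(1)]
    have kJ: "a1 - 1 \<in> J1" "b1 - 1 \<in> J1" "c1 \<in> J1" "d1 - 1 \<in> J1" using k(2) by (simp_all add: elem_defs)
    have kt: "mat2 a1 (r * b1) (r' * c1) d1 \<in> H" using H_torus(1)[OF k(1)] .
    have "r * b1 - r = r * (b1 - 1)" by (simp add: algebra_simps)
    then have "r * b1 - r \<in> J1" using J1c(6)[OF r(1) kJ(2)] by simp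
    then have "mcong J1 (mat2 a1 (r * b1) (r' * c1) d1) (elem_upper r)"
      using kJ J1c(6)[OF r'_closed kJ(3)] J1c(2) by (simp add: elem_defs)
    \<comment> \<open>The lift of parameter \<open>r\<close> obtained from the torus has lower entry \<open>r' c1\<close>, but linearity gives \<open>r c1\<close>.\<close>
    from upper_commute[OF kt this r(1) k one_closed] have "r * c1 - r' * c1 \<in> J" by simp
    then have "r * (r * c1 - r' * c1) \<in> J" by (rule Jc(6)[OF r(1)])
    moreover have "r * (r * c1 - r' * c1) = (r\<^sup>2 - 1) * c1" using r(2) by Groebner_Basis.algebra
    ultimately have "(r\<^sup>2 - 1) * c1 \<in> J" by simp
    moreover have "r\<^sup>2 - 1 \<in> R" by (intro closed r)
    ultimately have c1: "c1 \<in> J" using unit_cancel[OF _ r(3)] by blast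
    have "y * c1 - 1 * c \<in> J" by (rule upper_commute[OF h k one_closed])
    from Jc(4)[OF Jc(6)[OF h(3) c1] this] show ?thesis by simp
  qed
  note hR = H_R[OF h(1)]
  show c: "c \<in> J" by (rule c0[OF h])
  obtain s where s: "s \<in> R" "(r - 1) * s = 1"
    using unit_inverse[OF _ r_minus_1] diff_closed[OF r(1) one_closed] by blast
  have z: "s * y \<in> R" by (intro closed s h)
  \<comment> \<open>Parameter \<open>y / (r - 1)\<close>: adding \<open>y\<close> to it has the same effect as multiplying it by \<open>r\<close>.\<close>
  obtain k where k: "k \<in> H" "mcong J1 k (elem_upper (s * y))" using full(1)[OF z] unfolding J1_def by blast
  obtain a1 b1 c1 d1 where k': "k = mat2 a1 b1 c1 d1" by (rule mat2_cases)
  note k = k[unfolded k'] note kR = H_R[OF k(1)]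
  have kJ: "a1 - 1 \<in> J1" "b1 - s * y \<in> J1" "c1 \<in> J1" "d1 - 1 \<in> J1" using k(2) by (simp_all add: elem_defs)
  have kt: "mat2 a1 (r * b1) (r' * c1) d1 \<in> H" using H_torus(1)[OF k(1)] .
  have "y + s * y = r * (s * y)" using s(2) by Groebner_Basis.algebra
  then have e: "elem_upper y ** elem_upper (s * y) = elem_upper (r * (s * y))" by (simp only: elem_upper_mult)
  have "mcong J1 (mat2 a b c d ** mat2 a1 b1 c1 d1) (elem_upper (r * (s * y)))"
    using mcong_mult[OF J1 h(2) k(2) subsetD[OF H_mats h(1)] elem_mats(1)[OF z]] unfolding e .
  moreover have "mcong J1 (elem_upper (r * (s * y))) (mat2 a1 (r * b1) (r' * c1) d1)"
  proof (rule mcong_sym[OF J1])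
    have "r * b1 - r * (s * y) = r * (b1 - s * y)" by (simp add: algebra_simps)
    then have "r * b1 - r * (s * y) \<in> J1" using J1c(6)[OF r(1) kJ(2)] by (simp only:)
    then show "mcong J1 (mat2 a1 (r * b1) (r' * c1) d1) (elem_upper (r * (s * y)))"
      using kJ J1c(6)[OF r'_closed kJ(3)] J1c(2) unfolding elem_defs mcong_mat2 by simp
  qed
  ultimately have "mcong J1 (mat2 a b c d ** mat2 a1 b1 c1 d1) (mat2 a1 (r * b1) (r' * c1) d1)"
    by (rule mcong_trans[OF J1])
  from rigid[OF H_mult[OF h(1) k(1)] kt this] have 1: "a * a1 + b * c1 - a1 \<in> J" by simp
  have "a1 * (a - 1) = (a * a1 + b * c1 - a1) - b * c1" by (simp add: algebra_simps)
  also have "\<dots> \<in> J" by (intro Jc(4,6) 1 c0[OF k z] hR)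
  finally have "a1 * (a - 1) \<in> J" .
  moreover have "a1 dvd 1" using unit_shift[of 1 a1] kJ(1) by simp
  ultimately show a: "a - 1 \<in> J" using unit_cancel kR(1) by blast
  have "a * (d - 1) = (b * c) - (a - 1)" using hR(5) by (simp add: algebra_simps)
  also have "\<dots> \<in> J" by (intro Jc(4,6) a c hR)
  finally have "a * (d - 1) \<in> J" .
  moreover have "a dvd 1" using unit_shift[of 1 a] subsetD[OF J_subset_J1 a] by simp
  ultimately show "d - 1 \<in> J" using unit_cancel hR(1) by blast
qed

lemma upper_rigid:
  assumes "h \<in> H" "mcong J1 h (elem_upper y)" "y \<in> R"
  obtains y' where "y' \<in> R" "y' - y \<in> J1" "mcong J h (elem_upper y')"
proof -
  obtain a b c d where h: "h = mat2 a b c d" by (rule mat2_cases)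
  note s = upper_shape[OF assms[unfolded h]]
  have "mcong J h (elem_upper b)" using s Jc(2) by (simp add: h elem_defs)
  moreover have "b - y \<in> J1" using assms(2) by (simp add: h elem_defs)
  moreover have "b \<in> R" using H_R assms(1) unfolding h by blast
  ultimately show thesis using that by blast
qed

lemma lower_rigid:
  assumes "h \<in> H" "mcong J1 h (elem_lower y)" "y \<in> R"
  obtains y' where "y' \<in> R" "y' - y \<in> J1" "mcong J h (elem_lower y')"
proof -
  interpret T: rigid_step R "transpose ` H" J j r r' by (rule rigid_transposed)
  have e: "transpose (elem_lower z) = elem_upper z" for z :: 'a by (simp add: elem_defs)
  have "mcong J1 (transpose h) (elem_upper y)"
    using mcong_transpose[THEN iffD2, OF assms(2)] unfolding e .
  then obtain y' where y: "y' \<in> R" "y' - y \<in> J1" "mcong J (transpose h) (elem_upper y')"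
    using T.upper_rigid[OF imageI[OF assms(1)] _ assms(3)] by metis
  have "mcong J h (elem_lower y')" using y(3) unfolding e[symmetric] by (rule mcong_transpose[THEN iffD1])
  then show thesis using that y by blast
qed

definition realised :: "'a ^ 2 ^ 2 \<Rightarrow> bool"
  where "realised M \<longleftrightarrow> M \<in> mats R \<and> (\<exists>h\<in>H. mcong J1 h M)"

lemma realised_mult:
  assumes "realised M" "realised N" shows "realised (M ** N)"
proof -
  obtain h k where hk: "h \<in> H" "mcong J1 h M" "k \<in> H" "mcong J1 k N" "M \<in> mats R" "N \<in> mats R"
    using assms unfolding realised_def by blast
  have "mcong J1 (h ** k) (M ** N)"
    by (rule mcong_mult[OF J1 hk(2,4) subsetD[OF H_mats hk(1)] hk(6)])
  then show ?thesis unfolding realised_def using H_mult[OF hk(1,3)] mats_mult[OF hk(5,6)] by blast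
qed

lemma realised_elem: "b \<in> R \<Longrightarrow> realised (elem_upper b)" "b \<in> R \<Longrightarrow> realised (elem_lower b)"
  unfolding realised_def J1_def using full elem_mats by blast+

text \<open>
  Diagonal matrices are products of elementary ones. Their lifts commute with the torus, hence are
  diagonal modulo \<open>J\<close>.
\<close>

lemma diag_rigid:
  assumes u: "u \<in> R" "u * v = 1"
  obtains d \<upsilon> \<upsilon>' where "d \<in> H" "mcong J d (mat2 \<upsilon> 0 0 \<upsilon>')" "\<upsilon> \<in> R" "\<upsilon>' \<in> R"
    "\<upsilon> - u \<in> J1" "\<upsilon>' - v \<in> J1" "\<upsilon> * \<upsilon>' - 1 \<in> J"
proof -
  have v: "v \<in> R" using inverse_closed u by blast
  have "mat2 u 0 0 v = (elem_upper u ** elem_lower (- v) ** elem_upper u) **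
      (elem_upper (- 1) ** elem_lower 1 ** elem_upper (- 1))"
    using u by (simp add: elem_defs algebra_simps)
  moreover have "realised \<dots>" by (intro realised_mult realised_elem closed u v)
  ultimately obtain h where h: "h \<in> H" "mcong J1 h (mat2 u 0 0 v)" unfolding realised_def by metis
  obtain a b c d where h': "h = mat2 a b c d" by (rule mat2_cases)
  note h = h[unfolded h'] note hR = H_R[OF h(1)]
  have hJ: "a - u \<in> J1" "b \<in> J1" "c \<in> J1" "d - v \<in> J1" using h(2) by simp_all
  have e: "r * b - b = (r - 1) * b" by (simp add: algebra_simps)
  have e': "r' * c - c = r' * (- (r - 1) * c)" using r(2) by Groebner_Basis.algebra
  have "r - 1 \<in> R" by (intro closed r)
  then have "mcong J1 (mat2 a (r * b) (r' * c) d) (mat2 a b c d)"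
    unfolding mcong_mat2 e e' using hJ r'_closed r(1) by (auto intro!: J1c(6) closed simp: J1c(2))
  from rigid[OF H_torus(1)[OF h(1)] h(1) this]
  have 1: "(r - 1) * b \<in> J" "r' * (- (r - 1) * c) \<in> J" unfolding mcong_mat2 e e' by blast+
  have b: "b \<in> J" using unit_cancel[OF \<open>r - 1 \<in> R\<close> r_minus_1 1(1)] .
  have "r * (r' * (- (r - 1) * c)) \<in> J" by (rule Jc(6)[OF r(1) 1(2)])
  moreover have "r * (r' * (- (r - 1) * c)) = - ((r - 1) * c)" using r(2) by Groebner_Basis.algebra
  ultimately have "(r - 1) * c \<in> J" unfolding minus_minus using Jc(5)[of "- ((r - 1) * c)"] by simp
  then have c: "c \<in> J" by (rule unit_cancel[OF \<open>r - 1 \<in> R\<close> r_minus_1])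
  have "a * d - 1 = b * c" using hR(5) by (simp add: algebra_simps)
  then have "a * d - 1 \<in> J" using Jc(6)[OF hR(2) c] by simp
  moreover have "mcong J (mat2 a b c d) (mat2 a 0 0 d)" using b c Jc(2) by simp
  ultimately show thesis using that[OF h(1) _ hR(1,4) hJ(1,4)] by blast
qed

end

text \<open>
  The lift of the elementary matrix with parameter \<open>1\<close> has a parameter \<open>x\<close> that need not be \<open>1\<close>. Dividing
  all parameters by \<open>x\<close> replaces a conjugation by a diagonal matrix.
\<close>

locale rigid_step_pointed = rigid_step +
  fixes x x' :: 'a
  assumes x: "x \<in> R" "x * x' = 1" "x - 1 \<in> J1" and x_real: "\<exists>h\<in>H. mcong J h (elem_upper x)"
begin

lemma x'_closed: "x' \<in> R"
  using inverse_closed x by blast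

lemma x_unit: "x dvd 1"
  using x(2) by (metis dvdI)

text \<open>
  \<open>Q / J\<close> is the image of the section on parameters, normalised to contain \<open>1\<close>. It is an additive group
  that maps bijectively to \<open>R / J1\<close>. Its multipliers \<open>S\<close> form a ring for trivial reasons, and in
  fact \<open>S = Q\<close> (lemma \<open>Q_S\<close>).
\<close>

definition Q where "Q = {q \<in> R. \<exists>h\<in>H. mcong J h (elem_upper (q * x))}"

definition S where "S = {s \<in> R. \<forall>q\<in>Q. s * q \<in> Q}"

lemma Q_diff:
  assumes "p \<in> Q" "q \<in> Q" shows "p - q \<in> Q"
proof -
  obtain h k where hk: "h \<in> H" "mcong J h (elem_upper (p * x))" "k \<in> H" "mcong J k (elem_upper (q * x))"
    and R: "p \<in> R" "q \<in> R"
    using assms unfolding Q_def by blast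
  obtain a b c d where k: "k = mat2 a b c d" by (rule mat2_cases)
  have kJ: "a - 1 \<in> J" "b - q * x \<in> J" "c \<in> J" "d - 1 \<in> J" using hk(4) by (simp_all add: k elem_defs)
  have "mcong J (adj2 k) (elem_upper (- (q * x)))"
    using kJ Jc(5)[OF kJ(2)] Jc(5)[OF kJ(3)] by (simp add: k elem_defs)
  from mcong_mult[OF J hk(2) this subsetD[OF H_mats hk(1)] elem_mats(1)]
  have "mcong J (h ** adj2 k) (elem_upper (p * x - q * x))"
    using R x unfolding elem_upper_mult by (simp add: closed)
  then have "mcong J (h ** adj2 k) (elem_upper ((p - q) * x))" by (simp add: algebra_simps)
  then show ?thesis unfolding Q_def using H_mult[OF hk(1) H_adj[OF hk(3)]] diff_closed[OF R] by blast
qed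

lemma one_Q: "1 \<in> Q"
  unfolding Q_def using x_real one_closed by simp

lemma J_Q: "J \<subseteq> Q"
proof
  fix q assume q: "q \<in> J"
  have "mcong J (mat 1) (elem_upper (q * x))"
    using Jc(5)[OF Jc(7)[OF x(1) q]] Jc(2) by (simp add: mat_1_mat2 elem_defs)
  then show "q \<in> Q" unfolding Q_def using H_one Jc(1)[OF q] by blast
qed

lemma Q_J1:
  assumes "q \<in> Q" "q \<in> J1" shows "q \<in> J"
proof -
  obtain h where h: "h \<in> H" "mcong J h (elem_upper (q * x))" using assms(1) unfolding Q_def by blast
  have "mcong J1 (elem_upper (q * x)) (mat 1)"
    using J1c(7)[OF x(1) assms(2)] J1c(2) by (simp add: mat_1_mat2 elem_defs)
  with mcong_mono[OF h(2) J_subset_J1] have "mcong J1 h (mat 1)" by (rule mcong_trans[OF J1])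
  from rigid[OF h(1) H_one this] have "mcong J (elem_upper (q * x)) (mat 1)"
    using mcong_trans[OF J mcong_sym[OF J h(2)]] by blast
  then have "x * q \<in> J" by (simp add: mat_1_mat2 elem_defs mult.commute)
  then show ?thesis by (rule unit_cancel[OF x(1) x_unit])
qed

lemma S_Q: "S \<subseteq> Q"
  unfolding S_def using one_Q by force

lemma S_R: "S \<subseteq> R"
  unfolding S_def by blast

lemma one_S: "1 \<in> S"
  unfolding S_def using one_closed by simp

lemma S_mult: "s \<in> S \<Longrightarrow> t \<in> S \<Longrightarrow> s * t \<in> S"
  unfolding S_def by (auto simp: mult.assoc intro: closed)

lemma S_diff: "s \<in> S \<Longrightarrow> t \<in> S \<Longrightarrow> s - t \<in> S"
  unfolding S_def by (auto simp: left_diff_distrib intro: closed Q_diff)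

lemma J_S: "J \<subseteq> S"
proof
  fix s assume s: "s \<in> J"
  have "s * q \<in> Q" if "q \<in> Q" for q
    using that Jc(7)[OF _ s, of q] J_Q unfolding Q_def by blast
  then show "s \<in> S" unfolding S_def using Jc(1)[OF s] by blast
qed

lemma S_minus: "s \<in> S \<Longrightarrow> - s \<in> S"
  using S_diff[OF subsetD[OF J_S Jc(2)]] by fastforce

lemma S_add: "s \<in> S \<Longrightarrow> t \<in> S \<Longrightarrow> s + t \<in> S"
  using S_diff[OF _ S_minus, of s t] by simp

lemma S_cong:
  assumes "s \<in> S" "s - t \<in> J" shows "t \<in> S"
  using S_diff[OF assms(1) subsetD[OF J_S assms(2)]] by simp

text \<open>
  Conjugation by a lift of \<open>diag(u, 1/u)\<close> multiplies parameters by the square of a lift of \<open>u\<close>.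
\<close>

lemma S_square_unit:
  assumes u: "u \<in> R" "u dvd 1" shows "\<exists>s\<in>S. s - u\<^sup>2 \<in> J1"
proof -
  obtain v where v: "u * v = 1" using unit_inverse[OF u] by blast
  obtain d \<upsilon> \<upsilon>' where d: "d \<in> H" "mcong J d (mat2 \<upsilon> 0 0 \<upsilon>')" "\<upsilon> \<in> R" "\<upsilon>' \<in> R"
    "\<upsilon> - u \<in> J1" "\<upsilon>' - v \<in> J1" "\<upsilon> * \<upsilon>' - 1 \<in> J" using diag_rigid[OF u(1) v] .
  obtain a1 b1 c1 d1 where d': "d = mat2 a1 b1 c1 d1" by (rule mat2_cases)
  have dJ: "a1 - \<upsilon> \<in> J" "b1 \<in> J" "c1 \<in> J" "d1 - \<upsilon>' \<in> J" using d(2) by (simp_all add: d')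
  have da: "mcong J (adj2 d) (mat2 \<upsilon>' 0 0 \<upsilon>)" using dJ Jc(5)[OF dJ(2)] Jc(5)[OF dJ(3)] by (simp add: d')
  have dR: "d \<in> mats R" using H_mats d(1) by blast
  have "\<upsilon>\<^sup>2 * q \<in> Q" if q: "q \<in> Q" for q
  proof -
    obtain h where h: "h \<in> H" "mcong J h (elem_upper (q * x))" and qR: "q \<in> R" using q unfolding Q_def by blast
    have m: "elem_upper (q * x) \<in> mats R" using qR x by (intro elem_mats closed)
    have "mcong J (d ** h ** adj2 d) (mat2 \<upsilon> 0 0 \<upsilon>' ** elem_upper (q * x) ** mat2 \<upsilon>' 0 0 \<upsilon>)"
      using mats_mult[OF dR subsetD[OF H_mats h(1)]]
      by (rule mcong_mult[OF J mcong_mult[OF J d(2) h(2) dR m] da]) (simp add: d closed)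
    moreover have "mcong J (mat2 \<upsilon> 0 0 \<upsilon>' ** elem_upper (q * x) ** mat2 \<upsilon>' 0 0 \<upsilon>) (elem_upper (\<upsilon>\<^sup>2 * q * x))"
      using d(7) Jc(2) by (simp add: elem_defs power2_eq_square algebra_simps)
    ultimately have "mcong J (d ** h ** adj2 d) (elem_upper (\<upsilon>\<^sup>2 * q * x))" by (rule mcong_trans[OF J])
    moreover have "d ** h ** adj2 d \<in> H" by (intro H_mult H_adj d h)
    ultimately show ?thesis unfolding Q_def using qR d(3) by (auto intro: closed)
  qed
  then have "\<upsilon>\<^sup>2 \<in> S" unfolding S_def using d(3) by (auto intro: closed)
  moreover have "\<upsilon>\<^sup>2 - u\<^sup>2 = (\<upsilon> + u) * (\<upsilon> - u)" by (simp add: power2_eq_square algebra_simps)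
  then have "\<upsilon>\<^sup>2 - u\<^sup>2 \<in> J1" using d(3,5) u(1) by (auto intro!: J1c(6) closed)
  ultimately show ?thesis by blast
qed

text \<open>
  Modulo \<open>J1\<close>, the ring \<open>S\<close> contains the squares of units. A non-unit \<open>m\<close> is the difference of the
  squares of the units \<open>1 + m/4\<close> and \<open>1 - m/4\<close>, so \<open>S\<close> contains all squares, and these generate \<open>R\<close>
  additively.
\<close>

lemma S_onto:
  assumes "c \<in> R" shows "\<exists>s\<in>S. s - c \<in> J1"
proof -
  define P where "P c \<longleftrightarrow> (\<exists>s\<in>S. s - c \<in> J1)" for c
  have P_diff: "P (c - c')" if c: "P c" "P c'" for c c'
  proof -
    obtain s t where st: "s \<in> S" "t \<in> S" "s - c \<in> J1" "t - c' \<in> J1" using c unfolding P_def by blast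
    have "s - t - (c - c') = (s - c) - (t - c')" by simp
    then show ?thesis unfolding P_def using S_diff[OF st(1,2)] J1c(4)[OF st(3,4)] by metis
  qed
  obtain h where h: "h \<in> R" "2 * h = 1" using half by blast
  have P_unit: "P (u\<^sup>2)" if "u \<in> R" "u dvd 1" for u
    using S_square_unit[OF that] by (simp add: P_def)
  have P_nonunit: "P m" if m: "m \<in> R" "\<not> m dvd 1" for m
  proof -
    have n: "\<not> (h * h * m) dvd 1" using nonunit_mult[OF m(2), of "h * h"] by (simp add: mult.commute)
    have hm: "h * h * m \<in> R" by (intro closed h m)
    have "(1 + h * h * m) dvd 1"
      using nonunit_add[of "1 + h * h * m" "- (h * h * m)"] nonunit_minus[OF n] by auto
    moreover have "(1 - h * h * m) dvd 1" using nonunit_add[of "1 - h * h * m" "h * h * m"] n by auto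
    ultimately have "P ((1 + h * h * m)\<^sup>2 - (1 - h * h * m)\<^sup>2)"
      by (intro P_diff P_unit closed hm)
    moreover have "(1 + h * h * m)\<^sup>2 - (1 - h * h * m)\<^sup>2 = m" using h(2) by Groebner_Basis.algebra
    ultimately show ?thesis by simp
  qed
  have P_square: "P (y\<^sup>2)" if y: "y \<in> R" for y
  proof (cases "y dvd 1")
    case True then show ?thesis by (rule P_unit[OF y])
  next
    case False then show ?thesis
      using P_nonunit[of "y\<^sup>2"] nonunit_mult[of y y] y by (simp add: power2_eq_square closed)
  qed
  have "P ((h * (c + 1))\<^sup>2 - (h * (c - 1))\<^sup>2)" by (intro P_diff P_square closed h assms)
  moreover have "(h * (c + 1))\<^sup>2 - (h * (c - 1))\<^sup>2 = c" using h(2) by Groebner_Basis.algebra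
  ultimately show ?thesis by (simp add: P_def)
qed

text \<open>
  Both sets map onto \<open>R / J1\<close>, and the larger one injectively modulo \<open>J\<close>.
\<close>

lemma Q_S: "Q = S"
proof
  show "Q \<subseteq> S"
  proof
    fix q assume q: "q \<in> Q"
    obtain s where s: "s \<in> S" "s - q \<in> J1" using S_onto q unfolding Q_def by blast
    have "s - q \<in> J" using Q_J1[OF Q_diff[OF subsetD[OF S_Q s(1)] q] s(2)] .
    then show "q \<in> S" by (rule S_cong[OF s(1)])
  qed
qed (rule S_Q)

lemma S_J1: "s \<in> S \<Longrightarrow> s \<in> J1 \<Longrightarrow> s \<in> J"
  using Q_J1 S_Q by blast

lemma S_inverse:
  assumes s: "s \<in> S" "s * v = 1" shows "v \<in> S"
proof -
  have sR: "s \<in> R" using s S_R by blast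
  have v: "v \<in> R" using inverse_closed[OF sR s(2)] .
  obtain t where t: "t \<in> S" "t - v \<in> J1" using S_onto[OF v] by blast
  have e: "s * (t - v) = s * t - 1" using s(2) by (simp add: algebra_simps)
  have "s * t - 1 \<in> J1" using J1c(6)[OF sR t(2)] unfolding e .
  from S_J1[OF S_diff[OF S_mult[OF s(1) t(1)] one_S] this] have "s * (t - v) \<in> J" unfolding e .
  then have "t - v \<in> J" using unit_cancel[OF sR] s(2) by (metis dvdI)
  then show ?thesis by (rule S_cong[OF t(1)])
qed

text \<open>
  The product of lifts that represents the Weyl element modulo \<open>J1\<close> has diagonal entries \<open>z \<in> J1\<close>. A lift
  of \<open>diag(r, 1/r)\<close> on both sides fixes the Weyl element modulo \<open>J1\<close> but multiplies the upper left
  entry \<open>z\<close> by \<open>r\<^sup>2\<close> modulo \<open>J\<close>; hence \<open>z \<in> J\<close>, and the lower elementary matrix involved has parameter \<open>- 1/x\<close>.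
\<close>

lemma weyl: obtains w where "w \<in> H" "mcong J w (mat2 0 x (- x') 0)"
  "\<exists>h\<in>H. mcong J h (elem_lower (- x'))"
proof -
  obtain n where n: "n \<in> H" "mcong J n (elem_upper x)" using x_real by blast
  obtain k where k: "k \<in> H" "mcong J1 k (elem_lower (- 1))"
    using full(2)[OF minus_closed[OF one_closed]] unfolding J1_def by blast
  obtain y where y: "y \<in> R" "y - - 1 \<in> J1" "mcong J k (elem_lower y)"
    using lower_rigid[OF k minus_closed[OF one_closed]] .
  define w where "w = n ** k ** n"
  have w: "w \<in> H" unfolding w_def by (intro H_mult n k)
  have nR: "n \<in> mats R" "k \<in> mats R" "w \<in> mats R" using n k w H_mats by auto
  have xR: "elem_upper x \<in> mats R" "elem_lower y \<in> mats R" using x y by (auto intro: elem_mats)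
  define z where "z = 1 + x * y"
  have zR: "z \<in> R" unfolding z_def by (intro closed x y)
  have zJ1: "z \<in> J1"
  proof -
    have "z = x * (y - - 1) - (x - 1)" by (simp add: z_def algebra_simps)
    also have "\<dots> \<in> J1" by (intro J1c(4,6) x y)
    finally show ?thesis .
  qed
  have wc: "mcong J w (mat2 z (x + x * z) y z)"
  proof -
    have "mcong J w (elem_upper x ** elem_lower y ** elem_upper x)"
      unfolding w_def using nR xR by (intro mcong_mult[OF J] n y mats_mult)
    moreover have "elem_upper x ** elem_lower y ** elem_upper x = mat2 z (x + x * z) y z"
      by (simp add: elem_defs z_def algebra_simps)
    ultimately show ?thesis by simp
  qed
  obtain d \<upsilon> \<upsilon>' where d: "d \<in> H" "mcong J d (mat2 \<upsilon> 0 0 \<upsilon>')" "\<upsilon> \<in> R" "\<upsilon>' \<in> R"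
    "\<upsilon> - r \<in> J1" "\<upsilon>' - r' \<in> J1" "\<upsilon> * \<upsilon>' - 1 \<in> J" using diag_rigid[OF r(1,2)] .
  have dR: "d \<in> mats R" using H_mats d(1) by blast
  have wR: "mat2 z (x + x * z) y z \<in> mats R" using zR x y by (simp add: closed)
  have dwd: "mcong J (d ** w ** d) (mat2 \<upsilon> 0 0 \<upsilon>' ** mat2 z (x + x * z) y z ** mat2 \<upsilon> 0 0 \<upsilon>')"
    using mats_mult[OF dR nR(3)]
    by (rule mcong_mult[OF J mcong_mult[OF J d(2) wc dR wR] d(2)]) (simp add: d closed)
  have "mcong J1 (mat2 \<upsilon> 0 0 \<upsilon>' ** mat2 z (x + x * z) y z ** mat2 \<upsilon> 0 0 \<upsilon>') (mat2 z (x + x * z) y z)"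
  proof -
    have 1: "\<upsilon> * \<upsilon>' - 1 \<in> J1" using d(7) J_subset_J1 by blast
    have "\<upsilon> * z * \<upsilon> - z \<in> J1" "\<upsilon>' * z * \<upsilon>' - z \<in> J1"
      by (intro J1c(4) J1c(7)[OF d(3)] J1c(7)[OF d(4)] J1c(6)[OF d(3)] J1c(6)[OF d(4)] zJ1)+
    moreover have "\<upsilon> * (x + x * z) * \<upsilon>' - (x + x * z) = (x + x * z) * (\<upsilon> * \<upsilon>' - 1)"
      "\<upsilon>' * y * \<upsilon> - y = y * (\<upsilon> * \<upsilon>' - 1)" by (simp_all add: algebra_simps)
    then have "\<upsilon> * (x + x * z) * \<upsilon>' - (x + x * z) \<in> J1" "\<upsilon>' * y * \<upsilon> - y \<in> J1"
      using 1 x y zR by (simp_all only: J1c(6) closed)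
    ultimately show ?thesis by simp
  qed
  then have "mcong J1 (d ** w ** d) w"
    using mcong_trans[OF J1 mcong_trans[OF J1 mcong_mono[OF dwd J_subset_J1]]
        mcong_sym[OF J1 mcong_mono[OF wc J_subset_J1]]] by blast
  from rigid[OF _ w this] have "mcong J (d ** w ** d) w" using H_mult d w by blast
  then have "mcong J (mat2 \<upsilon> 0 0 \<upsilon>' ** mat2 z (x + x * z) y z ** mat2 \<upsilon> 0 0 \<upsilon>') (mat2 z (x + x * z) y z)"
    using mcong_trans[OF J mcong_trans[OF J mcong_sym[OF J dwd]] wc] by blast
  then have "\<upsilon> * z * \<upsilon> - z \<in> J" by simp
  moreover have "\<upsilon> * z * \<upsilon> - z = (\<upsilon>\<^sup>2 - 1) * z" by (simp add: power2_eq_square algebra_simps)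
  ultimately have "(\<upsilon>\<^sup>2 - 1) * z \<in> J" by simp
  moreover have "(\<upsilon>\<^sup>2 - 1) dvd 1"
  proof (rule unit_shift[OF r(3)])
    have "\<upsilon>\<^sup>2 - 1 - (r\<^sup>2 - 1) = (\<upsilon> + r) * (\<upsilon> - r)" by (simp add: power2_eq_square algebra_simps)
    then show "\<upsilon>\<^sup>2 - 1 - (r\<^sup>2 - 1) \<in> J1" using d(3,5) r(1) by (auto intro!: J1c(6) closed)
  qed
  moreover have "\<upsilon>\<^sup>2 - 1 \<in> R" by (intro closed d)
  ultimately have z: "z \<in> J" using unit_cancel by blast
  have "y - - x' = x' * z" using x(2) by (simp add: z_def algebra_simps)
  then have y': "y - - x' \<in> J" using Jc(6)[OF x'_closed z] by simp
  have "mcong J (mat2 z (x + x * z) y z) (mat2 0 x (- x') 0)"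
    using z Jc(6)[OF x(1) z] y' by simp
  then have "mcong J w (mat2 0 x (- x') 0)" by (rule mcong_trans[OF J wc])
  moreover have "mcong J (elem_lower y) (elem_lower (- x'))" using y' Jc(2) by (simp add: elem_defs)
  then have "mcong J k (elem_lower (- x'))" by (rule mcong_trans[OF J y(3)])
  ultimately show thesis using that[OF w] k(1) by blast
qed

text \<open>
  The matrices conjugate by \<open>diag(x, 1)\<close> to a matrix over \<open>S\<close>.
\<close>

definition Z :: "'a ^ 2 ^ 2 \<Rightarrow> bool"
  where "Z k \<longleftrightarrow> k $ 1 $ 1 \<in> S \<and> x' * k $ 1 $ 2 \<in> S \<and> x * k $ 2 $ 1 \<in> S \<and> k $ 2 $ 2 \<in> S"

lemma Z_mat2 [simp]: "Z (mat2 a b c d) \<longleftrightarrow> a \<in> S \<and> x' * b \<in> S \<and> x * c \<in> S \<and> d \<in> S"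
  by (simp add: Z_def)

lemma Z_mult:
  assumes "Z h" "Z k" shows "Z (h ** k)"
proof -
  obtain a b c d where h: "h = mat2 a b c d" by (rule mat2_cases)
  obtain a' b' c' d' where k: "k = mat2 a' b' c' d'" by (rule mat2_cases)
  have e: "a * a' + b * c' = a * a' + (x' * b) * (x * c')"
    "x' * (a * b' + b * d') = a * (x' * b') + (x' * b) * d'"
    "x * (c * a' + d * c') = (x * c) * a' + d * (x * c')"
    "c * b' + d * d' = (x * c) * (x' * b') + d * d'"
    using x(2) by Groebner_Basis.algebra+
  show ?thesis using assms unfolding h k mat2_mult Z_mat2 e by (blast intro: S_add S_mult)
qed

lemma Z_cong:
  assumes "Z h" "mcong J h k" shows "Z k"
proof -
  obtain a b c d where h: "h = mat2 a b c d" by (rule mat2_cases)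
  obtain a' b' c' d' where k: "k = mat2 a' b' c' d'" by (rule mat2_cases)
  have m: "a - a' \<in> J" "b - b' \<in> J" "c - c' \<in> J" "d - d' \<in> J" using assms(2) by (simp_all add: h k)
  have "x' * b - x' * b' \<in> J" "x * c - x * c' \<in> J"
    using Jc(6)[OF x'_closed m(2)] Jc(6)[OF x(1) m(3)] by (simp_all add: algebra_simps)
  then show ?thesis using assms(1) m unfolding h k Z_mat2 by (blast intro: S_cong)
qed

lemma Z_upper: "h \<in> H \<Longrightarrow> mcong J1 h (elem_upper b) \<Longrightarrow> b \<in> R \<Longrightarrow> Z h"
proof -
  assume h: "h \<in> H" "mcong J1 h (elem_upper b)" "b \<in> R"
  obtain b' where b: "b' \<in> R" "mcong J h (elem_upper b')" using upper_rigid[OF h] by metis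
  have "x' * b' * x = b'" using x(2) by Groebner_Basis.algebra
  then have "mcong J h (elem_upper (x' * b' * x))" using b(2) by (simp only:)
  then have "x' * b' \<in> Q" unfolding Q_def using h(1) mult_closed[OF x'_closed b(1)] by blast
  then have "Z (elem_upper b')" using one_S subsetD[OF J_S Jc(2)] by (simp add: elem_defs Q_S)
  then show "Z h" by (rule Z_cong[OF _ mcong_sym[OF J b(2)]])
qed

text \<open>
  The Weyl element turns a lower lift into an upper one, whose parameter is controlled by \<open>Q = S\<close>.
\<close>

lemma Z_lower: "h \<in> H \<Longrightarrow> mcong J1 h (elem_lower b) \<Longrightarrow> b \<in> R \<Longrightarrow> Z h"
proof -
  assume h: "h \<in> H" "mcong J1 h (elem_lower b)" "b \<in> R"
  obtain c where c: "c \<in> R" "mcong J h (elem_lower c)" using lower_rigid[OF h] by metis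
  obtain w where w: "w \<in> H" "mcong J w (mat2 0 x (- x') 0)" using weyl by blast
  obtain a1 b1 c1 d1 where w': "w = mat2 a1 b1 c1 d1" by (rule mat2_cases)
  have wJ: "a1 \<in> J" "b1 - x \<in> J" "c1 - - x' \<in> J" "d1 \<in> J" using w(2) by (simp_all add: w')
  have wa: "mcong J (adj2 w) (mat2 0 (- x) x' 0)"
    using wJ Jc(5)[OF wJ(2)] Jc(5)[OF wJ(3)] by (simp add: w' add.commute)
  have wR: "w \<in> mats R" "h \<in> mats R" using H_mats w(1) h(1) by blast+
  have "mcong J (w ** h ** adj2 w) (mat2 0 x (- x') 0 ** elem_lower c ** mat2 0 (- x) x' 0)"
    using mats_mult[OF wR]
    by (rule mcong_mult[OF J mcong_mult[OF J w(2) c(2) wR(1) elem_mats(2)[OF c(1)]] wa])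
      (simp add: x x'_closed closed)
  moreover have "mat2 0 x (- x') 0 ** elem_lower c ** mat2 0 (- x) x' 0 = elem_upper (- (x * c) * x)"
    using x(2) by (simp add: elem_defs algebra_simps)
  ultimately have "mcong J (w ** h ** adj2 w) (elem_upper (- (x * c) * x))" by simp
  moreover have "w ** h ** adj2 w \<in> H" by (intro H_mult H_adj w h)
  ultimately have "- (x * c) \<in> Q" unfolding Q_def using x(1) c(1) by (auto intro: closed)
  then have "x * c \<in> S" using S_minus unfolding Q_S by fastforce
  then have "Z (elem_lower c)" using one_S subsetD[OF J_S Jc(2)] by (simp add: elem_defs)
  then show "Z h" by (rule Z_cong[OF _ mcong_sym[OF J c(2)]])
qed

lemma H_Z:
  assumes k: "k \<in> H" shows "Z k"
proof -
  define P where "P M \<longleftrightarrow> M \<in> mats R \<and> (\<exists>z\<in>H. mcong J1 z M \<and> Z z)" for M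
  have P_mult: "P (M ** N)" if "P M" "P N" for M N
  proof -
    obtain h k where hk: "h \<in> H" "mcong J1 h M" "Z h" "k \<in> H" "mcong J1 k N" "Z k" "M \<in> mats R" "N \<in> mats R"
      using \<open>P M\<close> \<open>P N\<close> unfolding P_def by blast
    have "mcong J1 (h ** k) (M ** N)"
      by (rule mcong_mult[OF J1 hk(2,5) subsetD[OF H_mats hk(1)] hk(8)])
    then show ?thesis
      unfolding P_def using H_mult[OF hk(1,4)] mats_mult[OF hk(7,8)] Z_mult[OF hk(3,6)] by blast
  qed
  have P_elem: "P (elem_upper b)" "P (elem_lower b)" if b: "b \<in> R" for b
  proof -
    show "P (elem_upper b)" using full(1)[OF b] Z_upper b elem_mats(1)[OF b] unfolding P_def J1_def by blast
    show "P (elem_lower b)" using full(2)[OF b] Z_lower b elem_mats(2)[OF b] unfolding P_def J1_def by blast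
  qed
  obtain z where z: "z \<in> H" "mcong J1 z k" "Z z"
    using SL_elementary_induct[of P, OF P_mult P_elem subsetD[OF H_mats k] H_det[OF k]] unfolding P_def by blast
  show ?thesis by (rule Z_cong[OF z(3) rigid[OF z(1) k z(2)]])
qed

text \<open>
  Conjugating the lifts of the two elementary matrices and of \<open>diag(r, 1/r)\<close> by a matrix with entries
  \<open>\<alpha>, \<beta>, \<gamma>, \<delta>\<close> and determinant \<open>1/v\<close> gives elements of \<open>H\<close>, and suitable entries of these are
  \<open>\<alpha>\<^sup>2 v\<close>, \<open>\<delta>\<^sup>2 v\<close> and a function of \<open>\<alpha> \<delta> v\<close>. After division by the appropriate power of \<open>x\<close> all three lie in \<open>S\<close>, hence so does the adjoint trace.
\<close>

lemma normaliser_trace: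
  assumes m: "mat2 \<alpha> \<beta> \<gamma> \<delta> \<in> mats R" "(\<alpha> * \<delta> - \<beta> * \<gamma>) * v = 1"
    and norm: "\<And>k. k \<in> H \<Longrightarrow> mat2 \<alpha> \<beta> \<gamma> \<delta> ** k ** mat2 (v * \<delta>) (- v * \<beta>) (- v * \<gamma>) (v * \<alpha>) \<in> H"
  shows "(\<alpha> + \<delta>)\<^sup>2 * v \<in> S"
proof -
  let ?h = "mat2 \<alpha> \<beta> \<gamma> \<delta>" and ?h' = "mat2 (v * \<delta>) (- v * \<beta>) (- v * \<gamma>) (v * \<alpha>)"
  have hR: "\<alpha> \<in> R" "\<beta> \<in> R" "\<gamma> \<in> R" "\<delta> \<in> R" using m(1) by simp_all
  have v: "v \<in> R" by (rule inverse_closed[OF _ m(2)]) (intro closed hR)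
  have h'R: "?h' \<in> mats R" using hR v by (simp add: closed)
  have conj: "Z (?h ** M ** ?h')" if k: "k \<in> H" "mcong J k M" "M \<in> mats R" for k M
  proof -
    have "mcong J (?h ** k ** ?h') (?h ** M ** ?h')"
      using mats_mult[OF m(1) subsetD[OF H_mats k(1)]]
      by (rule mcong_mult[OF J mcong_mult[OF J mcong_refl[OF J] k(2) m(1) k(3)] mcong_refl[OF J] _ h'R])
    then show ?thesis by (rule Z_cong[OF H_Z[OF norm[OF k(1)]]])
  qed
  obtain k where k: "k \<in> H" "mcong J k (elem_upper x)" using x_real by blast
  have "x' * ((\<alpha> + \<beta> * 0) * (- v * \<beta>) + (\<alpha> * x + \<beta>) * (v * \<alpha>)) = \<alpha>\<^sup>2 * v"
    using x(2) by Groebner_Basis.algebra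
  with conj[OF k elem_mats(1)[OF x(1)]] have \<alpha>: "\<alpha>\<^sup>2 * v \<in> S" by (simp add: elem_defs)
  obtain l where l: "l \<in> H" "mcong J l (elem_lower (- x'))" using weyl by blast
  have "x * ((\<gamma> - \<delta> * x') * (v * \<delta>) - \<delta> * (v * \<gamma>)) = - (\<delta>\<^sup>2 * v)"
    using x(2) by Groebner_Basis.algebra
  with conj[OF l elem_mats(2)[OF minus_closed[OF x'_closed]]] have "- (\<delta>\<^sup>2 * v) \<in> S" by (simp add: elem_defs)
  from S_minus[OF this] have \<delta>: "\<delta>\<^sup>2 * v \<in> S" by simp
  obtain d \<upsilon> \<upsilon>' where d: "d \<in> H" "mcong J d (mat2 \<upsilon> 0 0 \<upsilon>')" "\<upsilon> \<in> R" "\<upsilon>' \<in> R"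
    "\<upsilon> - r \<in> J1" "\<upsilon>' - r' \<in> J1" "\<upsilon> * \<upsilon>' - 1 \<in> J" using diag_rigid[OF r(1,2)] .
  have \<upsilon>S: "\<upsilon> \<in> S" "\<upsilon>' \<in> S" using Z_cong[OF H_Z[OF d(1)] d(2)] by simp_all
  have "mat2 \<upsilon> 0 0 \<upsilon>' \<in> mats R" using d zero_closed by simp
  from conj[OF d(1,2) this] have "\<alpha> * \<upsilon> * (v * \<delta>) - \<beta> * \<upsilon>' * (v * \<gamma>) \<in> S" by simp
  moreover have "\<alpha> * \<upsilon> * (v * \<delta>) - \<beta> * \<upsilon>' * (v * \<gamma>) = (\<upsilon> - \<upsilon>') * (\<alpha> * \<delta> * v) + \<upsilon>'"
    using m(2) by Groebner_Basis.algebra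
  ultimately have "(\<upsilon> - \<upsilon>') * (\<alpha> * \<delta> * v) + \<upsilon>' \<in> S" by simp
  from S_diff[OF this \<upsilon>S(2)] have 1: "(\<upsilon> - \<upsilon>') * (\<alpha> * \<delta> * v) \<in> S" by simp
  have "(\<upsilon> - \<upsilon>') dvd 1"
  proof (rule unit_shift)
    obtain s where s: "(r\<^sup>2 - 1) * s = 1" using r(3) by (metis dvdE)
    have "1 = (r - r') * (r * s)" using s r(2) by Groebner_Basis.algebra
    then show "(r - r') dvd 1" by (rule dvdI)
    have "\<upsilon> - \<upsilon>' - (r - r') = (\<upsilon> - r) - (\<upsilon>' - r')" by simp
    then show "\<upsilon> - \<upsilon>' - (r - r') \<in> J1" using J1c(4)[OF d(5,6)] by (simp only:)
  qed
  then obtain s where s: "(\<upsilon> - \<upsilon>') * s = 1" by (metis dvdE)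
  from S_mult[OF S_inverse[OF S_diff[OF \<upsilon>S] s] 1] have "s * ((\<upsilon> - \<upsilon>') * (\<alpha> * \<delta> * v)) \<in> S" .
  moreover have "s * ((\<upsilon> - \<upsilon>') * (\<alpha> * \<delta> * v)) = \<alpha> * \<delta> * v" using s by Groebner_Basis.algebra
  ultimately have \<alpha>\<delta>: "\<alpha> * \<delta> * v \<in> S" by simp
  have "(\<alpha> + \<delta>)\<^sup>2 * v = \<alpha>\<^sup>2 * v + \<delta>\<^sup>2 * v + (\<alpha> * \<delta> * v + \<alpha> * \<delta> * v)"
    by (simp add: power2_eq_square algebra_simps)
  then show ?thesis using \<alpha> \<delta> \<alpha>\<delta> S_add by metis
qed

end

text \<open>
  In the second case the subring is the ring of multipliers; the last clause applies to every matrix over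
  \<open>R\<close> that normalises \<open>H\<close>.
\<close>

lemma (in congruence_step) dichotomy:
  obtains (lifts) "\<And>b. b \<in> R \<Longrightarrow> \<exists>h\<in>H. mcong J h (elem_upper b)" "\<And>b. b \<in> R \<Longrightarrow> \<exists>h\<in>H. mcong J h (elem_lower b)"
  | (subring) S where "S \<subseteq> R" "J \<subseteq> S" "j \<notin> S" "1 \<in> S"
      "\<And>s t. s \<in> S \<Longrightarrow> t \<in> S \<Longrightarrow> s - t \<in> S" "\<And>s t. s \<in> S \<Longrightarrow> t \<in> S \<Longrightarrow> s * t \<in> S"
      "\<And>\<alpha> \<beta> \<gamma> \<delta> v. mat2 \<alpha> \<beta> \<gamma> \<delta> \<in> mats R \<Longrightarrow> (\<alpha> * \<delta> - \<beta> * \<gamma>) * v = 1 \<Longrightarrow>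
        (\<And>k. k \<in> H \<Longrightarrow> mat2 \<alpha> \<beta> \<gamma> \<delta> ** k ** mat2 (v * \<delta>) (- v * \<beta>) (- v * \<gamma>) (v * \<alpha>) \<in> H) \<Longrightarrow>
        (\<alpha> + \<delta>)\<^sup>2 * v \<in> S"
proof (cases "\<exists>h\<in>H. \<exists>k\<in>H. mcong J1 h k \<and> \<not> mcong J h k")
  case True
  then show thesis using full_of_not_rigid lifts by blast
next
  case False
  then interpret rigid_step R H J j r r' by unfold_locales blast
  obtain n where n: "n \<in> H" "mcong J1 n (elem_upper 1)" using full(1)[OF one_closed] unfolding J1_def by blast
  obtain x where x: "x \<in> R" "x - 1 \<in> J1" "mcong J n (elem_upper x)" using upper_rigid[OF n one_closed] .
  have "x dvd 1" using unit_shift[of 1 x] x(2) by simp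
  then obtain x' where x': "x * x' = 1" by (metis dvdE)
  interpret rigid_step_pointed R H J j r r' x x' by unfold_locales (use x x' n in blast)+
  show thesis
  proof (rule subring)
    show "S \<subseteq> R" "J \<subseteq> S" "1 \<in> S" by (rule S_R J_S one_S)+
    show "j \<notin> S" using S_J1 j_J1 j(3) by blast
    show "s - t \<in> S" "s * t \<in> S" if "s \<in> S" "t \<in> S" for s t
      using S_diff[OF that] S_mult[OF that] .
    show "(\<alpha> + \<delta>)\<^sup>2 * v \<in> S"
      if "mat2 \<alpha> \<beta> \<gamma> \<delta> \<in> mats R" "(\<alpha> * \<delta> - \<beta> * \<gamma>) * v = 1"
        "\<And>k. k \<in> H \<Longrightarrow> mat2 \<alpha> \<beta> \<gamma> \<delta> ** k ** mat2 (v * \<delta>) (- v * \<beta>) (- v * \<gamma>) (v * \<alpha>) \<in> H"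
      for \<alpha> \<beta> \<gamma> \<delta> v
      using normaliser_trace[OF that] .
  qed
qed

section \<open>Profinite local rings\<close>

text \<open>
  \<open>NN\<close> is a basis of open ideals of finite index. Coherent families in \<open>complete\<close> are indexed by the ideals
  themselves; this is the surjectivity onto the inverse limit.
\<close>

locale profinite_local_ring =
  fixes NN :: "'a :: {idom, local_ring, topological_ab_group_add, topological_semigroup_mult} set set"
  assumes zero_N: "N \<in> NN \<Longrightarrow> 0 \<in> N"
    and diff_N: "N \<in> NN \<Longrightarrow> x \<in> N \<Longrightarrow> y \<in> N \<Longrightarrow> x - y \<in> N"
    and mult_N: "N \<in> NN \<Longrightarrow> x \<in> N \<Longrightarrow> a * x \<in> N"
    and finite_index: "N \<in> NN \<Longrightarrow> finite (range (\<lambda>x. {y. x - y \<in> N}))"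
    and directed_N: "M \<in> NN \<Longrightarrow> N \<in> NN \<Longrightarrow> \<exists>L\<in>NN. L \<subseteq> M \<and> L \<subseteq> N"
    and separated: "(\<And>N. N \<in> NN \<Longrightarrow> x \<in> N) \<Longrightarrow> x = 0"
    and closure_iff: "x \<in> closure S \<longleftrightarrow> (\<forall>N\<in>NN. \<exists>y\<in>S. x - y \<in> N)"
    and complete: "(\<And>M N. M \<in> NN \<Longrightarrow> N \<in> NN \<Longrightarrow> M \<subseteq> N \<Longrightarrow> f M - f N \<in> N) \<Longrightarrow> \<exists>x. \<forall>N\<in>NN. x - f N \<in> N"
    and two_unit: "(2::'a) dvd 1"

text \<open>
  The ideals are the kernels \<open>K i\<close> of the projections to the finite rings. A proper one among them
  contains a power of \<open>p\<close>, because the finite ring has such an order; as this power is odd, \<open>2\<close> is a unit.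
\<close>

lemma profinite_local_ring_of_pro_p:
  assumes pro: "pro_p_ring p TYPE('a :: {idom, local_ring, topological_ab_group_add, topological_semigroup_mult})"
    and odd: "odd p"
  obtains NN :: "'a :: {idom, local_ring, topological_ab_group_add, topological_semigroup_mult} set set" where "profinite_local_ring NN"
proof -
  let ?A = "ring_of_type_algebra :: 'a ring"
  obtain I :: "'a set set" and le and R :: "'a set \<Rightarrow> nat ring" and \<phi> and \<pi> :: "'a set \<Rightarrow> 'a \<Rightarrow> nat"
    where sys: "finite_ring_system p I le R \<phi>"
      and hom: "\<forall>i\<in>I. \<pi> i \<in> ring_hom ?A (R i)"
      and homeo: "homeomorphic_map euclidean (finite_ring_system.limit_topology I le R \<phi>) (\<lambda>a. \<lambda>i\<in>I. \<pi> i a)"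
    using pro unfolding pro_p_ring_def by blast
  interpret finite_ring_system p I le R \<phi> by fact
  interpret A: ring ?A by (rule ring_from_type_algebra)
  let ?f = "\<lambda>a. \<lambda>i\<in>I. \<pi> i a"
  define K where "K i = {x. \<pi> i x = \<zero>\<^bsub>R i\<^esub>}" for i
  have carr: "\<pi> i x \<in> carrier (R i)" if "i \<in> I" for i x
    using ring_hom_closed[of "\<pi> i" ?A "R i" x] hom that by simp
  have add: "\<pi> i (x + y) = \<pi> i x \<oplus>\<^bsub>R i\<^esub> \<pi> i y" if "i \<in> I" for i x y
    using ring_hom_add[of "\<pi> i" ?A "R i" x y] hom that by simp
  have mult: "\<pi> i (x * y) = \<pi> i x \<otimes>\<^bsub>R i\<^esub> \<pi> i y" if "i \<in> I" for i x y
    using ring_hom_mult[of "\<pi> i" ?A "R i" x y] hom that by simp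
  have one: "\<pi> i 1 = \<one>\<^bsub>R i\<^esub>" if "i \<in> I" for i
    using ring_hom_one[of "\<pi> i" ?A "R i"] hom that by simp
  have zero: "\<pi> i 0 = \<zero>\<^bsub>R i\<^esub>" if "i \<in> I" for i
    using ring_hom_zero[of "\<pi> i" ?A "R i"] A.ring_axioms ring[OF that] hom that by simp
  have K_iff: "x - y \<in> K i \<longleftrightarrow> \<pi> i x = \<pi> i y" if i: "i \<in> I" for i x y
  proof -
    interpret Ri: ring "R i" by (rule ring[OF i])
    have "\<pi> i x = \<pi> i (x - y) \<oplus>\<^bsub>R i\<^esub> \<pi> i y" using add[OF i, of "x - y" y] by simp
    moreover have "\<pi> i (x - y) \<oplus>\<^bsub>R i\<^esub> \<pi> i y = \<pi> i y \<longleftrightarrow> \<pi> i (x - y) = \<zero>\<^bsub>R i\<^esub>"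
      using Ri.add.r_cancel_one[OF carr[OF i] carr[OF i]] .
    ultimately show ?thesis unfolding K_def mem_Collect_eq by argo
  qed
  have compat: "\<phi> i k (\<pi> k a) = \<pi> i a" if "i \<in> I" "k \<in> I" "le i k" for i k a
  proof -
    have "?f a \<in> topspace limit_topology"
      using homeomorphic_imp_surjective_map[OF homeo] by auto
    then show ?thesis using that unfolding limit_topology_def by auto
  qed
  have K_mono: "K k \<subseteq> K i" if "i \<in> I" "k \<in> I" "le i k" for i k
  proof
    fix x assume "x \<in> K k"
    then have "\<pi> k x = \<pi> k 0" using zero[OF that(2)] by (simp add: K_def)
    then have "\<pi> i x = \<pi> i 0" using compat[OF that] by metis
    then show "x \<in> K i" using zero[OF that(1)] by (simp add: K_def)
  qed
  have bound: "\<exists>k\<in>I. \<forall>i\<in>F. le i k" if "finite F" "F \<subseteq> I" for F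
    using that
  proof (induction F)
    case empty then show ?case using index_nonempty by blast
  next
    case (insert i F)
    then obtain k where k: "k \<in> I" "\<forall>i\<in>F. le i k" by blast
    obtain l where l: "l \<in> I" "le i l" "le k l" using directed[of i k] insert k by blast
    have "le a l" if "a \<in> F" for a
      using le_trans[of a k l] k l that insert by blast
    then show ?case using l by blast
  qed
  have inj: "x = y" if "\<And>i. i \<in> I \<Longrightarrow> \<pi> i x = \<pi> i y" for x y
  proof -
    have "?f x = ?f y" by (rule restrict_ext) (rule that)
    then show ?thesis using homeomorphic_imp_injective_map[OF homeo] injD[of ?f x y] by simp
  qed
  have cont: "continuous_map euclidean (discrete_topology (carrier (R i))) (\<pi> i)" if i: "i \<in> I" for i
  proof -
    have "continuous_map euclidean (product_topology (\<lambda>i. discrete_topology (carrier (R i))) I) ?f"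
      using homeomorphic_imp_continuous_map[OF homeo] unfolding limit_topology_def
      by (simp add: continuous_map_in_subtopology)
    from continuous_map_componentwise[THEN iffD1, OF this] i
    have "continuous_map euclidean (discrete_topology (carrier (R i))) (\<lambda>a. ?f a i)" by blast
    with i show ?thesis by (simp add: eta_contract_eq)
  qed
  have open_K: "open {z. x - z \<in> K i}" if i: "i \<in> I" for x i
  proof -
    have "openin (discrete_topology (carrier (R i))) {\<pi> i x}" using carr[OF i] by simp
    from openin_continuous_map_preimage[OF cont[OF i] this] have "open {z. \<pi> i z = \<pi> i x}" by simp
    then show ?thesis unfolding K_iff[OF i] by (simp add: eq_commute)
  qed
  have nhd: "\<exists>i\<in>I. \<forall>z. x - z \<in> K i \<longrightarrow> z \<in> U" if U: "open U" "x \<in> U" for x U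
  proof -
    have "openin limit_topology (?f ` U)"
      using homeomorphic_imp_open_map[OF homeo] U unfolding open_map_def by simp
    then obtain O' where O': "openin (product_topology (\<lambda>i. discrete_topology (carrier (R i))) I) O'"
      "?f ` U = O' \<inter> {x. \<forall>i\<in>I. \<forall>j\<in>I. le i j \<longrightarrow> \<phi> i j (x j) = x i}"
      unfolding limit_topology_def openin_subtopology by blast
    have "?f x \<in> O'" using O'(2) U(2) by blast
    \<comment> \<open>A basic open box restricts finitely many coordinates, which a single index dominates.\<close>
    then obtain W where W: "finite {i \<in> I. W i \<noteq> topspace (discrete_topology (carrier (R i)))}"
      "?f x \<in> Pi\<^sub>E I W" "Pi\<^sub>E I W \<subseteq> O'"
      using O'(1) unfolding openin_product_topology_alt by meson
    obtain k where k: "k \<in> I" "\<forall>i\<in>{i \<in> I. W i \<noteq> topspace (discrete_topology (carrier (R i)))}. le i k"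
      using bound[OF W(1)] by blast
    have "z \<in> U" if "x - z \<in> K k" for z
    proof -
      have "\<pi> i z \<in> W i" if i: "i \<in> I" for i
      proof (cases "W i = carrier (R i)")
        case True then show ?thesis using carr i by simp
      next
        case False
        then have "le i k" using k i by simp
        then have "x - z \<in> K i" using \<open>x - z \<in> K k\<close> K_mono[OF i k(1)] by blast
        then have "\<pi> i x = \<pi> i z" using K_iff i by blast
        then show ?thesis using W(2) i by (metis PiE_mem restrict_apply')
      qed
      then have "?f z \<in> O'" using W(3) by auto
      moreover have "?f z \<in> {x. \<forall>i\<in>I. \<forall>j\<in>I. le i j \<longrightarrow> \<phi> i j (x j) = x i}" using compat by simp
      ultimately have "?f z \<in> ?f ` U" using O'(2) by blast
      then obtain u where u: "u \<in> U" "?f z = ?f u" by blast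
      have "z = u" using homeomorphic_imp_injective_map[OF homeo] u(2) by (simp add: inj_on_def)
      then show ?thesis using u by simp
    qed
    then show ?thesis using k(1) by blast
  qed
  have ideal: "0 \<in> K i" "\<And>x y. x \<in> K i \<Longrightarrow> y \<in> K i \<Longrightarrow> x - y \<in> K i" "\<And>a x. x \<in> K i \<Longrightarrow> a * x \<in> K i"
    if i: "i \<in> I" for i
  proof -
    interpret Ri: ring "R i" by (rule ring[OF i])
    show "0 \<in> K i" using zero[OF i] by (simp add: K_def)
    show "x - y \<in> K i" if "x \<in> K i" "y \<in> K i" for x y
      unfolding K_iff[OF i] using that by (simp add: K_def)
    show "a * x \<in> K i" if "x \<in> K i" for a x
      using that mult[OF i, of a x] carr[OF i, of a] by (simp add: K_def)
  qed
  have "profinite_local_ring (K ` I)"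
  proof
    fix N assume "N \<in> K ` I"
    then obtain i where i: "i \<in> I" "N = K i" by blast
    have "range (\<lambda>x. {y. x - y \<in> N}) = (\<lambda>c. {y. c = \<pi> i y}) ` range (\<pi> i)"
      unfolding i(2) K_iff[OF i(1)] by auto
    moreover have "finite (range (\<pi> i))"
      using finite_subset[OF _ finite_carrier[OF i(1)]] carr[OF i(1)] by blast
    ultimately show "finite (range (\<lambda>x. {y. x - y \<in> N}))" by simp
  next
    fix M N assume "M \<in> K ` I" "N \<in> K ` I"
    then obtain i k where ik: "i \<in> I" "k \<in> I" "M = K i" "N = K k" by blast
    obtain l where l: "l \<in> I" "le i l" "le k l" using directed ik by blast
    then show "\<exists>L\<in>K ` I. L \<subseteq> M \<and> L \<subseteq> N" using K_mono ik by blast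
  next
    fix x :: 'a assume *: "\<And>N. N \<in> K ` I \<Longrightarrow> x \<in> N"
    show "x = 0"
    proof (rule inj)
      fix i assume i: "i \<in> I"
      then have "x - 0 \<in> K i" using * by simp
      then show "\<pi> i x = \<pi> i 0" using K_iff[OF i] by blast
    qed
  next
    fix x :: 'a and S
    show "x \<in> closure S \<longleftrightarrow> (\<forall>N\<in>K ` I. \<exists>y\<in>S. x - y \<in> N)"
    proof
      assume x: "x \<in> closure S"
      show "\<forall>N\<in>K ` I. \<exists>y\<in>S. x - y \<in> N"
      proof clarify
        fix i assume i: "i \<in> I"
        have "x \<in> {z. x - z \<in> K i}" using ideal(1)[OF i] by simp
        then have "S \<inter> {z. x - z \<in> K i} \<noteq> {}"
          using x open_K[OF i, of x] unfolding closure_iff_nhds_not_empty by blast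
        then show "\<exists>y\<in>S. x - y \<in> K i" by blast
      qed
    next
      assume *: "\<forall>N\<in>K ` I. \<exists>y\<in>S. x - y \<in> N"
      show "x \<in> closure S"
        unfolding closure_iff_nhds_not_empty
      proof (intro allI impI)
        fix A V assume "V \<subseteq> A" "open V" "x \<in> V"
        then show "S \<inter> A \<noteq> {}" using nhd[of V x] * by blast
      qed
    qed
  next
    fix y :: "'a set \<Rightarrow> 'a"
    assume y: "\<And>M N. M \<in> K ` I \<Longrightarrow> N \<in> K ` I \<Longrightarrow> M \<subseteq> N \<Longrightarrow> y M - y N \<in> N"
    let ?y = "\<lambda>i\<in>I. \<pi> i (y (K i))"
    have "?y \<in> topspace limit_topology"
    proof -
      have "\<phi> i k (?y k) = ?y i" if ik: "i \<in> I" "k \<in> I" "le i k" for i k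
      proof -
        have "y (K k) - y (K i) \<in> K i" using y[of "K k" "K i"] ik K_mono by blast
        then have "\<pi> i (y (K k)) = \<pi> i (y (K i))" using K_iff[OF ik(1)] by blast
        then show ?thesis using compat[OF ik] ik by simp
      qed
      then have "?y \<in> {x. \<forall>i\<in>I. \<forall>j\<in>I. le i j \<longrightarrow> \<phi> i j (x j) = x i}" by blast
      moreover have "?y \<in> Pi\<^sub>E I (\<lambda>i. carrier (R i))" by (rule restrict_PiE_iff[THEN iffD2]) (simp add: carr)
      ultimately show ?thesis by (simp add: limit_topology_def)
    qed
    then have "?y \<in> ?f ` topspace euclidean"
      using homeomorphic_imp_surjective_map[OF homeo] by (simp only:)
    then obtain x where x: "?y = ?f x" by (rule imageE)
    have "x - y (K i) \<in> K i" if i: "i \<in> I" for i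
      unfolding K_iff[OF i] using fun_cong[OF x, of i] i by simp
    then show "\<exists>x. \<forall>N\<in>K ` I. x - y N \<in> N" by blast
  next
    show "(2::'a) dvd 1"
    proof (rule ccontr)
      assume two: "\<not> (2::'a) dvd 1"
      have "\<exists>i\<in>I. \<pi> i 1 \<noteq> \<pi> i 0" using inj[of 1 0] by auto
      then obtain i where i: "i \<in> I" "1 - 0 \<notin> K i" using K_iff by blast
      interpret Ri: ring "R i" by (rule ring[OF i(1)])
      obtain n where n: "card (carrier (R i)) = p ^ n" using p_power_order[OF i(1)] by blast
      have "\<pi> i (of_nat k) = [k] \<cdot>\<^bsub>R i\<^esub> \<one>\<^bsub>R i\<^esub>" for k
        by (induction k) (simp_all add: zero one add i(1) Ri.add.nat_pow_Suc2 Ri.add.m_comm)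
      then have "\<pi> i (of_nat (p ^ n)) = \<zero>\<^bsub>R i\<^esub>"
        using Ri.add.pow_order_eq_1[OF Ri.one_closed] n by (simp add: order_def add_pow_def del: of_nat_power)
      then have 1: "of_nat (p ^ n) \<in> K i" by (simp add: K_def)
      have "\<not> of_nat (p ^ n) dvd (1::'a)"
      proof
        assume "of_nat (p ^ n) dvd (1::'a)"
        then obtain a where "(1::'a) = of_nat (p ^ n) * a" by (rule dvdE)
        then show False using ideal(3)[OF i(1) 1, of a] i(2) by (simp add: mult.commute)
      qed
      moreover obtain k where k: "p ^ n = 2 * k + 1" using odd by (metis odd_pos oddE even_power)
      have "\<not> (- (2 * of_nat k)) dvd (1::'a)" using nonunit_minus[OF nonunit_mult[OF two]] .
      ultimately have "\<not> (of_nat (p ^ n) + - (2 * of_nat k)) dvd (1::'a)" by (rule nonunit_add)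
      then show False unfolding k by simp
    qed
  qed (use ideal in blast)+
  then show thesis by (rule that)
qed

context profinite_local_ring begin

sublocale whole: local_subring "UNIV :: 'a set"
  by unfold_locales (use two_unit in auto)

lemma N_ideal: "N \<in> NN \<Longrightarrow> whole.ideal_of N"
proof -
  assume N: "N \<in> NN"
  have "x + y \<in> N" if "x \<in> N" "y \<in> N" for x y
    using diff_N[OF N that(1) diff_N[OF N zero_N[OF N] that(2)]] by simp
  then show ?thesis unfolding whole.ideal_of_def using zero_N[OF N] mult_N[OF N] by blast
qed

lemma proper_N:
  assumes "N \<in> NN" "1 \<notin> N" "x \<in> N" shows "\<not> x dvd 1"
proof
  assume "x dvd 1"
  then obtain y where "1 = x * y" by (rule dvdE)
  then show False using mult_N[OF assms(1,3), of y] assms(2) by (simp add: mult.commute)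
qed

lemma ex_proper_N: "\<exists>N\<in>NN. 1 \<notin> N"
  using separated[of 1] by auto

definition coset :: "'a set \<Rightarrow> 'a \<Rightarrow> 'a set" where "coset N x = {y. x - y \<in> N}"

lemma coset_eq_iff: "N \<in> NN \<Longrightarrow> coset N x = coset N y \<longleftrightarrow> x - y \<in> N"
proof -
  assume N: "N \<in> NN"
  note I = whole.ideal_ofD[OF N_ideal[OF N]]
  show ?thesis
  proof
    assume "coset N x = coset N y" moreover have "y \<in> coset N y" using I(2) by (simp add: coset_def)
    ultimately show "x - y \<in> N" by (auto simp: coset_def)
  next
    assume xy: "x - y \<in> N"
    have "x - w \<in> N \<longleftrightarrow> y - w \<in> N" for w
      using I(3)[OF xy, of "y - w"] I(4)[OF _ xy, of "x - w"] by auto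
    then show "coset N x = coset N y" by (simp add: coset_def)
  qed
qed

lemma finite_cosets: "N \<in> NN \<Longrightarrow> finite (coset N ` B)"
  using finite_subset[OF image_mono[OF subset_UNIV] finite_index] by (simp add: coset_def[abs_def])

text \<open>
  Injectivity modulo \<open>N\<close> implies surjectivity modulo \<open>N\<close>, because the quotient is finite. Existence of
  inverses and of roots in closed subrings follows from this without iteration. The induced map on
  classes is formed with chosen representatives.
\<close>

lemma surj_mod_N:
  assumes N: "N \<in> NN" and f: "f ` S \<subseteq> S"
    and inj: "\<And>x y. x \<in> S \<Longrightarrow> y \<in> S \<Longrightarrow> f x - f y \<in> N \<Longrightarrow> x - y \<in> N" and z: "z \<in> S"
  shows "\<exists>x\<in>S. f x - z \<in> N"
proof -
  define c where "c = coset N"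
  have c: "c x = c y \<longleftrightarrow> x - y \<in> N" for x y
    unfolding c_def by (rule coset_eq_iff[OF N])
  have fin: "finite (c ` S)" unfolding c_def by (rule finite_cosets[OF N])
  define rep where "rep C = (SOME x. x \<in> S \<and> c x = C)" for C
  have rep: "rep C \<in> S" "c (rep C) = C" if "C \<in> c ` S" for C
    using someI_ex[of "\<lambda>x. x \<in> S \<and> c x = C"] that unfolding rep_def by blast+
  define F where "F C = c (f (rep C))" for C
  have "inj_on F (c ` S)"
  proof (rule inj_onI)
    fix C D assume CD: "C \<in> c ` S" "D \<in> c ` S" "F C = F D"
    then have "rep C - rep D \<in> N" using inj[OF rep(1) rep(1)] by (simp add: F_def c)
    then have "c (rep C) = c (rep D)" by (rule c[THEN iffD2])
    then show "C = D" using rep(2)[OF CD(1)] rep(2)[OF CD(2)] by simp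
  qed
  moreover have "F C \<in> c ` S" if "C \<in> c ` S" for C
    unfolding F_def using imageI[OF subsetD[OF f imageI[OF rep(1)[OF that]]]] .
  then have "F ` (c ` S) \<subseteq> c ` S" by (rule image_subsetI)
  ultimately have "F ` (c ` S) = c ` S" using endo_inj_surj[OF fin] by metis
  then have "c z \<in> F ` (c ` S)" using z by simp
  then obtain C where "C \<in> c ` S" "F C = c z" by (metis imageE)
  then show ?thesis using rep(1) c unfolding F_def by blast
qed

text \<open>
  The polynomial \<open>X\<^sup>2 - b X + c\<close> maps \<open>a\<close> plus the non-units to the non-units, and it is injective there
  modulo \<open>N\<close> because its difference quotients are congruent to the unit \<open>2 a - b\<close> modulo non-units.
\<close>

lemma hensel_mod_N:
  assumes N: "N \<in> NN" and R: "1 \<in> R" "\<And>x y. x \<in> R \<Longrightarrow> y \<in> R \<Longrightarrow> x - y \<in> R" "\<And>x y. x \<in> R \<Longrightarrow> y \<in> R \<Longrightarrow> x * y \<in> R"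
    and abc: "a \<in> R" "b \<in> R" "c \<in> R" "\<not> (a * a - b * a + c) dvd 1" "(2 * a - b) dvd 1"
  shows "\<exists>x\<in>R. \<not> (x - a) dvd 1 \<and> x * x - b * x + c \<in> N"
proof -
  have R_zero: "0 \<in> R" using R(2)[OF R(1) R(1)] by simp
  have R_add: "x + y \<in> R" if "x \<in> R" "y \<in> R" for x y
    using R(2)[OF that(1) R(2)[OF R_zero that(2)]] by simp
  define S where "S = {y \<in> R. \<not> y dvd 1}"
  define f where "f y = (a + y) * (a + y) - b * (a + y) + c" for y
  have "f ` S \<subseteq> S"
  proof clarify
    fix y assume y: "y \<in> S"
    have "f y = (a * a - b * a + c) + y * (2 * a - b + y)" by (simp add: f_def algebra_simps)
    moreover have "\<not> y dvd 1" using y by (simp add: S_def)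
    ultimately have "\<not> f y dvd 1" using nonunit_add[OF abc(4) nonunit_mult] by metis
    moreover have "f y \<in> R" unfolding f_def using y abc by (auto simp: S_def intro!: R R_add)
    ultimately show "f y \<in> S" by (simp add: S_def)
  qed
  moreover have "x - y \<in> N" if xy: "x \<in> S" "y \<in> S" "f x - f y \<in> N" for x y
  proof -
    have n: "\<not> (- (x + y)) dvd 1" using xy nonunit_add nonunit_minus unfolding S_def by blast
    have "(2 * a - b + (x + y)) dvd 1"
    proof (rule ccontr)
      assume "\<not> ?thesis"
      from nonunit_add[OF this n] show False using abc(5) by simp
    qed
    then obtain v where v: "1 = (2 * a - b + (x + y)) * v" by (rule dvdE)
    have "x - y = v * (f x - f y)" using v unfolding f_def by Groebner_Basis.algebra
    then show ?thesis using mult_N[OF N xy(3)] by simp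
  qed
  moreover have "0 \<in> S" using R_zero by (simp add: S_def)
  ultimately obtain y where y: "y \<in> S" "f y - 0 \<in> N" using surj_mod_N[OF N, of f S 0] by blast
  have "a + y \<in> R" "\<not> (a + y - a) dvd 1" using y abc R_add by (auto simp: S_def)
  then show ?thesis using y(2) unfolding f_def by (metis diff_zero)
qed

text \<open>
  Approximate roots near \<open>a\<close> are unique modulo \<open>N\<close>, so they form a coherent family.
\<close>

lemma hensel_root:
  fixes a b c :: 'a
  assumes abc: "\<not> (a * a - b * a + c) dvd 1" "(2 * a - b) dvd 1"
  obtains x where "\<not> (x - a) dvd 1" "x * x - b * x + c = 0"
proof -
  have "\<forall>N\<in>NN. \<exists>x. \<not> (x - a) dvd 1 \<and> x * x - b * x + c \<in> N"
    using hensel_mod_N[of _ UNIV a b c] abc by blast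
  then obtain f where f: "\<And>N. N \<in> NN \<Longrightarrow> \<not> (f N - a) dvd 1" "\<And>N. N \<in> NN \<Longrightarrow> f N * f N - b * f N + c \<in> N"
    by metis
  have "f M - f N \<in> N" if MN: "M \<in> NN" "N \<in> NN" "M \<subseteq> N" for M N
  proof -
    have n: "\<not> (- ((f M - a) + (f N - a))) dvd 1" using f(1) MN nonunit_add nonunit_minus by blast
    have "(f M + f N - b) dvd 1"
    proof (rule ccontr)
      assume "\<not> ?thesis"
      from nonunit_add[OF this n] show False using abc(2) by (simp add: algebra_simps)
    qed
    then obtain v where v: "1 = (f M + f N - b) * v" by (rule dvdE)
    have "f M - f N = v * ((f M * f M - b * f M + c) - (f N * f N - b * f N + c))"
      using v by Groebner_Basis.algebra
    moreover have "(f M * f M - b * f M + c) - (f N * f N - b * f N + c) \<in> N"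
      using f(2) MN by (intro diff_N) blast+
    ultimately show ?thesis using mult_N[OF MN(2)] by metis
  qed
  from complete[of f, OF this] obtain x where x: "\<And>N. N \<in> NN \<Longrightarrow> x - f N \<in> N" by blast
  have "x * x - b * x + c \<in> N" if N: "N \<in> NN" for N
  proof -
    have "x * x - b * x + c = (x + f N - b) * (x - f N) - - 1 * (f N * f N - b * f N + c)"
      by (simp add: algebra_simps)
    also have "\<dots> \<in> N" by (intro diff_N mult_N N x f)
    finally show ?thesis .
  qed
  then have root: "x * x - b * x + c = 0" by (rule separated)
  obtain N where N: "N \<in> NN" "1 \<notin> N" using ex_proper_N by blast
  have "\<not> ((x - f N) + (f N - a)) dvd 1" using nonunit_add[OF proper_N[OF N x[OF N(1)]] f(1)[OF N(1)]] .
  then have "\<not> (x - a) dvd 1" by simp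
  from that[OF this root] show thesis .
qed

lemma closed_subring_inverse:
  fixes R :: "'a set"
  assumes R: "closure R = R" "\<And>x y. x \<in> R \<Longrightarrow> y \<in> R \<Longrightarrow> x * y \<in> R" "1 \<in> R" and x: "x \<in> R" "x * y = 1"
  shows "y \<in> R"
proof -
  have "\<exists>w\<in>R. y - w \<in> N" if N: "N \<in> NN" for N
  proof -
    have "\<exists>w\<in>R. x * w - 1 \<in> N"
    proof (rule surj_mod_N[OF N])
      fix u v assume "x * u - x * v \<in> N"
      then have "y * (x * u - x * v) \<in> N" by (rule mult_N[OF N])
      moreover have "y * (x * u - x * v) = u - v" using x(2) by Groebner_Basis.algebra
      ultimately show "u - v \<in> N" by simp
    qed (use R x in auto)
    then obtain w where w: "w \<in> R" "x * w - 1 \<in> N" by blast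
    have "y - w = - y * (x * w - 1)" using x(2) by Groebner_Basis.algebra
    then show ?thesis using w mult_N[OF N w(2), of "- y"] by metis
  qed
  then have "y \<in> closure R" unfolding closure_iff by blast
  then show ?thesis using R(1) by simp
qed

text \<open>
  A root \<open>u\<close> of a quadratic polynomial over \<open>R\<close> lies in \<open>R\<close> if its reduction is a simple root and
  comes from an element of \<open>R\<close>: the approximate roots found in \<open>R\<close> converge to \<open>u\<close>.
\<close>

lemma closed_subring_root:
  fixes R :: "'a set"
  assumes R: "closure R = R" "1 \<in> R" "\<And>x y. x \<in> R \<Longrightarrow> y \<in> R \<Longrightarrow> x - y \<in> R" "\<And>x y. x \<in> R \<Longrightarrow> y \<in> R \<Longrightarrow> x * y \<in> R"
    and a: "a \<in> R" "\<not> (u - a) dvd 1" and u: "u + u' \<in> R" "u * u' \<in> R" "(u - u') dvd 1"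
  shows "u \<in> R"
proof -
  have "\<exists>w\<in>R. u - w \<in> N" if N: "N \<in> NN" for N
  proof -
    have na: "\<not> (a - u) dvd 1" using nonunit_minus[OF a(2)] by simp
    have "\<not> ((a - u) * (a - u')) dvd 1" using nonunit_mult[OF na] .
    moreover have "(a - u) * (a - u') = a * a - (u + u') * a + u * u'" by (simp add: algebra_simps)
    ultimately have 1: "\<not> (a * a - (u + u') * a + u * u') dvd 1" by simp
    have 2: "(2 * a - (u + u')) dvd 1"
    proof (rule ccontr)
      assume *: "\<not> ?thesis"
      from nonunit_add[OF * nonunit_add[OF a(2) a(2)]] show False using u(3) by (simp add: algebra_simps)
    qed
    obtain x where x: "x \<in> R" "\<not> (x - a) dvd 1" "x * x - (u + u') * x + u * u' \<in> N"
      using hensel_mod_N[OF N R(2-4) a(1) u(1,2) 1 2] by blast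
    have "(x - u') dvd 1"
    proof (rule ccontr)
      assume *: "\<not> ?thesis"
      have "\<not> ((x - u') + - (x - a)) dvd 1" by (rule nonunit_add[OF * nonunit_minus[OF x(2)]])
      from nonunit_add[OF this a(2)] show False using u(3) by (simp add: algebra_simps)
    qed
    then obtain v where v: "1 = (x - u') * v" by (rule dvdE)
    have "u - x = - v * (x * x - (u + u') * x + u * u')" using v by Groebner_Basis.algebra
    then show ?thesis using x mult_N[OF N x(3), of "- v"] by metis
  qed
  then have "u \<in> closure R" unfolding closure_iff by blast
  then show ?thesis using R(1) by simp
qed

lemma closed_N: "N \<in> NN \<Longrightarrow> closed N"
proof -
  assume N: "N \<in> NN"
  have "x \<in> N" if x: "x \<in> closure N" for x
  proof -
    obtain y where y: "y \<in> N" "x - y \<in> N" using x N unfolding closure_iff by blast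
    then show ?thesis using whole.ideal_ofD(3)[OF N_ideal[OF N] y(2,1)] by simp
  qed
  then show ?thesis using closure_subset_eq by blast
qed

lemma compact_image_attains:
  fixes f :: "'g \<Rightarrow> 'a ^ 2 ^ 2" and M :: "'a ^ 2 ^ 2"
  assumes T: "compact_space T" and f: "continuous_map T euclidean f"
    and approx: "\<And>N. N \<in> NN \<Longrightarrow> \<exists>g\<in>topspace T. mcong N (f g) M"
  shows "\<exists>g\<in>topspace T. f g = M"
proof -
  define C where "C N = {g \<in> topspace T. mcong N (f g) M}" for N
  have closed: "closedin T (C N)" if N: "N \<in> NN" for N
  proof -
    have "closed ((\<lambda>Y. Y $ i $ k - M $ i $ k) -` N)" for i k
      by (intro closed_vimage closed_N[OF N] continuous_intros)
    then have "closed (\<Inter>i\<in>UNIV. \<Inter>k\<in>UNIV. (\<lambda>Y. Y $ i $ k - M $ i $ k) -` N)" by blast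
    moreover have "(\<Inter>i\<in>UNIV. \<Inter>k\<in>UNIV. (\<lambda>Y. Y $ i $ k - M $ i $ k) -` N) = Collect (\<lambda>Y. mcong N Y M)"
      by (auto simp: mcong_def)
    ultimately have "closed (Collect (\<lambda>Y. mcong N Y M))" by simp
    then show ?thesis using closedin_continuous_map_preimage[OF f, of "Collect (\<lambda>Y. mcong N Y M)"] by (simp add: C_def)
  qed
  have fip: "\<Inter>\<F> \<noteq> {}" if F: "finite \<F>" "\<F> \<subseteq> C ` NN" for \<F>
  proof -
    obtain K where K: "finite K" "K \<subseteq> NN" "\<F> = C ` K" using finite_subset_image[OF F] by blast
    have "\<exists>L\<in>NN. \<forall>N\<in>K. L \<subseteq> N" using K(1,2)
    proof (induction K)
      case empty then show ?case using ex_proper_N by blast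
    next
      case (insert N K)
      then obtain L where "L \<in> NN" "\<forall>N\<in>K. L \<subseteq> N" by blast
      moreover obtain L' where "L' \<in> NN" "L' \<subseteq> L" "L' \<subseteq> N"
        using directed_N[OF \<open>L \<in> NN\<close>, of N] insert.prems by auto
      ultimately show ?case by (intro bexI[of _ L']) auto
    qed
    then obtain L where L: "L \<in> NN" "\<forall>N\<in>K. L \<subseteq> N" by blast
    obtain g where "g \<in> topspace T" "mcong L (f g) M" using approx[OF L(1)] by blast
    then have "g \<in> \<Inter>\<F>" using L(2) mcong_mono unfolding K(3) C_def by blast
    then show ?thesis by blast
  qed
  have "\<Inter>(C ` NN) \<noteq> {}"
    using compact_space_fip[THEN iffD1, OF T, rule_format, of "C ` NN"] closed fip by blast
  then obtain g where g: "\<And>N. N \<in> NN \<Longrightarrow> g \<in> C N" by blast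
  have "f g $ i $ k = M $ i $ k" for i k
    using separated[of "f g $ i $ k - M $ i $ k"] g unfolding C_def mcong_def by auto
  moreover have "g \<in> topspace T" using g ex_proper_N unfolding C_def by blast
  ultimately show ?thesis by (auto simp: vec_eq_iff)
qed

end

section \<open>Groups of matrices with given adjoint traces\<close>

locale adjoint_group = local_subring R for R :: "'a::{idom,local_ring} set" +
  fixes \<Gamma> :: "('a ^ 2 ^ 2) set"
  assumes \<Gamma>_one: "mat 1 \<in> \<Gamma>"
    and \<Gamma>_mult: "g \<in> \<Gamma> \<Longrightarrow> h \<in> \<Gamma> \<Longrightarrow> g ** h \<in> \<Gamma>"
    and \<Gamma>_inverse: "g \<in> \<Gamma> \<Longrightarrow> \<exists>h\<in>\<Gamma>. g ** h = mat 1"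
    and adjoint_trace: "g \<in> \<Gamma> \<Longrightarrow> det g * v = 1 \<Longrightarrow> (trace g)\<^sup>2 * v \<in> R"
begin

lemma det_unit: "g \<in> \<Gamma> \<Longrightarrow> \<exists>v. det g * v = 1"
proof -
  assume "g \<in> \<Gamma>"
  then obtain h where "g ** h = mat 1" using \<Gamma>_inverse by blast
  then have "det g * det h = 1" by (metis det_I det_mul)
  then show ?thesis by blast
qed

lemma conjugate:
  assumes P: "P ** P' = mat 1" "P' ** P = mat 1"
  shows "adjoint_group R ((\<lambda>g. P' ** g ** P) ` \<Gamma>)"
proof
  have cancel: "P' ** g ** P ** (P' ** h ** P) = P' ** (g ** h) ** P" for g h
  proof -
    have "P' ** g ** P ** (P' ** h ** P) = P' ** g ** (P ** P') ** h ** P" by (simp only: matrix_mul_assoc)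
    then show ?thesis unfolding P(1) by (simp only: matrix_mul_rid matrix_mul_assoc)
  qed
  have "mat 1 = P' ** mat 1 ** P" using P(2) by (simp add: matrix_mul_rid)
  then show "mat 1 \<in> (\<lambda>g. P' ** g ** P) ` \<Gamma>" using \<Gamma>_one by blast
  fix g assume "g \<in> (\<lambda>g. P' ** g ** P) ` \<Gamma>"
  then obtain g' where g: "g' \<in> \<Gamma>" "g = P' ** g' ** P" by blast
  show "g ** h \<in> (\<lambda>g. P' ** g ** P) ` \<Gamma>" if "h \<in> (\<lambda>g. P' ** g ** P) ` \<Gamma>" for h
    using that g \<Gamma>_mult cancel by auto
  obtain h where h: "h \<in> \<Gamma>" "g' ** h = mat 1" using \<Gamma>_inverse[OF g(1)] by blast
  have "g ** (P' ** h ** P) = mat 1" unfolding g(2) cancel h(2) using P(2) by (simp add: matrix_mul_rid)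
  then show "\<exists>h\<in>(\<lambda>g. P' ** g ** P) ` \<Gamma>. g ** h = mat 1" using h(1) by blast
  have d: "det P * det P' = 1" using P(1) by (metis det_I det_mul)
  fix v assume "det g * v = 1"
  then have "det g' * v = 1" using d unfolding g(2) det_mul by (metis mult.assoc mult.commute mult_1)
  from adjoint_trace[OF g(1) this] have "(trace g')\<^sup>2 * v \<in> R" .
  moreover have "trace g = trace g'"
  proof -
    have "trace g = trace (P ** (P' ** g'))" unfolding g(2) by (rule trace_mul_sym)
    then show ?thesis unfolding matrix_mul_assoc P(1) matrix_mul_lid .
  qed
  ultimately show "(trace g)\<^sup>2 * v \<in> R" by simp
qed

end

text \<open>
  Conjugation by the diagonal element scales the upper right entry by the ratio \<open>r\<close> of its eigenvalues.
  As \<open>r\<^sup>2 - 1\<close> is a unit, the weights \<open>r\<close>, \<open>1\<close> and \<open>1/r\<close> are distinct modulo the maximal ideal.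
\<close>

locale torus_group = adjoint_group R \<Gamma> for R :: "'a::{idom,local_ring} set" and \<Gamma> +
  fixes s1 s2 r r' :: 'a
  assumes torus: "mat2 s1 0 0 s2 \<in> \<Gamma>" "s1 = r * s2"
    and r: "r \<in> R" "r * r' = 1" "(r\<^sup>2 - 1) dvd 1"
begin

lemma r'_closed: "r' \<in> R"
  using inverse_closed r by blast

lemma vandermonde:
  assumes "x + y + z \<in> R" "r * x + y + r' * z \<in> R" "r\<^sup>2 * x + y + r'\<^sup>2 * z \<in> R"
  shows "x \<in> R" "y \<in> R" "z \<in> R"
proof -
  obtain b where b: "b \<in> R" "(r\<^sup>2 - 1) * b = 1" using unit_inverse[OF _ r(3)] r(1) by (auto intro: closed)
  define a where "a = b * (r + 1)"
  have a: "a \<in> R" unfolding a_def by (intro closed b r)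
  define A where "A = a * ((r * x + y + r' * z) - (x + y + z))"
  define B where "B = b * ((r\<^sup>2 * x + y + r'\<^sup>2 * z) - (x + y + z))"
  have AB: "A \<in> R" "B \<in> R" unfolding A_def B_def by (intro closed assms a b)+
  have "z = - (r\<^sup>2 * a * (A - B))"
    using b(2) r(2) unfolding A_def B_def a_def by Groebner_Basis.algebra
  moreover have "- (r\<^sup>2 * a * (A - B)) \<in> R" by (intro closed r a AB)
  ultimately show z: "z \<in> R" by simp
  have "x = A + r' * z"
    using b(2) r(2) unfolding A_def a_def by Groebner_Basis.algebra
  moreover have "A + r' * z \<in> R" by (intro closed r'_closed AB z)
  ultimately show x: "x \<in> R" by simp
  have "y = (x + y + z) - x - z" by simp
  moreover have "(x + y + z) - x - z \<in> R" by (intro closed assms x z)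
  ultimately show "y \<in> R" by simp
qed

lemma torus_unit: "(s1 * s2) dvd 1"
proof -
  obtain v where "s1 * s2 * v = 1" using det_unit[OF torus(1)] by auto
  then show ?thesis by (metis dvdI)
qed

lemma torus_power: "mat2 (s1 ^ n) 0 0 (s2 ^ n) \<in> \<Gamma>"
proof (induction n)
  case 0 show ?case using \<Gamma>_one by (simp add: mat_1_mat2)
next
  case (Suc n) show ?case using \<Gamma>_mult[OF torus(1) Suc] by simp
qed

text \<open>
  The hypothesis collects adjoint traces of products with the powers of the torus. Expanding the square
  splits it into the three weights \<open>r\<close>, \<open>1\<close>, \<open>1/r\<close>, which the Vandermonde matrix separates.
\<close>

lemma weights:
  assumes w: "s1 * s2 * w = 1"
    and sq: "\<And>n. (s1 ^ n * A + s2 ^ n * B)\<^sup>2 * (w ^ n * v) \<in> R"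
  shows "A\<^sup>2 * v \<in> R" "A * B * v \<in> R" "B\<^sup>2 * v \<in> R"
proof -
  have e: "s1\<^sup>2 * w = r" "s2\<^sup>2 * w = r'" using w torus(2) r(2) by Groebner_Basis.algebra+
  have 0: "A\<^sup>2 * v + 2 * A * B * v + B\<^sup>2 * v \<in> R"
    using sq[of 0] by (simp add: power2_eq_square algebra_simps)
  have "(s1 ^ 1 * A + s2 ^ 1 * B)\<^sup>2 * (w ^ 1 * v) = (s1\<^sup>2 * w) * (A\<^sup>2 * v) + 2 * A * B * v * (s1 * s2 * w) + (s2\<^sup>2 * w) * (B\<^sup>2 * v)"
    by (simp add: power2_eq_square algebra_simps)
  then have 1: "r * (A\<^sup>2 * v) + 2 * A * B * v + r' * (B\<^sup>2 * v) \<in> R" using sq[of 1] unfolding e w by simp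
  have "(s1 ^ 2 * A + s2 ^ 2 * B)\<^sup>2 * (w ^ 2 * v) =
      (s1\<^sup>2 * w)\<^sup>2 * (A\<^sup>2 * v) + 2 * A * B * v * (s1 * s2 * w)\<^sup>2 + (s2\<^sup>2 * w)\<^sup>2 * (B\<^sup>2 * v)"
    by (simp add: power2_eq_square algebra_simps)
  then have 2: "r\<^sup>2 * (A\<^sup>2 * v) + 2 * A * B * v + r'\<^sup>2 * (B\<^sup>2 * v) \<in> R" using sq[of 2] unfolding e w by simp
  show "A\<^sup>2 * v \<in> R" "B\<^sup>2 * v \<in> R" using vandermonde(1,3)[OF 0 1 2] .
  obtain h where h: "h \<in> R" "2 * h = 1" using half by blast
  have "h * (2 * A * B * v) \<in> R" by (intro mult_closed h vandermonde(2)[OF 0 1 2])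
  moreover have "h * (2 * A * B * v) = A * B * v" using h(2) by Groebner_Basis.algebra
  ultimately show "A * B * v \<in> R" by simp
qed

lemma diagonal_products:
  assumes g: "mat2 \<alpha> \<beta> \<gamma> \<delta> \<in> \<Gamma>" "(\<alpha> * \<delta> - \<beta> * \<gamma>) * v = 1"
  shows "\<alpha>\<^sup>2 * v \<in> R" "\<alpha> * \<delta> * v \<in> R" "\<delta>\<^sup>2 * v \<in> R"
proof -
  obtain w where w: "s1 * s2 * w = 1" using torus_unit by (metis dvdE)
  have "(s1 ^ n * \<alpha> + s2 ^ n * \<delta>)\<^sup>2 * (w ^ n * v) \<in> R" for n
  proof -
    let ?h = "mat2 (s1 ^ n) 0 0 (s2 ^ n) ** mat2 \<alpha> \<beta> \<gamma> \<delta>"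
    have "?h \<in> \<Gamma>" by (rule \<Gamma>_mult[OF torus_power g(1)])
    moreover have "det ?h * (w ^ n * v) = (s1 * s2 * w) ^ n * ((\<alpha> * \<delta> - \<beta> * \<gamma>) * v)"
      by (simp add: algebra_simps)
    then have "det ?h * (w ^ n * v) = 1" using w g(2) by simp
    ultimately have "(trace ?h)\<^sup>2 * (w ^ n * v) \<in> R" by (rule adjoint_trace)
    then show ?thesis by simp
  qed
  from weights[OF w this] show "\<alpha>\<^sup>2 * v \<in> R" "\<alpha> * \<delta> * v \<in> R" "\<delta>\<^sup>2 * v \<in> R" .
qed

end

text \<open>
  Up to the scalar \<open>\<kappa>\<close> the frame element has entries \<open>1, 1, \<gamma>0, \<delta>0\<close> in \<open>R\<close>. Multiplication by it moves
  off-diagonal entries into the diagonal, where the torus can separate them.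
\<close>

locale framed_group = torus_group +
  fixes \<kappa> \<gamma>0 \<delta>0
  assumes frame: "mat2 \<kappa> \<kappa> (\<kappa> * \<gamma>0) (\<kappa> * \<delta>0) \<in> \<Gamma>" "\<kappa> dvd 1" "\<gamma>0 \<in> R" "\<gamma>0 dvd 1" "\<delta>0 \<in> R" "\<delta>0 dvd 1"
    "(\<delta>0 - \<gamma>0) dvd 1"
begin

lemma left_products:
  assumes g: "mat2 \<alpha> \<beta> \<gamma> \<delta> \<in> \<Gamma>" "(\<alpha> * \<delta> - \<beta> * \<gamma>) * v = 1"
  shows "\<alpha> * \<gamma> * v \<in> R" "\<gamma>\<^sup>2 * v \<in> R" "\<beta>\<^sup>2 * v \<in> R" "\<beta> * \<delta> * v \<in> R"
proof -
  obtain w where w: "s1 * s2 * w = 1" using torus_unit by (metis dvdE)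
  obtain \<kappa>' where \<kappa>': "\<kappa> * \<kappa>' = 1" using frame(2) by (metis dvdE)
  have eR: "\<delta>0 - \<gamma>0 \<in> R" by (intro closed frame)
  obtain e where e: "e \<in> R" "(\<delta>0 - \<gamma>0) * e = 1" using unit_inverse[OF eR frame(7)] by blast
  have sq: "(s1 ^ n * \<alpha> + s2 ^ n * \<gamma>)\<^sup>2 * (w ^ n * v) \<in> R \<and>
      (s1 ^ n * (\<gamma>0 * \<beta>) + s2 ^ n * (\<delta>0 * \<delta>))\<^sup>2 * (w ^ n * v) \<in> R" for n
  proof -
    let ?h = "mat2 \<kappa> \<kappa> (\<kappa> * \<gamma>0) (\<kappa> * \<delta>0) ** (mat2 (s1 ^ n) 0 0 (s2 ^ n) ** mat2 \<alpha> \<beta> \<gamma> \<delta>)"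
    let ?v = "\<kappa>'\<^sup>2 * e * w ^ n * v"
    let ?a = "\<kappa> * (s1 ^ n * \<alpha> + s2 ^ n * \<gamma>)" and ?b = "\<kappa> * (s1 ^ n * \<beta> + s2 ^ n * \<delta>)"
    let ?c = "\<kappa> * (s1 ^ n * (\<gamma>0 * \<alpha>) + s2 ^ n * (\<delta>0 * \<gamma>))" and ?d = "\<kappa> * (s1 ^ n * (\<gamma>0 * \<beta>) + s2 ^ n * (\<delta>0 * \<delta>))"
    have "?h \<in> \<Gamma>" by (intro \<Gamma>_mult torus_power frame(1) g(1))
    moreover have "?h = mat2 ?a ?b ?c ?d" by (simp add: algebra_simps)
    ultimately have h: "mat2 ?a ?b ?c ?d \<in> \<Gamma>" by simp
    have "(?a * ?d - ?b * ?c) * ?v = (\<kappa> * \<kappa>')\<^sup>2 * ((\<delta>0 - \<gamma>0) * e) * (s1 * s2 * w) ^ n * ((\<alpha> * \<delta> - \<beta> * \<gamma>) * v)"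
      unfolding power_mult_distrib by Groebner_Basis.algebra
    then have v: "(?a * ?d - ?b * ?c) * ?v = 1" using w g(2) \<kappa>' e(2) by simp
    have "(\<delta>0 - \<gamma>0) * (?a\<^sup>2 * ?v) = (\<kappa> * \<kappa>')\<^sup>2 * ((\<delta>0 - \<gamma>0) * e) * ((s1 ^ n * \<alpha> + s2 ^ n * \<gamma>)\<^sup>2 * (w ^ n * v))"
      "(\<delta>0 - \<gamma>0) * (?d\<^sup>2 * ?v) = (\<kappa> * \<kappa>')\<^sup>2 * ((\<delta>0 - \<gamma>0) * e) * ((s1 ^ n * (\<gamma>0 * \<beta>) + s2 ^ n * (\<delta>0 * \<delta>))\<^sup>2 * (w ^ n * v))"
      unfolding power_mult_distrib by Groebner_Basis.algebra+
    then have E: "(\<delta>0 - \<gamma>0) * (?a\<^sup>2 * ?v) = (s1 ^ n * \<alpha> + s2 ^ n * \<gamma>)\<^sup>2 * (w ^ n * v)"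
      "(\<delta>0 - \<gamma>0) * (?d\<^sup>2 * ?v) = (s1 ^ n * (\<gamma>0 * \<beta>) + s2 ^ n * (\<delta>0 * \<delta>))\<^sup>2 * (w ^ n * v)"
      unfolding \<kappa>' e(2) by simp_all
    show ?thesis
      using mult_closed[OF eR diagonal_products(1)[OF h v]] mult_closed[OF eR diagonal_products(3)[OF h v]]
      unfolding E by blast
  qed
  show "\<alpha> * \<gamma> * v \<in> R" "\<gamma>\<^sup>2 * v \<in> R" using weights(2,3)[OF w, of \<alpha> \<gamma> v] sq by blast+
  have W: "(\<gamma>0 * \<beta>)\<^sup>2 * v \<in> R" "\<gamma>0 * \<beta> * (\<delta>0 * \<delta>) * v \<in> R"
    using weights(1,2)[OF w, of "\<gamma>0 * \<beta>" "\<delta>0 * \<delta>" v] sq by blast+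
  obtain c where c: "c \<in> R" "\<gamma>0 * c = 1" using unit_inverse[OF frame(3,4)] by blast
  obtain d where d: "d \<in> R" "\<delta>0 * d = 1" using unit_inverse[OF frame(5,6)] by blast
  have "c\<^sup>2 * ((\<gamma>0 * \<beta>)\<^sup>2 * v) = \<beta>\<^sup>2 * v" "c * d * (\<gamma>0 * \<beta> * (\<delta>0 * \<delta>) * v) = \<beta> * \<delta> * v"
    using c(2) d(2) by Groebner_Basis.algebra+
  moreover have "c\<^sup>2 * ((\<gamma>0 * \<beta>)\<^sup>2 * v) \<in> R" "c * d * (\<gamma>0 * \<beta> * (\<delta>0 * \<delta>) * v) \<in> R"
    by (intro mult_closed power_closed c d W)+
  ultimately show "\<beta>\<^sup>2 * v \<in> R" "\<beta> * \<delta> * v \<in> R" by (simp_all only:)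
qed

lemma right_products:
  assumes g: "mat2 \<alpha> \<beta> \<gamma> \<delta> \<in> \<Gamma>" "(\<alpha> * \<delta> - \<beta> * \<gamma>) * v = 1"
  shows "\<alpha> * \<beta> * v \<in> R" "\<gamma> * \<delta> * v \<in> R"
proof -
  obtain w where w: "s1 * s2 * w = 1" using torus_unit by (metis dvdE)
  obtain \<kappa>' where \<kappa>': "\<kappa> * \<kappa>' = 1" using frame(2) by (metis dvdE)
  have eR: "\<delta>0 - \<gamma>0 \<in> R" by (intro closed frame)
  obtain e where e: "e \<in> R" "(\<delta>0 - \<gamma>0) * e = 1" using unit_inverse[OF eR frame(7)] by blast
  have sq: "(s1 ^ n * \<alpha> + s2 ^ n * (\<gamma>0 * \<beta>))\<^sup>2 * (w ^ n * v) \<in> R \<and>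
      (s1 ^ n * \<gamma> + s2 ^ n * (\<delta>0 * \<delta>))\<^sup>2 * (w ^ n * v) \<in> R" for n
  proof -
    let ?h = "mat2 \<alpha> \<beta> \<gamma> \<delta> ** (mat2 (s1 ^ n) 0 0 (s2 ^ n) ** mat2 \<kappa> \<kappa> (\<kappa> * \<gamma>0) (\<kappa> * \<delta>0))"
    let ?v = "\<kappa>'\<^sup>2 * e * w ^ n * v"
    let ?a = "\<kappa> * (s1 ^ n * \<alpha> + s2 ^ n * (\<gamma>0 * \<beta>))" and ?b = "\<kappa> * (s1 ^ n * \<alpha> + s2 ^ n * (\<delta>0 * \<beta>))"
    let ?c = "\<kappa> * (s1 ^ n * \<gamma> + s2 ^ n * (\<gamma>0 * \<delta>))" and ?d = "\<kappa> * (s1 ^ n * \<gamma> + s2 ^ n * (\<delta>0 * \<delta>))"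
    have "?h \<in> \<Gamma>" by (intro \<Gamma>_mult torus_power frame(1) g(1))
    moreover have "?h = mat2 ?a ?b ?c ?d" by (simp add: algebra_simps)
    ultimately have h: "mat2 ?a ?b ?c ?d \<in> \<Gamma>" by simp
    have "(?a * ?d - ?b * ?c) * ?v = (\<kappa> * \<kappa>')\<^sup>2 * ((\<delta>0 - \<gamma>0) * e) * (s1 * s2 * w) ^ n * ((\<alpha> * \<delta> - \<beta> * \<gamma>) * v)"
      unfolding power_mult_distrib by Groebner_Basis.algebra
    then have v: "(?a * ?d - ?b * ?c) * ?v = 1" using w g(2) \<kappa>' e(2) by simp
    have "(\<delta>0 - \<gamma>0) * (?a\<^sup>2 * ?v) = (\<kappa> * \<kappa>')\<^sup>2 * ((\<delta>0 - \<gamma>0) * e) * ((s1 ^ n * \<alpha> + s2 ^ n * (\<gamma>0 * \<beta>))\<^sup>2 * (w ^ n * v))"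
      "(\<delta>0 - \<gamma>0) * (?d\<^sup>2 * ?v) = (\<kappa> * \<kappa>')\<^sup>2 * ((\<delta>0 - \<gamma>0) * e) * ((s1 ^ n * \<gamma> + s2 ^ n * (\<delta>0 * \<delta>))\<^sup>2 * (w ^ n * v))"
      unfolding power_mult_distrib by Groebner_Basis.algebra+
    then have E: "(\<delta>0 - \<gamma>0) * (?a\<^sup>2 * ?v) = (s1 ^ n * \<alpha> + s2 ^ n * (\<gamma>0 * \<beta>))\<^sup>2 * (w ^ n * v)"
      "(\<delta>0 - \<gamma>0) * (?d\<^sup>2 * ?v) = (s1 ^ n * \<gamma> + s2 ^ n * (\<delta>0 * \<delta>))\<^sup>2 * (w ^ n * v)"
      unfolding \<kappa>' e(2) by simp_all
    show ?thesis
      using mult_closed[OF eR diagonal_products(1)[OF h v]] mult_closed[OF eR diagonal_products(3)[OF h v]]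
      unfolding E by blast
  qed
  have W: "\<alpha> * (\<gamma>0 * \<beta>) * v \<in> R" "\<gamma> * (\<delta>0 * \<delta>) * v \<in> R"
    using weights(2)[OF w, of \<alpha> "\<gamma>0 * \<beta>" v] weights(2)[OF w, of \<gamma> "\<delta>0 * \<delta>" v] sq by blast+
  obtain c where c: "c \<in> R" "\<gamma>0 * c = 1" using unit_inverse[OF frame(3,4)] by blast
  obtain d where d: "d \<in> R" "\<delta>0 * d = 1" using unit_inverse[OF frame(5,6)] by blast
  have "c * (\<alpha> * (\<gamma>0 * \<beta>) * v) = \<alpha> * \<beta> * v" "d * (\<gamma> * (\<delta>0 * \<delta>) * v) = \<gamma> * \<delta> * v"
    using c(2) d(2) by Groebner_Basis.algebra+
  then show "\<alpha> * \<beta> * v \<in> R" "\<gamma> * \<delta> * v \<in> R"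
    using mult_closed[OF c(1) W(1)] mult_closed[OF d(1) W(2)] by (simp_all only:)
qed

text \<open>
  Some entry in the first column is a unit; dividing by it gives entries in \<open>R\<close>, because products of two
  entries divided by the determinant lie in \<open>R\<close>.
\<close>

lemma scaling:
  assumes g: "g \<in> \<Gamma>"
  obtains \<mu> a b c d where "\<mu> dvd 1" "g = mat2 (\<mu> * a) (\<mu> * b) (\<mu> * c) (\<mu> * d)" "mat2 a b c d \<in> mats R"
proof -
  obtain \<alpha> \<beta> \<gamma> \<delta> where g': "g = mat2 \<alpha> \<beta> \<gamma> \<delta>" by (rule mat2_cases)
  obtain v where v: "(\<alpha> * \<delta> - \<beta> * \<gamma>) * v = 1" using det_unit[OF g] by (auto simp: g')
  note g = g[unfolded g'] note P = diagonal_products[OF g v] left_products[OF g v] right_products[OF g v]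
  have \<beta>\<gamma>: "\<beta> * \<gamma> * v \<in> R"
  proof -
    have "\<beta> * \<gamma> * v = \<alpha> * \<delta> * v - 1" using v by (simp add: algebra_simps)
    then show ?thesis using diff_closed[OF P(2) one_closed] by simp
  qed
  have vu: "v dvd 1" using v by (metis dvdI mult.commute)
  show thesis
  proof (cases "\<alpha> dvd 1")
    case True
    then obtain \<alpha>' where a: "\<alpha> * \<alpha>' = 1" by (metis dvdE)
    have "\<alpha>\<^sup>2 * v * (\<alpha>'\<^sup>2 * (\<alpha> * \<delta> - \<beta> * \<gamma>)) = 1" using a v by Groebner_Basis.algebra
    from inverse_closed[OF P(1) this] have u: "\<alpha>'\<^sup>2 * (\<alpha> * \<delta> - \<beta> * \<gamma>) \<in> R" .
    have e: "\<alpha>' * \<beta> = \<alpha>'\<^sup>2 * (\<alpha> * \<delta> - \<beta> * \<gamma>) * (\<alpha> * \<beta> * v)" "\<alpha>' * \<gamma> = \<alpha>'\<^sup>2 * (\<alpha> * \<delta> - \<beta> * \<gamma>) * (\<alpha> * \<gamma> * v)"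
      "\<alpha>' * \<delta> = \<alpha>'\<^sup>2 * (\<alpha> * \<delta> - \<beta> * \<gamma>) * (\<alpha> * \<delta> * v)" using a v by Groebner_Basis.algebra+
    have "mat2 1 (\<alpha>' * \<beta>) (\<alpha>' * \<gamma>) (\<alpha>' * \<delta>) \<in> mats R"
      unfolding mat2_mats e by (intro conjI mult_closed[OF u] P one_closed)
    moreover have "g = mat2 (\<alpha> * 1) (\<alpha> * (\<alpha>' * \<beta>)) (\<alpha> * (\<alpha>' * \<gamma>)) (\<alpha> * (\<alpha>' * \<delta>))"
      using a by (simp add: g' mult.assoc[symmetric])
    ultimately show thesis using that True by blast
  next
    case False
    have "\<gamma> dvd 1"
    proof (rule ccontr)
      assume "\<not> \<gamma> dvd 1"
      then have "\<not> (\<alpha> * (\<delta> * v) + - (\<gamma> * (\<beta> * v))) dvd 1"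
        by (intro nonunit_add nonunit_minus nonunit_mult False)
      then show False using v by (simp add: algebra_simps)
    qed
    then obtain \<gamma>' where c: "\<gamma> * \<gamma>' = 1" by (metis dvdE)
    have "\<gamma>\<^sup>2 * v * (\<gamma>'\<^sup>2 * (\<alpha> * \<delta> - \<beta> * \<gamma>)) = 1" using c v by Groebner_Basis.algebra
    from inverse_closed[OF P(5) this] have u: "\<gamma>'\<^sup>2 * (\<alpha> * \<delta> - \<beta> * \<gamma>) \<in> R" .
    have e: "\<gamma>' * \<alpha> = \<gamma>'\<^sup>2 * (\<alpha> * \<delta> - \<beta> * \<gamma>) * (\<alpha> * \<gamma> * v)" "\<gamma>' * \<beta> = \<gamma>'\<^sup>2 * (\<alpha> * \<delta> - \<beta> * \<gamma>) * (\<beta> * \<gamma> * v)"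
      "\<gamma>' * \<delta> = \<gamma>'\<^sup>2 * (\<alpha> * \<delta> - \<beta> * \<gamma>) * (\<gamma> * \<delta> * v)" using c v by Groebner_Basis.algebra+
    have "mat2 (\<gamma>' * \<alpha>) (\<gamma>' * \<beta>) 1 (\<gamma>' * \<delta>) \<in> mats R"
      unfolding mat2_mats e by (intro conjI mult_closed[OF u] P \<beta>\<gamma> one_closed)
    moreover have "g = mat2 (\<gamma> * (\<gamma>' * \<alpha>)) (\<gamma> * (\<gamma>' * \<beta>)) (\<gamma> * 1) (\<gamma> * (\<gamma>' * \<delta>))"
      using c by (simp add: g' mult.assoc[symmetric])
    ultimately show thesis using that \<open>\<gamma> dvd 1\<close> by blast
  qed
qed

definition H where "H = {h \<in> \<Gamma> \<inter> mats R. det h = 1}"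

lemma inverse_adj:
  fixes k :: "'a ^ 2 ^ 2"
  assumes "mat2 a b c d ** k = mat 1" "(a * d - b * c) * v = 1"
  shows "k = mat2 (v * d) (- v * b) (- v * c) (v * a)"
proof -
  have "mat2 (v * d) (- v * b) (- v * c) (v * a) ** mat2 a b c d = mat 1"
    using assms(2) by (simp add: mat_1_mat2 algebra_simps)
  then have "mat2 (v * d) (- v * b) (- v * c) (v * a) ** (mat2 a b c d ** k) = k"
    by (simp only: matrix_mul_assoc matrix_mul_lid)
  then show ?thesis using assms(1) by (simp add: matrix_mul_rid)
qed

lemma H_adj: "h \<in> H \<Longrightarrow> adj2 h \<in> H"
proof -
  assume h: "h \<in> H"
  obtain a b c d where h': "h = mat2 a b c d" by (rule mat2_cases)
  obtain k where k: "k \<in> \<Gamma>" "h ** k = mat 1" using \<Gamma>_inverse h unfolding H_def by blast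
  have "k = adj2 h" using inverse_adj[of a b c d k 1] k(2) h by (simp add: h' H_def)
  then show ?thesis using h k(1) by (auto simp: H_def h' algebra_simps intro: closed)
qed

lemma H_mult: "h \<in> H \<Longrightarrow> k \<in> H \<Longrightarrow> h ** k \<in> H"
  unfolding H_def by (auto simp: det_mul intro: \<Gamma>_mult mats_mult)

text \<open>Scalars act trivially by conjugation, so an element of \<open>\<Gamma>\<close> conjugates \<open>H\<close> as a matrix over \<open>R\<close> does.\<close>

lemma H_normal:
  assumes g: "mat2 (\<mu> * a) (\<mu> * b) (\<mu> * c) (\<mu> * d) \<in> \<Gamma>" "\<mu> dvd 1" "mat2 a b c d \<in> mats R"
    and v: "(a * d - b * c) * v = 1" and k: "k \<in> H"
  shows "mat2 a b c d ** k ** mat2 (v * d) (- v * b) (- v * c) (v * a) \<in> H"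
proof -
  obtain \<mu>' where \<mu>': "\<mu> * \<mu>' = 1" using g(2) by (metis dvdE)
  obtain l where l: "l \<in> \<Gamma>" "mat2 (\<mu> * a) (\<mu> * b) (\<mu> * c) (\<mu> * d) ** l = mat 1" using \<Gamma>_inverse[OF g(1)] by blast
  have "((\<mu> * a) * (\<mu> * d) - (\<mu> * b) * (\<mu> * c)) * (\<mu>'\<^sup>2 * v) = 1" using v \<mu>' by Groebner_Basis.algebra
  note l' = inverse_adj[OF l(2) this]
  obtain k1 k2 k3 k4 where k': "k = mat2 k1 k2 k3 k4" by (rule mat2_cases)
  let ?m = "mat2 a b c d ** k ** mat2 (v * d) (- v * b) (- v * c) (v * a)"
  have "mat2 (\<mu> * a) (\<mu> * b) (\<mu> * c) (\<mu> * d) ** k ** l = ?m"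
    unfolding l' k' mat2_mult mat2_eq_iff using \<mu>' by (intro conjI; Groebner_Basis.algebra)
  moreover have "mat2 (\<mu> * a) (\<mu> * b) (\<mu> * c) (\<mu> * d) ** k ** l \<in> \<Gamma>"
    using k by (intro \<Gamma>_mult g l) (simp add: H_def)
  ultimately have 1: "?m \<in> \<Gamma>" by simp
  have vR: "v \<in> R" using inverse_closed[OF _ v] g(3) by (simp add: closed)
  have 2: "?m \<in> mats R" using g(3) k vR by (intro mats_mult) (auto simp: H_def closed)
  have "det ?m = det k * ((a * d - b * c) * v)\<^sup>2"
    unfolding det_mul det_mat2 by Groebner_Basis.algebra
  then have 3: "det ?m = 1" using k v by (simp add: H_def)
  show ?thesis unfolding H_def using 1 2 3 by blast
qed

lemma H_torus:
  assumes h: "mat2 a b c d \<in> H"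
  shows "mat2 a (r * b) (r' * c) d \<in> H" "mat2 a (r' * b) (r * c) d \<in> H"
proof -
  have rr: "r * r' = 1" "r' * r = 1" "r * a * r' = a" "r' * a * r = a"
    using r(2) by (simp_all add: mult.commute mult.left_commute)
  obtain u where u: "s2 * u = 1" using torus_unit by (metis dvdE mult.assoc mult.left_commute)
  have e: "s2 * r = s1" using torus(2) by (simp add: mult.commute)
  have "mat2 (s2 * r) (s2 * 0) (s2 * 0) (s2 * 1) \<in> \<Gamma>" using torus(1) e by simp
  from H_normal[OF this _ _ _ h, of r'] have "mat2 r 0 0 1 ** mat2 a b c d ** mat2 (r' * 1) (- r' * 0) (- r' * 0) (r' * r) \<in> H"
    using dvdI[OF u[symmetric]] r r'_closed by (simp add: closed)
  moreover have "mat2 r 0 0 1 ** mat2 a b c d ** mat2 (r' * 1) (- r' * 0) (- r' * 0) (r' * r) = mat2 a (r * b) (r' * c) d"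
    using rr by (simp add: mult.commute)
  ultimately show "mat2 a (r * b) (r' * c) d \<in> H" by (simp only:)
  obtain k where k: "k \<in> \<Gamma>" "mat2 s1 0 0 s2 ** k = mat 1" using \<Gamma>_inverse[OF torus(1)] by blast
  obtain w where w: "s1 * s2 * w = 1" using torus_unit by (metis dvdE)
  have k': "k = mat2 (w * s2) 0 0 (w * s1)" using inverse_adj[OF k(2), of w] w by simp
  have e: "(w * s1) * r' = w * s2" using torus(2) r(2) by Groebner_Basis.algebra
  have "mat2 ((w * s1) * r') ((w * s1) * 0) ((w * s1) * 0) ((w * s1) * 1) \<in> \<Gamma>" using k(1) unfolding k' e by simp
  moreover have "(w * s1) dvd 1" using w by (metis dvdI mult.commute mult.left_commute)
  ultimately have "mat2 r' 0 0 1 ** mat2 a b c d ** mat2 (r * 1) (- r * 0) (- r * 0) (r * r') \<in> H"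
    using H_normal[of "w * s1" r' 0 0 1 r, OF _ _ _ _ h] r r'_closed by (simp add: closed mult.commute)
  moreover have "mat2 r' 0 0 1 ** mat2 a b c d ** mat2 (r * 1) (- r * 0) (- r * 0) (r * r') = mat2 a (r' * b) (r * c) d"
    using rr by (simp add: mult.commute)
  ultimately show "mat2 a (r' * b) (r * c) d \<in> H" by (simp only:)
qed

end

section \<open>Descent through the ideals of finite index\<close>

definition scale2 :: "'a::comm_ring_1 \<Rightarrow> 'a ^ 2 ^ 2 \<Rightarrow> 'a ^ 2 ^ 2"
  where "scale2 \<mu> M = mat2 (\<mu> * M$1$1) (\<mu> * M$1$2) (\<mu> * M$2$1) (\<mu> * M$2$2)"

lemma scale2_mult: "scale2 \<mu> M ** scale2 \<nu> N = scale2 (\<mu> * \<nu>) (M ** N)"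
  by (cases M rule: mat2_cases, cases N rule: mat2_cases) (simp add: scale2_def algebra_simps)

lemma scale2_1: "scale2 1 M = M"
  by (cases M rule: mat2_cases) (simp add: scale2_def)

locale residual_group = framed_group +
  assumes residual: "M \<in> mats R \<Longrightarrow> det M = 1 \<Longrightarrow> \<exists>g\<in>\<Gamma>. mcong nonunits g M"
begin

definition "max_ideal = R \<inter> nonunits"

text \<open>
  The scalars by which elements of \<open>\<Gamma>\<close> differ from matrices over \<open>R\<close> cancel in commutators.
\<close>

lemma commutator_in_H:
  assumes M: "M \<in> mats R" "det M = 1" and N: "N \<in> mats R" "det N = 1"
  shows "\<exists>h\<in>H. mcong max_ideal h (M ** N ** adj2 M ** adj2 N)"
proof -
  interpret U: local_subring "UNIV :: 'a set" by (rule local_subring_UNIV)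
  have pair: "\<exists>g\<in>\<Gamma>. \<exists>k\<in>\<Gamma>. \<exists>\<mu> \<mu>' h h'. \<mu> * \<mu>' = 1 \<and> h \<in> mats R \<and> h' \<in> mats R \<and> g = scale2 \<mu> h \<and> k = scale2 \<mu>' h' \<and>
      det g * det k = 1 \<and> mcong nonunits g M \<and> mcong nonunits k (adj2 M)"
    if M: "M \<in> mats R" "det M = 1" for M
  proof -
    obtain g where g: "g \<in> \<Gamma>" "mcong nonunits g M" using residual[OF M] by blast
    obtain \<mu> a b c d where s: "\<mu> dvd 1" "g = mat2 (\<mu> * a) (\<mu> * b) (\<mu> * c) (\<mu> * d)" "mat2 a b c d \<in> mats R"
      using scaling[OF g(1)] .
    obtain \<mu>' where \<mu>': "\<mu> * \<mu>' = 1" using s(1) by (metis dvdE)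
    obtain k where k: "k \<in> \<Gamma>" "g ** k = mat 1" using \<Gamma>_inverse[OF g(1)] by blast
    obtain w where w: "det g * w = 1" using det_unit[OF g(1)] by blast
    define v where "v = \<mu>\<^sup>2 * w"
    have v: "(a * d - b * c) * v = 1" using w unfolding v_def s(2) det_mat2 by Groebner_Basis.algebra
    have vR: "v \<in> R" using inverse_closed[OF _ v] s(3) by (simp add: closed)
    have "((\<mu> * a) * (\<mu> * d) - (\<mu> * b) * (\<mu> * c)) * w = 1" using w unfolding s(2) by simp
    note k' = inverse_adj[OF k(2)[unfolded s(2)] this]
    have "w * \<mu> = \<mu>' * v" using \<mu>' unfolding v_def by Groebner_Basis.algebra
    then have e: "w * (\<mu> * x) = \<mu>' * (v * x)" "- w * (\<mu> * x) = \<mu>' * (- v * x)" for x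
      by (simp_all add: mult.assoc[symmetric])
    have "k = scale2 \<mu>' (mat2 (v * d) (- v * b) (- v * c) (v * a))"
      unfolding k' scale2_def mat2_nth e ..
    moreover have "mat2 (v * d) (- v * b) (- v * c) (v * a) \<in> mats R" using s(3) vR by (simp add: closed)
    moreover have "g = scale2 \<mu> (mat2 a b c d)" by (simp add: s(2) scale2_def)
    moreover have "det g * det k = 1" using k(2) by (metis det_I det_mul)
    moreover have "mcong nonunits k (adj2 M)"
    proof (rule U.mcong_sym[OF nonunits_ideal])
      obtain m1 m2 m3 m4 where m: "M = mat2 m1 m2 m3 m4" by (rule mat2_cases)
      have 1: "adj2 M ** M = mat 1" using M(2) by (simp add: m mat_1_mat2 algebra_simps)
      have "mcong nonunits (adj2 M ** (g ** k)) (adj2 M ** (M ** k))"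
        by (intro mcong_nonunits_mult U.mcong_refl[OF nonunits_ideal] g(2))
      moreover have "adj2 M ** (M ** k) = k" using 1 by (simp only: matrix_mul_assoc matrix_mul_lid)
      ultimately show "mcong nonunits (adj2 M) k" using k(2) by (simp add: matrix_mul_rid)
    qed
    ultimately show ?thesis using g k(1) \<mu>' s(3) by metis
  qed
  obtain g1 k1 \<mu>1 \<mu>1' h1 h1' where A: "g1 \<in> \<Gamma>" "k1 \<in> \<Gamma>" "\<mu>1 * \<mu>1' = 1" "h1 \<in> mats R" "h1' \<in> mats R"
    "g1 = scale2 \<mu>1 h1" "k1 = scale2 \<mu>1' h1'" "det g1 * det k1 = 1" "mcong nonunits g1 M" "mcong nonunits k1 (adj2 M)"
    using pair[OF M] by blast
  obtain g2 k2 \<mu>2 \<mu>2' h2 h2' where B: "g2 \<in> \<Gamma>" "k2 \<in> \<Gamma>" "\<mu>2 * \<mu>2' = 1" "h2 \<in> mats R" "h2' \<in> mats R"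
    "g2 = scale2 \<mu>2 h2" "k2 = scale2 \<mu>2' h2'" "det g2 * det k2 = 1" "mcong nonunits g2 N" "mcong nonunits k2 (adj2 N)"
    using pair[OF N] by blast
  define c where "c = g1 ** g2 ** k1 ** k2"
  have "\<mu>1 * \<mu>2 * \<mu>1' * \<mu>2' = 1" using A(3) B(3) by Groebner_Basis.algebra
  then have c': "c = h1 ** h2 ** h1' ** h2'" unfolding c_def A(6,7) B(6,7) scale2_mult by (simp add: scale2_1)
  have cR: "c \<in> mats R" unfolding c' by (intro mats_mult A B)
  have "det c = (det g1 * det k1) * (det g2 * det k2)" by (simp add: c_def det_mul)
  then have "det c = 1" using A(8) B(8) by simp
  moreover have "c \<in> \<Gamma>" unfolding c_def by (intro \<Gamma>_mult A B)
  ultimately have "c \<in> H" unfolding H_def using cR by blast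
  moreover have "mcong nonunits c (M ** N ** adj2 M ** adj2 N)"
    unfolding c_def by (intro mcong_nonunits_mult A B)
  then have "mcong max_ideal c (M ** N ** adj2 M ** adj2 N)"
  proof -
    have adjR: "adj2 K \<in> mats R" if "K \<in> mats R" for K
      using that by (cases K rule: mat2_cases) (simp add: closed)
    have "M ** N ** adj2 M ** adj2 N \<in> mats R" by (intro mats_mult adjR M N)
    then show ?thesis
      using \<open>mcong nonunits c _\<close> cR unfolding mcong_def mats_def max_ideal_def by (auto intro: closed)
  qed
  ultimately show ?thesis by blast
qed

text \<open>
  The commutator of \<open>diag(r, 1/r)\<close> and the elementary matrix with parameter \<open>b / (r\<^sup>2 - 1)\<close> is the elementary
  matrix with parameter \<open>b\<close>; for lower elementary matrices the diagonal matrix is inverted.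
\<close>

lemma full_max_ideal:
  assumes b: "b \<in> R"
  shows "\<exists>h\<in>H. mcong max_ideal h (elem_upper b)" "\<exists>h\<in>H. mcong max_ideal h (elem_lower b)"
proof -
  obtain s where s: "s \<in> R" "(r\<^sup>2 - 1) * s = 1" using unit_inverse[OF _ r(3)] r(1) by (auto intro: closed)
  have sb: "s * b \<in> R" by (intro closed s b)
  have rr: "r' * r = 1" using r(2) by (simp add: mult.commute)
  have e: "r * (s * b) * r - s * b = b" using s(2) by Groebner_Basis.algebra
  have "\<exists>h\<in>H. mcong max_ideal h (mat2 r 0 0 r' ** elem_upper (s * b) ** adj2 (mat2 r 0 0 r') ** adj2 (elem_upper (s * b)))"
    by (rule commutator_in_H) (use r r'_closed sb in \<open>auto simp: elem_defs closed\<close>)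
  moreover have "mat2 r 0 0 r' ** elem_upper (s * b) ** adj2 (mat2 r 0 0 r') ** adj2 (elem_upper (s * b)) = elem_upper b"
    using r(2) rr e by (simp add: elem_defs)
  ultimately show "\<exists>h\<in>H. mcong max_ideal h (elem_upper b)" by simp
  have "\<exists>h\<in>H. mcong max_ideal h (mat2 r' 0 0 r ** elem_lower (s * b) ** adj2 (mat2 r' 0 0 r) ** adj2 (elem_lower (s * b)))"
    by (rule commutator_in_H) (use r r'_closed rr sb in \<open>auto simp: elem_defs closed\<close>)
  moreover have "mat2 r' 0 0 r ** elem_lower (s * b) ** adj2 (mat2 r' 0 0 r) ** adj2 (elem_lower (s * b)) = elem_lower b"
    using r(2) rr e by (simp add: elem_defs)
  ultimately show "\<exists>h\<in>H. mcong max_ideal h (elem_lower b)" by simp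
qed

end

text \<open>
  The last assumption says that \<open>R\<close> is topologically generated by the adjoint traces of \<open>\<Gamma>\<close>: a subring
  that contains them and is open in \<open>R\<close> is \<open>R\<close>.
\<close>

locale profinite_residual_group = profinite_local_ring NN + residual_group R \<Gamma> s1 s2 r r' \<kappa> \<gamma>0 \<delta>0
  for NN :: "'a :: {idom, local_ring, topological_ab_group_add, topological_semigroup_mult} set set"
    and R :: "'a set" and \<Gamma> s1 s2 r r' \<kappa> \<gamma>0 \<delta>0 +
  assumes generated: "N \<in> NN \<Longrightarrow> N \<inter> R \<subseteq> S \<Longrightarrow> S \<subseteq> R \<Longrightarrow> 1 \<in> S \<Longrightarrow>
      (\<And>s t. s \<in> S \<Longrightarrow> t \<in> S \<Longrightarrow> s - t \<in> S) \<Longrightarrow> (\<And>s t. s \<in> S \<Longrightarrow> t \<in> S \<Longrightarrow> s * t \<in> S) \<Longrightarrow>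
      (\<And>g v. g \<in> \<Gamma> \<Longrightarrow> det g * v = 1 \<Longrightarrow> (trace g)\<^sup>2 * v \<in> S) \<Longrightarrow> R \<subseteq> S"
begin

definition full :: "'a set \<Rightarrow> bool"
  where "full J \<longleftrightarrow> (\<forall>b\<in>R. (\<exists>h\<in>H. mcong J h (elem_upper b)) \<and> (\<exists>h\<in>H. mcong J h (elem_lower b)))"

lemma full_step:
  assumes N: "N \<in> NN" and J: "ideal_of J" "N \<inter> R \<subseteq> J" "J \<subseteq> max_ideal"
    and j: "j \<in> max_ideal" "j \<notin> J" "\<And>m. m \<in> max_ideal \<Longrightarrow> m * j \<in> J"
    and full: "full {x + a * j | x a. x \<in> J \<and> a \<in> R}"
  shows "full J"
proof -
  interpret step: congruence_step R H J j r r'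
  proof unfold_locales
    show "ideal_of J" "j \<in> R" "\<not> j dvd 1" "j \<notin> J" "r \<in> R" "r * r' = 1" "(r\<^sup>2 - 1) dvd 1"
      using J j r by (auto simp: max_ideal_def)
    show "\<not> x dvd 1" if "x \<in> J" for x using that J(3) by (auto simp: max_ideal_def)
    show "m * j \<in> J" if "m \<in> R" "\<not> m dvd 1" for m using that j(3) by (auto simp: max_ideal_def)
    show "H \<subseteq> mats R" "\<And>h. h \<in> H \<Longrightarrow> det h = 1" by (auto simp: H_def)
    show "mat 1 \<in> H" using \<Gamma>_one zero_closed one_closed by (simp add: H_def) (simp add: mat_1_mat2)
  qed (use H_mult H_adj H_torus full in \<open>auto simp: full_def\<close>)
  show ?thesis
  proof (rule step.dichotomy)
    assume "\<And>b. b \<in> R \<Longrightarrow> \<exists>h\<in>H. mcong J h (elem_upper b)" "\<And>b. b \<in> R \<Longrightarrow> \<exists>h\<in>H. mcong J h (elem_lower b)"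
    then show ?thesis by (simp add: full_def)
  next
    fix S assume S: "S \<subseteq> R" "J \<subseteq> S" "j \<notin> S" "1 \<in> S"
      "\<And>s t. s \<in> S \<Longrightarrow> t \<in> S \<Longrightarrow> s - t \<in> S" "\<And>s t. s \<in> S \<Longrightarrow> t \<in> S \<Longrightarrow> s * t \<in> S"
      and tr: "\<And>\<alpha> \<beta> \<gamma> \<delta> v. mat2 \<alpha> \<beta> \<gamma> \<delta> \<in> mats R \<Longrightarrow> (\<alpha> * \<delta> - \<beta> * \<gamma>) * v = 1 \<Longrightarrow>
        (\<And>k. k \<in> H \<Longrightarrow> mat2 \<alpha> \<beta> \<gamma> \<delta> ** k ** mat2 (v * \<delta>) (- v * \<beta>) (- v * \<gamma>) (v * \<alpha>) \<in> H) \<Longrightarrow>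
        (\<alpha> + \<delta>)\<^sup>2 * v \<in> S"
    have "R \<subseteq> S"
    proof (rule generated[OF N _ S(1,4,5,6)])
      show "N \<inter> R \<subseteq> S" using J(2) S(2) by blast
      fix g w assume g: "g \<in> \<Gamma>" "det g * w = 1"
      obtain \<mu> a b c d where s: "\<mu> dvd 1" "g = mat2 (\<mu> * a) (\<mu> * b) (\<mu> * c) (\<mu> * d)" "mat2 a b c d \<in> mats R"
        using scaling[OF g(1)] .
      have v: "(a * d - b * c) * (\<mu>\<^sup>2 * w) = 1" using g(2) unfolding s(2) det_mat2 by Groebner_Basis.algebra
      have "(a + d)\<^sup>2 * (\<mu>\<^sup>2 * w) \<in> S"
        by (rule tr[OF s(3) v]) (rule H_normal[OF g(1)[unfolded s(2)] s(1,3) v])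
      moreover have "(trace g)\<^sup>2 * w = (a + d)\<^sup>2 * (\<mu>\<^sup>2 * w)"
        by (simp add: s(2) power2_eq_square algebra_simps)
      ultimately show "(trace g)\<^sup>2 * w \<in> S" by (simp only:)
    qed
    then show ?thesis using S(3) j(1) by (auto simp: max_ideal_def)
  qed
qed

lemma coset_image_eq:
  assumes N: "N \<in> NN" and J: "ideal_of J" "ideal_of J'" "N \<inter> R \<subseteq> J" "J \<subseteq> J'"
    and eq: "card (coset N ` J') \<le> card (coset N ` J)"
  shows "J = J'"
proof -
  have "coset N ` J = coset N ` J'"
    by (rule card_seteq[OF finite_cosets[OF N] image_mono[OF J(4)] eq])
  have "x \<in> J" if x: "x \<in> J'" for x
  proof -
    obtain y where y: "y \<in> J" "coset N x = coset N y" using x \<open>coset N ` J = coset N ` J'\<close> by blast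
    have "x - y \<in> N" using y(2) coset_eq_iff[OF N] by blast
    then have "x - y \<in> J"
      using J(3) diff_closed[OF ideal_ofD(1)[OF J(2) x] ideal_ofD(1)[OF J(1) y(1)]] by blast
    from ideal_ofD(3)[OF J(1) this y(1)] show ?thesis by simp
  qed
  then show ?thesis using J(4) by blast
qed

text \<open>
  Choose \<open>j\<close> outside \<open>J\<close> such that \<open>J + Rj\<close> is as small as possible. If \<open>m j\<close> with a non-unit \<open>m\<close> were
  outside \<open>J\<close>, then \<open>J + Rmj\<close> would contain \<open>j\<close>, and so would \<open>J\<close>, since \<open>1 - a m\<close> is a unit.
\<close>

lemma minimal_enlargement:
  assumes N: "N \<in> NN" and J: "ideal_of J" "N \<inter> R \<subseteq> J" "J \<subset> max_ideal"
  shows "\<exists>j\<in>max_ideal. j \<notin> J \<and> (\<forall>m\<in>max_ideal. m * j \<in> J)"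
proof -
  let ?J1 = "\<lambda>j. {x + a * j | x a. x \<in> J \<and> a \<in> R}"
  obtain j where j: "j \<in> max_ideal - J"
    and least: "\<And>k. k \<in> max_ideal - J \<Longrightarrow> card (coset N ` ?J1 j) \<le> card (coset N ` ?J1 k)"
    using ex_has_least_nat[of "\<lambda>j. j \<in> max_ideal - J" _ "\<lambda>j. card (coset N ` ?J1 j)"] J(3) by blast
  have jR: "j \<in> R" using j by (simp add: max_ideal_def)
  have "m * j \<in> J" if m: "m \<in> max_ideal" for m
  proof (rule ccontr)
    assume mj: "m * j \<notin> J"
    have mR: "m \<in> R" "\<not> m dvd 1" using m by (simp_all add: max_ideal_def)
    have mjR: "m * j \<in> R" by (intro closed mR jR)
    have "m * j \<in> max_ideal - J" using mj mjR nonunit_mult[OF mR(2)] by (simp add: max_ideal_def)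
    note le = least[OF this]
    have sub: "?J1 (m * j) \<subseteq> ?J1 j"
    proof clarify
      fix x a assume "x \<in> J" "a \<in> R"
      moreover have "x + a * (m * j) = x + (a * m) * j" by (simp add: mult.assoc)
      ultimately show "\<exists>x' a'. x + a * (m * j) = x' + a' * j \<and> x' \<in> J \<and> a' \<in> R"
        using mult_closed[OF \<open>a \<in> R\<close> mR(1)] by blast
    qed
    have J_sub: "N \<inter> R \<subseteq> ?J1 (m * j)"
    proof
      fix x assume "x \<in> N \<inter> R"
      then have "x \<in> J" using J(2) by blast
      moreover have "x = x + 0 * (m * j)" by simp
      ultimately show "x \<in> ?J1 (m * j)" using zero_closed by blast
    qed
    have "?J1 (m * j) = ?J1 j"
      by (rule coset_image_eq[OF N ideal_adjoin[OF J(1) mjR] ideal_adjoin[OF J(1) jR] J_sub sub le])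
    moreover have "j \<in> ?J1 j"
    proof -
      have "j = 0 + 1 * j" by simp
      then show ?thesis using ideal_ofD(2)[OF J(1)] one_closed by blast
    qed
    ultimately obtain x a where xa: "j = x + a * (m * j)" "x \<in> J" "a \<in> R" by blast
    have "(1 - a * m) dvd 1"
    proof (rule ccontr)
      assume *: "\<not> ?thesis"
      have "\<not> (m * a) dvd 1" by (rule nonunit_mult[OF mR(2)])
      from nonunit_add[OF * this] show False by (simp add: mult.commute)
    qed
    then obtain u where u: "u \<in> R" "(1 - a * m) * u = 1"
      using unit_inverse[of "1 - a * m"] xa mR by (auto intro: closed)
    have "j = u * x" using u(2) xa(1) by Groebner_Basis.algebra
    then have "j \<in> J" using ideal_ofD(6)[OF J(1) u(1) xa(2)] by simp
    then show False using j by simp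
  qed
  then show ?thesis using j by blast
qed

lemma full_all:
  assumes N: "N \<in> NN" "1 \<notin> N" and J: "ideal_of J" "N \<inter> R \<subseteq> J"
  shows "full J"
  using J
proof (induction "card (coset N ` R) - card (coset N ` J)" arbitrary: J rule: less_induct)
  case less
  have "J \<subseteq> max_ideal" if "\<not> (\<exists>x\<in>J. x dvd 1)"
    using that ideal_ofD(1)[OF less.prems(1)] by (simp add: max_ideal_def subset_iff)
  then consider (unit) "\<exists>x\<in>J. x dvd 1" | (max) "J = max_ideal" | (proper) "J \<subset> max_ideal"
    by (metis psubsetI)
  then show ?case
  proof cases
    case unit
    then obtain x v where x: "x \<in> J" "v \<in> R" "x * v = 1"
      using unit_inverse ideal_ofD(1)[OF less.prems(1)] by blast
    have "b \<in> J" if "b \<in> R" for b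
      using ideal_ofD(7)[OF less.prems(1) mult_closed[OF x(2) that] x(1)] x(3)
      by (simp add: mult.assoc[symmetric])
    then have "mcong J (mat 1) (elem_upper b)" "mcong J (mat 1) (elem_lower b)" if "b \<in> R" for b
      using that by (simp_all add: mat_1_mat2 elem_defs closed)
    moreover have "mat 1 \<in> H" using \<Gamma>_one zero_closed one_closed by (simp add: H_def) (simp add: mat_1_mat2)
    ultimately show ?thesis unfolding full_def by blast
  next
    case max then show ?thesis using full_max_ideal by (simp add: full_def)
  next
    case proper
    obtain j where j: "j \<in> max_ideal" "j \<notin> J" "\<And>m. m \<in> max_ideal \<Longrightarrow> m * j \<in> J"
      using minimal_enlargement[OF N(1) less.prems proper] by blast
    let ?J1 = "{x + a * j | x a. x \<in> J \<and> a \<in> R}"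
    have jR: "j \<in> R" using j(1) by (simp add: max_ideal_def)
    have J1: "ideal_of ?J1" by (rule ideal_adjoin[OF less.prems(1) jR])
    have sub: "J \<subseteq> ?J1"
    proof
      fix x assume "x \<in> J"
      moreover have "x = x + 0 * j" by simp
      ultimately show "x \<in> ?J1" using zero_closed by blast
    qed
    have "j = 0 + 1 * j" by simp
    then have "j \<in> ?J1" using ideal_ofD(2)[OF less.prems(1)] one_closed by blast
    then have "J \<noteq> ?J1" using j(2) by blast
    then have "card (coset N ` J) < card (coset N ` ?J1)"
      using coset_image_eq[OF N(1) less.prems(1) J1 less.prems(2) sub] by (meson not_le)
    moreover have "card (coset N ` ?J1) \<le> card (coset N ` R)"
      by (rule card_mono[OF finite_cosets[OF N(1)] image_mono]) (use ideal_ofD(1)[OF J1] in blast)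
    ultimately have "full ?J1" using less.prems(2) sub by (intro less.hyps J1) auto
    then show ?thesis using full_step[OF N(1) less.prems _ j] proper by blast
  qed
qed

lemma SL_mod_N:
  assumes N: "N \<in> NN" and M: "M \<in> mats R" "det M = 1"
  shows "\<exists>g\<in>\<Gamma>. mcong N g M"
proof -
  have J: "ideal_of (L \<inter> R)" if L: "L \<in> NN" for L
    unfolding ideal_of_def
    using whole.ideal_ofD(2,3)[OF N_ideal[OF L]] mult_N[OF L] zero_closed add_closed mult_closed by blast
  obtain N0 where N0: "N0 \<in> NN" "1 \<notin> N0" using ex_proper_N by blast
  obtain L where L: "L \<in> NN" "L \<subseteq> N" "L \<subseteq> N0" using directed_N[OF N N0(1)] by blast
  have f: "full (L \<inter> R)" using full_all[OF L(1) _ J[OF L(1)]] N0(2) L(3) by blast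
  define P where "P M \<longleftrightarrow> M \<in> mats R \<and> (\<exists>h\<in>H. mcong (L \<inter> R) h M)" for M
  have "P M"
  proof (rule SL_elementary_induct[OF _ _ _ M])
    fix A B assume "P A" "P B"
    then obtain h k where hk: "h \<in> H" "k \<in> H" "mcong (L \<inter> R) h A" "mcong (L \<inter> R) k B" "A \<in> mats R" "B \<in> mats R"
      unfolding P_def by blast
    have "mcong (L \<inter> R) (h ** k) (A ** B)"
      by (rule mcong_mult[OF J[OF L(1)] hk(3,4) _ hk(6)]) (use hk(1) in \<open>simp add: H_def\<close>)
    then show "P (A ** B)" unfolding P_def using H_mult[OF hk(1,2)] mats_mult[OF hk(5,6)] by blast
  next
    fix b assume "b \<in> R"
    then show "P (elem_upper b)" "P (elem_lower b)"
      using f zero_closed one_closed unfolding P_def full_def by (auto simp: elem_defs)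
  qed
  then obtain h where h: "h \<in> H" "mcong (L \<inter> R) h M" unfolding P_def by blast
  have "mcong N h M" using L(2) by (intro mcong_mono[OF h(2)]) blast
  moreover have "h \<in> \<Gamma>" using h(1) by (simp add: H_def)
  ultimately show ?thesis by blast
qed

end

section \<open>Choosing a frame\<close>

text \<open>
  The exceptional elements are roots of \<open>X\<^sup>5 - X\<close>.
\<close>

lemma exists_fourth_power_ne_1:
  fixes E :: "'f::field set"
  assumes "card E \<ge> 7" shows "\<exists>e\<in>E. e \<noteq> 0 \<and> e ^ 4 \<noteq> 1"
proof (rule ccontr)
  assume *: "\<not> ?thesis"
  let ?q = "[:0, - 1, 0, 0, 0, 1:] :: 'f poly"
  have nz: "?q \<noteq> 0" by simp
  have "poly ?q e = 0" if "e \<in> E" for e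
    using * that by (auto simp: algebra_simps power4_eq_xxxx)
  then have "E \<subseteq> {e. poly ?q e = 0}" by blast
  then have "card E \<le> card {e. poly ?q e = 0}" by (rule card_mono[OF poly_roots_finite[OF nz]])
  also have "\<dots> \<le> 5" using card_poly_roots_bound[OF nz] by simp
  finally show False using assms by simp
qed

context profinite_local_ring begin

lemma closure_subring:
  fixes S :: "'a set"
  assumes S: "\<And>x y. x \<in> S \<Longrightarrow> y \<in> S \<Longrightarrow> x - y \<in> S" "\<And>x y. x \<in> S \<Longrightarrow> y \<in> S \<Longrightarrow> x * y \<in> S"
    and xy: "x \<in> closure S" "y \<in> closure S"
  shows "x - y \<in> closure S" "x * y \<in> closure S"
proof -
  have *: "(\<exists>z\<in>S. x - y - z \<in> N) \<and> (\<exists>z\<in>S. x * y - z \<in> N)" if N: "N \<in> NN" for N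
  proof -
    note I = whole.ideal_ofD[OF N_ideal[OF N]]
    obtain x' y' where x': "x' \<in> S" "x - x' \<in> N" and y': "y' \<in> S" "y - y' \<in> N"
      using xy N unfolding closure_iff by blast
    have "x - y - (x' - y') = (x - x') - (y - y')" "x * y - x' * y' = y * (x - x') + x' * (y - y')"
      by (simp_all add: algebra_simps)
    then have "x - y - (x' - y') \<in> N" "x * y - x' * y' \<in> N"
      using I(4)[OF x'(2) y'(2)] I(3)[OF I(6)[OF UNIV_I x'(2), of y] I(6)[OF UNIV_I y'(2), of x']] by (simp_all only:)
    then show ?thesis using S x' y' by blast
  qed
  show "x - y \<in> closure S" "x * y \<in> closure S" unfolding closure_iff using * by blast+
qed

text \<open>
  The root of the characteristic polynomial near \<open>a\<close> gives eigenvectors close to the standard basis, so that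
  conjugation by them does not change reductions.
\<close>

lemma eigenframe:
  fixes p q u w a a' :: 'a
  assumes r: "residue p = residue a" "residue w = residue a'" "residue q = 0" "residue u = 0" "residue a \<noteq> residue a'"
  obtains s1 s2 e f where "residue s1 = residue a" "residue s2 = residue a'" "residue e = 0" "residue f = 0"
    "mat2 p q u w ** mat2 1 e f 1 = mat2 1 e f 1 ** mat2 s1 0 0 s2"
proof -
  have "residue (a * a - (p + w) * a + (p * w - q * u)) = 0" using r by (simp add: algebra_simps)
  then have 1: "\<not> (a * a - (p + w) * a + (p * w - q * u)) dvd 1" by (rule residue_eq_0_iff[THEN iffD1])
  have "2 * a - (p + w) = (a - p) + (a - w)" by simp
  then have "residue (2 * a - (p + w)) = residue a - residue a'"
    using r by (simp only: residue_add residue_diff diff_self add_0_left)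
  then have 2: "(2 * a - (p + w)) dvd 1" using r(5) by (simp add: unit_iff_residue)
  obtain s1 where s1: "\<not> (s1 - a) dvd 1" "s1 * s1 - (p + w) * s1 + (p * w - q * u) = 0"
    using hensel_root[OF 1 2] .
  define s2 where "s2 = p + w - s1"
  have rs: "residue s1 = residue a" using s1(1) by (simp add: unit_iff_residue)
  have rs2: "residue s2 = residue a'" using r rs by (simp add: s2_def)
  have "residue (s1 - w) \<noteq> 0" using r rs by simp
  then obtain i where i: "(s1 - w) * i = 1" unfolding unit_iff_residue[symmetric] by (metis dvdE)
  have "mat2 p q u w ** mat2 1 (- q * i) (u * i) 1 = mat2 1 (- q * i) (u * i) 1 ** mat2 s1 0 0 s2"
  proof -
    have "p + q * (u * i) = s1" "u + w * (u * i) = u * i * s1" "p * (- q * i) + q = - q * i * s2"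
      "u * (- q * i) + w = s2"
      using i s1(2) unfolding s2_def by Groebner_Basis.algebra+
    then show ?thesis by simp
  qed
  then show thesis using that[OF rs rs2, of "- q * i" "u * i"] r by simp
qed

text \<open>
  The conjugating matrix \<open>C\<close> is the product of the eigenvector matrix \<open>P\<close>, which makes a lift of
  \<open>diag(a, 1/a)\<close> diagonal, and of a diagonal matrix \<open>D\<close>, which equalises the upper entries of a lift of
  \<open>(1, 1; 1, 2)\<close>. That matrix is chosen because its entries and the difference of its lower entries are
  units. Both factors reduce to the identity, so that the reductions of \<open>\<Gamma>\<close> are unaffected.
\<close>

lemma SL_approximation:
  fixes R :: "'a set"
  assumes G: "adjoint_group R \<Gamma>" and closed_R: "closure R = R"
    and residual: "\<And>M. M \<in> mats R \<Longrightarrow> det M = 1 \<Longrightarrow> \<exists>g\<in>\<Gamma>. mcong nonunits g M"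
    and generated: "\<And>N S. N \<in> NN \<Longrightarrow> N \<inter> R \<subseteq> S \<Longrightarrow> S \<subseteq> R \<Longrightarrow> 1 \<in> S \<Longrightarrow>
      (\<And>s t. s \<in> S \<Longrightarrow> t \<in> S \<Longrightarrow> s - t \<in> S) \<Longrightarrow> (\<And>s t. s \<in> S \<Longrightarrow> t \<in> S \<Longrightarrow> s * t \<in> S) \<Longrightarrow>
      (\<And>g v. g \<in> \<Gamma> \<Longrightarrow> det g * v = 1 \<Longrightarrow> (trace g)\<^sup>2 * v \<in> S) \<Longrightarrow> R \<subseteq> S"
    and a: "a \<in> R" "residue a \<noteq> 0" "residue a ^ 4 \<noteq> 1"
  shows "\<exists>C C'. C ** C' = mat 1 \<and> C' ** C = mat 1 \<and>
    (\<forall>N\<in>NN. \<forall>M\<in>mats R. det M = 1 \<longrightarrow> (\<exists>g\<in>\<Gamma>. mcong N (C' ** g ** C) M))"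
proof -
  interpret G: adjoint_group R \<Gamma> by (rule G)
  have inv: "\<exists>y. x * y = 1" if "residue x \<noteq> 0" for x :: 'a
    using that unfolding unit_iff_residue[symmetric] by (metis dvdE)
  have res_inv: "residue y = inverse (residue x)" if "x * y = 1" for x y :: 'a
    using arg_cong[OF that, of residue] by (simp add: inverse_unique)
  have two: "(2 :: 'a residue_field) \<noteq> 0"
    using unit_iff_residue[THEN iffD1, OF two_unit] by (simp add: residue_2)
  let ?A = "residue a"
  obtain a' where a': "a * a' = 1" using inv[OF a(2)] by blast
  have a'R: "a' \<in> R" using G.inverse_closed[OF a(1) a'] .
  have A': "residue a' = inverse ?A" using res_inv[OF a'] .
  have A2: "?A\<^sup>2 \<noteq> 1"
  proof
    assume "?A\<^sup>2 = 1"
    then have "(?A\<^sup>2)\<^sup>2 = 1" by simp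
    then show False using a(3) by (simp add: power_mult[symmetric] del: power_mult)
  qed
  have AA': "?A \<noteq> residue a'" using a(2) A2 unfolding A' by (simp add: field_simps power2_eq_square)
  have "mat2 a 0 0 a' \<in> mats R" "det (mat2 a 0 0 a') = 1" using a a'R a' by (simp_all add: G.closed)
  from residual[OF this] obtain g1 where g1: "g1 \<in> \<Gamma>" "mcong nonunits g1 (mat2 a 0 0 a')" by blast
  obtain p q u w where g1': "g1 = mat2 p q u w" by (rule mat2_cases)
  have "residue p = ?A" "residue w = residue a'" "residue q = 0" "residue u = 0"
    using g1(2) by (simp_all add: g1' unit_iff_residue)
  from eigenframe[OF this AA'] obtain s1 s2 e f where
    s: "residue s1 = ?A" "residue s2 = residue a'" and ef: "residue e = 0" "residue f = 0"
    and eig: "g1 ** mat2 1 e f 1 = mat2 1 e f 1 ** mat2 s1 0 0 s2" unfolding g1' by metis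
  obtain d where d: "(1 - e * f) * d = 1" using inv[of "1 - e * f"] ef by auto
  have rd: "residue d = 1" using res_inv[OF d] ef by simp
  define P where "P = mat2 1 e f 1"
  define P' where "P' = mat2 d (- d * e) (- d * f) d"
  have P: "P ** P' = mat 1" "P' ** P = mat 1"
    using d by (simp_all add: P_def P'_def mat_1_mat2 algebra_simps)
  define \<Gamma>1 where "\<Gamma>1 = (\<lambda>g. P' ** g ** P) ` \<Gamma>"
  interpret G1: adjoint_group R \<Gamma>1 unfolding \<Gamma>1_def by (rule G.conjugate[OF P])
  have "P' ** g1 ** P = P' ** P ** mat2 s1 0 0 s2"
    using eig unfolding P_def[symmetric] by (metis matrix_mul_assoc)
  then have "P' ** g1 ** P = mat2 s1 0 0 s2" unfolding P(2) matrix_mul_lid .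
  then have torus: "mat2 s1 0 0 s2 \<in> \<Gamma>1" using g1(1) unfolding \<Gamma>1_def by (metis image_eqI)
  obtain i1 where i1: "s1 * i1 = 1" using inv[of s1] a(2) s(1) by auto
  obtain i2 where i2: "s2 * i2 = 1" using inv[of s2] a(2) s(2) A' by auto
  define r where "r = s1 * i2"
  define r' where "r' = s2 * i1"
  have rr': "r * r' = 1" using i1 i2 unfolding r_def r'_def by Groebner_Basis.algebra
  have rr: "residue r = ?A\<^sup>2" "residue r' = inverse (?A\<^sup>2)"
    using res_inv[OF i1] res_inv[OF i2] s A' by (simp_all add: r_def r'_def power2_eq_square)
  have rR: "r \<in> R"
  proof (rule closed_subring_root[OF closed_R G.one_closed G.diff_closed G.mult_closed, of "a * a" r r'])
    show "a * a \<in> R" by (intro G.closed a)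
    show "\<not> (r - a * a) dvd 1" using rr by (simp add: unit_iff_residue power2_eq_square)
    have v: "det (mat2 s1 0 0 s2) * (i1 * i2) = 1" using i1 i2 unfolding det_mat2 by Groebner_Basis.algebra
    have "(s1 + s2)\<^sup>2 * (i1 * i2) \<in> R" using G1.adjoint_trace[OF torus v] by simp
    from G.diff_closed[OF G.diff_closed[OF this G.one_closed] G.one_closed]
    have "(s1 + s2)\<^sup>2 * (i1 * i2) - 1 - 1 \<in> R" .
    moreover have "(s1 + s2)\<^sup>2 * (i1 * i2) - 1 - 1 = r + r'"
      using i1 i2 unfolding r_def r'_def by Groebner_Basis.algebra
    ultimately show "r + r' \<in> R" by simp
    show "r * r' \<in> R" unfolding rr' by (rule G.one_closed)
    have "?A\<^sup>2 \<noteq> inverse (?A\<^sup>2)"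
      using a(2,3) by (simp add: field_simps power2_eq_square power4_eq_xxxx)
    then show "(r - r') dvd 1" using rr by (simp add: unit_iff_residue)
  qed
  have "(r\<^sup>2 - 1) dvd 1"
    using rr a(3) by (simp add: unit_iff_residue residue_power power_mult[symmetric] del: power_mult)
  then interpret T: torus_group R \<Gamma>1 s1 s2 r r'
    using torus rR rr' i2 by unfold_locales (auto simp: r_def mult.commute mult.left_commute)
  have "mat2 1 1 1 2 \<in> mats R" "det (mat2 1 1 1 2 :: 'a ^ 2 ^ 2) = 1" by (simp_all add: G.closed)
  from residual[OF this] obtain g2 where g2: "g2 \<in> \<Gamma>" "mcong nonunits g2 (mat2 1 1 1 2)" by blast
  obtain x1 x2 x3 x4 where g2': "g2 = mat2 x1 x2 x3 x4" by (rule mat2_cases)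
  have x: "residue x1 = 1" "residue x2 = 1" "residue x3 = 1" "residue x4 = 2"
    using g2(2) by (simp_all add: g2' unit_iff_residue residue_2)
  obtain \<alpha> \<beta> \<gamma> \<delta> where h: "P' ** g2 ** P = mat2 \<alpha> \<beta> \<gamma> \<delta>" by (rule mat2_cases)
  have h\<Gamma>: "mat2 \<alpha> \<beta> \<gamma> \<delta> \<in> \<Gamma>1" using g2(1) unfolding \<Gamma>1_def h[symmetric] by blast
  have res: "residue \<alpha> = 1" "residue \<beta> = 1" "residue \<gamma> = 1" "residue \<delta> = 2"
    using h unfolding P_def P'_def g2' by (auto simp: ef rd x)
  obtain \<alpha>' where \<alpha>': "\<alpha> * \<alpha>' = 1" using inv[of \<alpha>] res by auto
  define c where "c = \<beta> * \<alpha>'"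
  have rc: "residue c = 1" using res_inv[OF \<alpha>'] res by (simp add: c_def)
  obtain c' where c': "c * c' = 1" using inv[of c] rc by auto
  define D where "D = mat2 c 0 0 1"
  define D' where "D' = mat2 c' 0 0 1"
  have D: "D ** D' = mat 1" "D' ** D = mat 1" using c' by (simp_all add: D_def D'_def mat_1_mat2 mult.commute)
  define \<Gamma>2 where "\<Gamma>2 = (\<lambda>g. D' ** g ** D) ` \<Gamma>1"
  interpret G2: adjoint_group R \<Gamma>2 unfolding \<Gamma>2_def by (rule G1.conjugate[OF D])
  have "D' ** mat2 s1 0 0 s2 ** D = mat2 s1 0 0 s2"
    using c' by (simp add: D_def D'_def mult.commute mult.left_commute)
  then have torus2: "mat2 s1 0 0 s2 \<in> \<Gamma>2" using torus unfolding \<Gamma>2_def by (metis image_eqI)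
  interpret T2: torus_group R \<Gamma>2 s1 s2 r r'
    using torus2 T.torus(2) T.r by unfold_locales
  define \<gamma>0 where "\<gamma>0 = \<gamma> * c * \<alpha>'"
  define \<delta>0 where "\<delta>0 = \<delta> * \<alpha>'"
  have r0: "residue \<gamma>0 = 1" "residue \<delta>0 = 2"
    using res rc res_inv[OF \<alpha>'] by (simp_all add: \<gamma>0_def \<delta>0_def)
  have frame: "mat2 \<alpha> \<alpha> (\<alpha> * \<gamma>0) (\<alpha> * \<delta>0) \<in> \<Gamma>2"
  proof -
    have "c' * \<beta> = \<alpha>" "\<gamma> * c = \<alpha> * \<gamma>0" "\<delta> = \<alpha> * \<delta>0" "c' * \<alpha> * c = \<alpha>"
      using c' \<alpha>' unfolding \<gamma>0_def \<delta>0_def c_def by Groebner_Basis.algebra+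
    then have "D' ** mat2 \<alpha> \<beta> \<gamma> \<delta> ** D = mat2 \<alpha> \<alpha> (\<alpha> * \<gamma>0) (\<alpha> * \<delta>0)"
      by (simp add: D_def D'_def)
    then show ?thesis using h\<Gamma> unfolding \<Gamma>2_def by (metis image_eqI)
  qed
  have frame_R: "\<gamma>0 \<in> R" "\<delta>0 \<in> R"
  proof -
    obtain v where v: "(\<alpha> * \<delta> - \<beta> * \<gamma>) * v = 1" using G1.det_unit[OF h\<Gamma>] by auto
    note dp = T.diagonal_products[OF h\<Gamma> v]
    have "\<alpha>\<^sup>2 * v * (\<alpha>'\<^sup>2 * (\<alpha> * \<delta> - \<beta> * \<gamma>)) = 1" using \<alpha>' v by Groebner_Basis.algebra
    from G.inverse_closed[OF dp(1) this] have z: "\<alpha>'\<^sup>2 * (\<alpha> * \<delta> - \<beta> * \<gamma>) \<in> R" .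
    have "\<gamma>0 = (\<alpha> * \<delta> * v - 1) * (\<alpha>'\<^sup>2 * (\<alpha> * \<delta> - \<beta> * \<gamma>))" "\<delta>0 = \<alpha> * \<delta> * v * (\<alpha>'\<^sup>2 * (\<alpha> * \<delta> - \<beta> * \<gamma>))"
      using \<alpha>' v unfolding \<gamma>0_def \<delta>0_def c_def by Groebner_Basis.algebra+
    then show "\<gamma>0 \<in> R" "\<delta>0 \<in> R" using z dp(2) by (simp_all only: G.closed)
  qed
  interpret F: framed_group R \<Gamma>2 s1 s2 r r' \<alpha> \<gamma>0 \<delta>0
    using frame frame_R r0 res two by unfold_locales (auto simp: unit_iff_residue)
  define C where "C = P ** D"
  define C' where "C' = D' ** P'"
  have \<Gamma>2: "\<Gamma>2 = (\<lambda>g. C' ** g ** C) ` \<Gamma>"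
    unfolding \<Gamma>2_def \<Gamma>1_def C_def C'_def image_image by (simp only: matrix_mul_assoc)
  have C: "C ** C' = mat 1" "C' ** C = mat 1"
  proof -
    have "C ** C' = P ** (D ** D') ** P'" "C' ** C = D' ** (P' ** P) ** D"
      unfolding C_def C'_def by (simp_all only: matrix_mul_assoc)
    then show "C ** C' = mat 1" "C' ** C = mat 1" using P D by (simp_all add: matrix_mul_rid)
  qed
  interpret R: residual_group R \<Gamma>2 s1 s2 r r' \<alpha> \<gamma>0 \<delta>0
  proof
    fix M :: "'a ^ 2 ^ 2" assume "M \<in> mats R" "det M = 1"
    from residual[OF this] obtain g where g: "g \<in> \<Gamma>" "mcong nonunits g M" by blast
    have "residue c' = 1" using res_inv[OF c'] rc by simp
    then have "mcong nonunits P (mat 1)" "mcong nonunits P' (mat 1)" "mcong nonunits D (mat 1)" "mcong nonunits D' (mat 1)"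
      unfolding P_def P'_def D_def D'_def mat_1_mat2 by (simp_all add: unit_iff_residue ef rd rc)
    then have "mcong nonunits (D' ** P' ** g ** (P ** D)) (mat 1 ** mat 1 ** M ** (mat 1 ** mat 1))"
      by (intro G.mcong_nonunits_mult g)
    then have "mcong nonunits (C' ** g ** C) M" by (simp add: C_def C'_def matrix_mul_rid)
    then show "\<exists>g\<in>\<Gamma>2. mcong nonunits g M" unfolding \<Gamma>2 using g(1) by blast
  qed
  interpret profinite_residual_group NN R \<Gamma>2 s1 s2 r r' \<alpha> \<gamma>0 \<delta>0
  proof
    fix N S assume N: "N \<in> NN" "N \<inter> R \<subseteq> S" "S \<subseteq> R" "1 \<in> S"
      "\<And>s t. s \<in> S \<Longrightarrow> t \<in> S \<Longrightarrow> s - t \<in> S" "\<And>s t. s \<in> S \<Longrightarrow> t \<in> S \<Longrightarrow> s * t \<in> S"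
      and tr: "\<And>g v. g \<in> \<Gamma>2 \<Longrightarrow> det g * v = 1 \<Longrightarrow> (trace g)\<^sup>2 * v \<in> S"
    show "R \<subseteq> S"
    proof (rule generated[OF N])
      fix g v assume g: "g \<in> \<Gamma>" "det g * v = 1"
      have dC: "det C * det C' = 1" using C(1) by (metis det_I det_mul)
      have "det (C' ** g ** C) = (det C * det C') * det g" by (simp add: det_mul)
      then have "det (C' ** g ** C) * v = 1" using g(2) dC by simp
      from tr[OF _ this] have "(trace (C' ** g ** C))\<^sup>2 * v \<in> S" using g(1) unfolding \<Gamma>2 by blast
      moreover have "trace (C' ** g ** C) = trace g"
      proof -
        have "trace (C' ** g ** C) = trace (C ** (C' ** g))" by (rule trace_mul_sym)
        then show ?thesis unfolding matrix_mul_assoc C(1) matrix_mul_lid .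
      qed
      ultimately show "(trace g)\<^sup>2 * v \<in> S" by simp
    qed
  qed
  have "\<exists>g\<in>\<Gamma>. mcong N (C' ** g ** C) M" if "N \<in> NN" "M \<in> mats R" "det M = 1" for N M
    using SL_mod_N[OF that] unfolding \<Gamma>2 by blast
  with C show ?thesis by blast
qed

end

section \<open>Image of the representation\<close>

lemma map_matrix_to_fract_mult:
  "map_matrix to_fract (M ** N) = map_matrix to_fract M ** map_matrix to_fract (N :: 'a::idom ^ 2 ^ 2)"
  by (simp add: vec_eq_iff matrix_matrix_mult_def sum_2)

lemma map_matrix_to_fract_1: "map_matrix to_fract (mat 1 :: 'a::idom ^ 2 ^ 2) = mat 1"
  by (simp add: vec_eq_iff mat_def)

theorem theorem3:
  fixes p :: nat
    and G :: "('g, 'm) monoid_scheme"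
    and T :: "'g topology"
    and \<rho> :: "'g \<Rightarrow>
      'a :: {idom, local_ring, topological_ab_group_add, topological_semigroup_mult} ^ 2 ^ 2"
  assumes "Factorial_Ring.prime p" and "odd p"
    and "local_pro_p_ring p TYPE('a)"
    and "profinite_group G T" and "p_finite p G T"
    and "\<rho> \<in> hom G GL" and "continuous_map T euclidean \<rho>"
    and "semisimple_rep G (residual_rep \<rho>)" and "multiplicity_free_rep G (residual_rep \<rho>)"
    and "card (adjoint_trace_residue_field G \<rho>) \<ge> 7"
    and "SL (adjoint_trace_residue_field G \<rho>) \<subseteq> residual_rep \<rho> ` carrier G"
  shows "\<exists>x :: 'a fract ^ 2 ^ 2. invertible x \<and>
    map_matrix to_fract ` SL (adjoint_trace_ring G \<rho>) \<subseteq>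
      (\<lambda>g. matrix_inv x ** map_matrix to_fract (\<rho> g) ** x) ` carrier G"
proof -
  have pro: "pro_p_ring p TYPE('a)" using assms(3) by (simp add: local_pro_p_ring_def)
  obtain NN :: "'a set set" where NN: "profinite_local_ring NN"
    using profinite_local_ring_of_pro_p[OF pro assms(2)] .
  interpret profinite_local_ring NN by (rule NN)
  have top: "group G" "compact_space T" "topspace T = carrier G"
    using assms(4) by (simp_all add: profinite_group_def topological_group_def)
  interpret grp: group G by (rule top(1))
  have hom: "\<rho> (g \<otimes>\<^bsub>G\<^esub> h) = \<rho> g ** \<rho> h" if "g \<in> carrier G" "h \<in> carrier G" for g h
    using hom_mult[OF assms(6) that] by (simp add: GL_def)
  have inv: "invertible (\<rho> g)" if "g \<in> carrier G" for g
    using assms(6) that by (auto simp: hom_def GL_def)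
  have hom_one: "\<rho> \<one>\<^bsub>G\<^esub> = mat 1"
  proof -
    obtain k where k: "k ** \<rho> \<one>\<^bsub>G\<^esub> = mat 1" using inv[OF grp.one_closed] unfolding invertible_def by blast
    have "\<rho> \<one>\<^bsub>G\<^esub> ** \<rho> \<one>\<^bsub>G\<^esub> = \<rho> \<one>\<^bsub>G\<^esub>" using hom[OF grp.one_closed grp.one_closed] by simp
    then have "k ** \<rho> \<one>\<^bsub>G\<^esub> ** \<rho> \<one>\<^bsub>G\<^esub> = k ** \<rho> \<one>\<^bsub>G\<^esub>" by (simp only: matrix_mul_assoc[symmetric])
    then show ?thesis using k by simp
  qed
  have det_unit: "\<exists>v. det (\<rho> g) * v = 1" if "g \<in> carrier G" for g
    using inv[OF that] unfolding invertible_def by (metis det_I det_mul)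
  let ?A = "ring_of_type_algebra :: 'a ring"
  define S0 where "S0 = {t. \<exists>g\<in>carrier G. t * det (\<rho> g) = (trace (\<rho> g))\<^sup>2}"
  define R0 where "R0 = generate_ring ?A S0"
  define R where "R = adjoint_trace_ring G \<rho>"
  have R: "R = closure R0" by (simp add: R_def R0_def S0_def adjoint_trace_ring_def)
  have R0_one: "1 \<in> R0" using generate_ring.one[of ?A S0] by (simp add: R0_def)
  have R0_minus: "- x \<in> R0" if "x \<in> R0" for x using generate_ring.a_inv[of x ?A S0] that by (simp add: R0_def)
  have R0_add: "x + y \<in> R0" if "x \<in> R0" "y \<in> R0" for x y
    using generate_ring.eng_add[of x ?A S0 y] that by (simp add: R0_def)
  have R0_mult: "x * y \<in> R0" if "x \<in> R0" "y \<in> R0" for x y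
    using generate_ring.eng_mult[of x ?A S0 y] that by (simp add: R0_def)
  have R0_diff: "x - y \<in> R0" if "x \<in> R0" "y \<in> R0" for x y
    using R0_add[OF that(1) R0_minus[OF that(2)]] by simp
  have closed_R: "closure R = R" by (simp add: R)
  have R_one: "1 \<in> R" unfolding R using R0_one closure_subset by blast
  have R_diff: "x - y \<in> R" and R_mult: "x * y \<in> R" if "x \<in> R" "y \<in> R" for x y
    using closure_subring[of R0, OF R0_diff R0_mult] that unfolding R by blast+
  interpret Rsub: local_subring R
  proof
    show "y \<in> R" if "x \<in> R" "x * y = 1" for x y
      by (rule closed_subring_inverse[OF closed_R R_mult R_one that])
  qed (use R_one R_diff R_mult two_unit in auto)
  let ?\<Gamma> = "\<rho> ` carrier G"
  have trace_S0: "(trace (\<rho> g))\<^sup>2 * v \<in> S0" if "g \<in> carrier G" "det (\<rho> g) * v = 1" for g v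
  proof -
    have "(trace (\<rho> g))\<^sup>2 * v * det (\<rho> g) = (trace (\<rho> g))\<^sup>2" using that(2) by Groebner_Basis.algebra
    then show ?thesis unfolding S0_def using that(1) by blast
  qed
  have S0_R0: "S0 \<subseteq> R0" unfolding R0_def by (auto intro: generate_ring.incl)
  have adj: "adjoint_group R ?\<Gamma>"
  proof
    show "mat 1 \<in> ?\<Gamma>" using hom_one grp.one_closed by (metis image_eqI)
    fix g assume "g \<in> ?\<Gamma>"
    then obtain g' where g: "g' \<in> carrier G" "g = \<rho> g'" by blast
    show "g ** h \<in> ?\<Gamma>" if "h \<in> ?\<Gamma>" for h using that g hom by (auto simp: image_iff) (metis grp.m_closed)
    have "g ** \<rho> (inv\<^bsub>G\<^esub> g') = mat 1" using hom[OF g(1) grp.inv_closed[OF g(1)]] g hom_one by simp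
    then show "\<exists>h\<in>?\<Gamma>. g ** h = mat 1" using grp.inv_closed[OF g(1)] by blast
    show "(trace g)\<^sup>2 * v \<in> R" if "det g * v = 1" for v
      using trace_S0[OF g(1)] that S0_R0 closure_subset unfolding R g(2) by blast
  qed
  have R_E: "residue ` R = adjoint_trace_residue_field G \<rho>"
    unfolding R_def using det_unit by (intro adjoint_trace_ring_residue[OF assms(3)]) (metis dvdI)
  have residual: "\<exists>g\<in>?\<Gamma>. mcong nonunits g M" if M: "M \<in> mats R" "det M = 1" for M
  proof -
    have "map_matrix residue M \<in> SL (adjoint_trace_residue_field G \<rho>)"
    proof -
      have "residue (det M) = 1" using M(2) by simp
      then have "det (map_matrix residue M) = 1" by (simp add: det_2)
      then show ?thesis using M(1) unfolding SL_def mats_def R_E[symmetric] by simp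
    qed
    then obtain g where g: "g \<in> carrier G" "map_matrix residue M = residual_rep \<rho> g" using assms(11) by blast
    have "residue (\<rho> g $ i $ k) = residue (M $ i $ k)" for i k
      using arg_cong[OF g(2), of "\<lambda>K. K $ i $ k"] by (simp add: residual_rep_def)
    then have "mcong nonunits (\<rho> g) M" by (simp add: mcong_def unit_iff_residue)
    then show ?thesis using g(1) by blast
  qed
  have generated: "R \<subseteq> S" if N: "N \<in> NN" "N \<inter> R \<subseteq> S" and S: "S \<subseteq> R" "1 \<in> S"
      "\<And>s t. s \<in> S \<Longrightarrow> t \<in> S \<Longrightarrow> s - t \<in> S" "\<And>s t. s \<in> S \<Longrightarrow> t \<in> S \<Longrightarrow> s * t \<in> S"
      and tr: "\<And>g v. g \<in> ?\<Gamma> \<Longrightarrow> det g * v = 1 \<Longrightarrow> (trace g)\<^sup>2 * v \<in> S" for N S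
  proof -
    have S_zero: "0 \<in> S" using S(3)[OF S(2) S(2)] by simp
    have S_minus: "- s \<in> S" if "s \<in> S" for s using S(3)[OF S_zero that] by simp
    have S_add: "s + t \<in> S" if "s \<in> S" "t \<in> S" for s t using S(3)[OF that(1) S_minus[OF that(2)]] by simp
    have R0_S: "x \<in> S" if "x \<in> R0" for x
      using that unfolding R0_def
    proof induction
      case (incl t)
      then obtain g where g: "g \<in> carrier G" "t * det (\<rho> g) = (trace (\<rho> g))\<^sup>2" by (auto simp: S0_def)
      obtain v where v: "det (\<rho> g) * v = 1" using det_unit[OF g(1)] by blast
      have "t = (trace (\<rho> g))\<^sup>2 * v" using g(2) v by Groebner_Basis.algebra
      then show ?case using tr[OF imageI[OF g(1)] v] by simp
    qed (use S S_minus S_add in auto)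
    show "R \<subseteq> S"
    proof
      fix x assume x: "x \<in> R"
      then obtain y where y: "y \<in> R0" "x - y \<in> N" using N(1) unfolding R closure_iff by blast
      have "y \<in> R" using y(1) closure_subset unfolding R by blast
      then have "x - y \<in> S" using N(2) y(2) R_diff[OF x] by blast
      from S_add[OF this R0_S[OF y(1)]] show "x \<in> S" by simp
    qed
  qed
  obtain e where e: "e \<in> adjoint_trace_residue_field G \<rho>" "e \<noteq> 0" "e ^ 4 \<noteq> 1"
    using exists_fourth_power_ne_1[OF assms(10)] by blast
  obtain a where a: "a \<in> R" "residue a \<noteq> 0" "residue a ^ 4 \<noteq> 1"
    using e unfolding R_E[symmetric] by blast
  have "\<exists>y y'. y ** y' = mat 1 \<and> y' ** y = mat 1 \<and>
      (\<forall>N\<in>NN. \<forall>M\<in>mats R. det M = 1 \<longrightarrow> (\<exists>g\<in>?\<Gamma>. mcong N (y' ** g ** y) M))"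
    by (rule SL_approximation[OF adj closed_R _ _ a]) (fact residual, rule generated)
  then obtain y y' where y: "y ** y' = mat 1" "y' ** y = mat 1"
    and approx: "\<And>N M. N \<in> NN \<Longrightarrow> M \<in> mats R \<Longrightarrow> det M = 1 \<Longrightarrow> \<exists>g\<in>?\<Gamma>. mcong N (y' ** g ** y) M"
    by blast
  have image: "\<exists>g\<in>carrier G. M = y' ** \<rho> g ** y" if M: "M \<in> SL R" for M
  proof -
    have M': "M \<in> mats R" "det M = 1" using M by (simp_all add: SL_def mats_def)
    \<comment> \<open>The target is conjugated instead of the representation, whose continuity is given.\<close>
    have "\<exists>g\<in>topspace T. \<rho> g = y ** M ** y'"
    proof (rule compact_image_attains[OF top(2) assms(7)])
      fix N assume N: "N \<in> NN"
      obtain g where g: "g \<in> carrier G" "mcong N (y' ** \<rho> g ** y) M" using approx[OF N M'] by blast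
      have all: "K \<in> mats (UNIV :: 'a set)" for K by (simp add: mats_def)
      have "mcong N (y ** (y' ** \<rho> g ** y) ** y') (y ** M ** y')"
        by (intro whole.mcong_mult[OF N_ideal[OF N]] whole.mcong_refl[OF N_ideal[OF N]] g(2) all)
      moreover have "y ** (y' ** \<rho> g ** y) ** y' = (y ** y') ** \<rho> g ** (y ** y')"
        by (simp only: matrix_mul_assoc)
      then have "y ** (y' ** \<rho> g ** y) ** y' = \<rho> g" unfolding y(1) by (simp add: matrix_mul_rid)
      ultimately show "\<exists>g\<in>topspace T. mcong N (\<rho> g) (y ** M ** y')" using g(1) top(3) by auto
    qed
    then obtain g where g: "g \<in> carrier G" "\<rho> g = y ** M ** y'" using top(3) by auto
    have "y' ** \<rho> g ** y = (y' ** y) ** M ** (y' ** y)" unfolding g(2) by (simp only: matrix_mul_assoc)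
    then have "y' ** \<rho> g ** y = M" unfolding y(2) by (simp add: matrix_mul_rid)
    then show ?thesis using g(1) by metis
  qed
  let ?x = "map_matrix to_fract y" and ?x' = "map_matrix to_fract y'"
  have x: "?x ** ?x' = mat 1" "?x' ** ?x = mat 1"
    using y by (simp_all add: map_matrix_to_fract_mult[symmetric] map_matrix_to_fract_1)
  have inv_x: "invertible ?x" unfolding invertible_def using x by blast
  have "matrix_inv ?x = ?x'"
  proof -
    have "matrix_inv ?x ** ?x = mat 1"
      using someI_ex[OF inv_x[unfolded invertible_def]] unfolding matrix_inv_def by blast
    then have "matrix_inv ?x ** ?x ** ?x' = ?x'" by simp
    then show ?thesis unfolding matrix_mul_assoc[symmetric] x(1) by (simp add: matrix_mul_rid)
  qed
  then have "map_matrix to_fract M = matrix_inv ?x ** map_matrix to_fract (\<rho> g) ** ?x"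
    if "M = y' ** \<rho> g ** y" for M g
    unfolding that map_matrix_to_fract_mult by (simp only:)
  then have "map_matrix to_fract ` SL R \<subseteq> (\<lambda>g. matrix_inv ?x ** map_matrix to_fract (\<rho> g) ** ?x) ` carrier G"
    using image by blast
  then show ?thesis using inv_x unfolding R_def by blast
qed

end
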